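(* Let $(V,\omega)$ be a $2n$-dimensional real symplectic space, $L_1,L_2,L_3\in\Lambda(V,\omega)$, $\psi:[0,T]\to\mathrm{Sp}(V,\omega)$ of class $\mathscr C^1$ with $\psi(0)=\mathrm{Id}$, and $\ell_i(t)=\psi(t)L_i$ for $i=1,2$. Let $k\in\mathbb N$ and assume: (1) $\ell_2$ is an $L_3$-plus curve; (2) $\iota(L_1,L_2,L_3)=n-\dim(L_1\cap L_2)$; (3) $\dim(L_3\cap L_2)=k$; (4) $\iota^{\mathrm{CLM}}(L_3,\ell_1(t);t\in[0,T])=k$. Then $\iota^{\mathrm{CLM}}(L_3,\ell_2(t);t\in[0,T])=k$.
   Context: $\Lambda(V,\omega)$ is the Lagrangian Grassmannian of $(V,\omega)$. For $L_0\in\Lambda(V,\omega)$ and a continuous path $\ell:[a,b]\to\Lambda(V,\omega)$, $\iota^{\mathrm{CLM}}(L_0,\ell(t);t\in[a,b])\in\mathbb Z$ denotes the Cappell–Lee–Miller Maslov index: the intersection index of $\ell$ with the Maslov cycle $\Sigma(L_0)=\{L: L\cap L_0\neq\{0\}\}$; it is invariant under fixed-endpoint homotopies, additive under concatenation, and for $\mathscr C^1$ paths with only regular crossings equals $n_+(\Gamma(\ell,L_0,a))+\sum_{a<t<b}\operatorname{sgn}\Gamma(\ell,L_0,t)-n_-(\Gamma(\ell,L_0,b))$, where a crossing is $t_0$ with $\ell(t_0)\cap L_0\ne\{0\}$, the crossing form on $\ell(t_0)\cap L_0$ is $\Gamma(\ell,L_0,t_0)[v]=\frac{d}{dt}|_{t=t_0}\omega(v,w(t))$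 with $w(t)$ the unique vector in a fixed Lagrangian $W$ transversal to $\ell(t_0)$ such that $v+w(t)\in\ell(t)$, and regular means nondegenerate. A $\mathscr C^1$ curve $\ell$ is an $L_0$-plus curve if at each crossing the crossing form is positive definite. Triple index: for $\alpha,\beta,\gamma\in\Lambda(V,\omega)$ let $Q(\alpha,\beta;\gamma)$ be the quadratic form on $\alpha\cap(\beta+\gamma)$ given by $Q(\alpha,\beta;\gamma)(x)=\omega(y,z)$ where $x=y+z$ with $y\in\beta$, $z\in\gamma$ (independent of the decomposition); then $\iota(\alpha,\beta,\gamma)=n_+\big(Q(\alpha,\beta;\gamma)\big)+\dim(\alpha\cap\gamma)-\dim(\alpha\cap\beta\cap\gamma)$, where $n_+$ is the positive inertia index. *)

theory Defs
  imports "HOL-Analysis.Analysis"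
begin

text \<open>The symplectic space V is modelled as a Euclidean space type 'v (finite dimensional
real vector space; the inner product is only used to topologize the Lagrangian Grassmannian).\<close>

definition symplectic_form :: "('v::euclidean_space \<Rightarrow> 'v \<Rightarrow> real) \<Rightarrow> bool" where
  "symplectic_form \<omega> \<longleftrightarrow> bilinear \<omega> \<and> (\<forall>x y. \<omega> x y = - \<omega> y x)
     \<and> (\<forall>x. (\<forall>y. \<omega> x y = 0) \<longrightarrow> x = 0)"

definition lagrangian :: "('v::euclidean_space \<Rightarrow> 'v \<Rightarrow> real) \<Rightarrow> 'v set \<Rightarrow> bool" where
  "lagrangian \<omega> L \<longleftrightarrow> subspace L \<and> (\<forall>x\<in>L. \<forall>y\<in>L. \<omega> x y = 0) \<and> 2 * dim L = DIM('v)"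

definition symplectic_map :: "('v::euclidean_space \<Rightarrow> 'v \<Rightarrow> real) \<Rightarrow> ('v \<Rightarrow>\<^sub>L 'v) \<Rightarrow> bool" where
  "symplectic_map \<omega> A \<longleftrightarrow> bij (blinfun_apply A) \<and> (\<forall>x y. \<omega> (A x) (A y) = \<omega> x y)"

definition pos_index :: "('v::euclidean_space \<Rightarrow> real) \<Rightarrow> 'v set \<Rightarrow> nat" where
  "pos_index q S = Max {dim U | U. subspace U \<and> U \<subseteq> S \<and> (\<forall>u\<in>U. u \<noteq> 0 \<longrightarrow> q u > 0)}"

definition neg_index :: "('v::euclidean_space \<Rightarrow> real) \<Rightarrow> 'v set \<Rightarrow> nat" where
  "neg_index q S = pos_index (\<lambda>x. - q x) S"

definition qf_signature :: "('v::euclidean_space \<Rightarrow> real) \<Rightarrow> 'v set \<Rightarrow> int" where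
  "qf_signature q S = int (pos_index q S) - int (neg_index q S)"

definition qf_nondegenerate :: "('v::euclidean_space \<Rightarrow> real) \<Rightarrow> 'v set \<Rightarrow> bool" where
  "qf_nondegenerate q S \<longleftrightarrow> (\<forall>u\<in>S. (\<forall>v\<in>S. q (u + v) - q u - q v = 0) \<longrightarrow> u = 0)"

definition qf_pos_def :: "('v::euclidean_space \<Rightarrow> real) \<Rightarrow> 'v set \<Rightarrow> bool" where
  "qf_pos_def q S \<longleftrightarrow> (\<forall>u\<in>S. u \<noteq> 0 \<longrightarrow> q u > 0)"

definition triple_Q :: "('v::euclidean_space \<Rightarrow> 'v \<Rightarrow> real) \<Rightarrow> 'v set \<Rightarrow> 'v set \<Rightarrow> 'v \<Rightarrow> real" where
  "triple_Q \<omega> \<beta> \<gamma> x = (let (y, z) = (SOME (y, z). y \<in> \<beta> \<and> z \<in> \<gamma> \<and> x = y + z) in \<omega> y z)"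

definition triple_index :: "('v::euclidean_space \<Rightarrow> 'v \<Rightarrow> real) \<Rightarrow> 'v set \<Rightarrow> 'v set \<Rightarrow> 'v set \<Rightarrow> int" where
  "triple_index \<omega> \<alpha> \<beta> \<gamma> =
     int (pos_index (triple_Q \<omega> \<beta> \<gamma>) (\<alpha> \<inter> {y + z | y z. y \<in> \<beta> \<and> z \<in> \<gamma>}))
     + int (dim (\<alpha> \<inter> \<gamma>)) - int (dim (\<alpha> \<inter> \<beta> \<inter> \<gamma>))"

text \<open>Hausdorff distance of the closed unit balls of two subspaces (the gap metric).\<close>
definition subspace_dist :: "'v::euclidean_space set \<Rightarrow> 'v set \<Rightarrow> real" where
  "subspace_dist L M = max (SUP x\<in>L \<inter> cball 0 1. infdist x M) (SUP y\<in>M \<inter> cball 0 1. infdist y L)"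

definition subspace_continuous_on :: "'a::metric_space set \<Rightarrow> ('a \<Rightarrow> 'v::euclidean_space set) \<Rightarrow> bool" where
  "subspace_continuous_on S H \<longleftrightarrow>
     (\<forall>p\<in>S. \<forall>e>0. \<exists>d>0. \<forall>q\<in>S. dist q p < d \<longrightarrow> subspace_dist (H q) (H p) < e)"

definition lag_path :: "('v::euclidean_space \<Rightarrow> 'v \<Rightarrow> real) \<Rightarrow> (real \<Rightarrow> 'v set) \<Rightarrow> real \<Rightarrow> real \<Rightarrow> bool" where
  "lag_path \<omega> l a b \<longleftrightarrow> (\<forall>t\<in>{a..b}. lagrangian \<omega> (l t)) \<and> subspace_continuous_on {a..b} l"

definition lag_homotopic :: "('v::euclidean_space \<Rightarrow> 'v \<Rightarrow> real) \<Rightarrow> real \<Rightarrow> real \<Rightarrow> (real \<Rightarrow> 'v set) \<Rightarrow> (real \<Rightarrow> 'v set) \<Rightarrow> bool" where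
  "lag_homotopic \<omega> a b l l' \<longleftrightarrow> (\<exists>H :: real \<times> real \<Rightarrow> 'v set.
      (\<forall>p\<in>{0..1} \<times> {a..b}. lagrangian \<omega> (H p))
    \<and> subspace_continuous_on ({0..1} \<times> {a..b}) H
    \<and> (\<forall>t\<in>{a..b}. H (0, t) = l t \<and> H (1, t) = l' t)
    \<and> (\<forall>s\<in>{0..1}. H (s, a) = l a \<and> H (s, b) = l b))"

definition C1_on_interval :: "real \<Rightarrow> real \<Rightarrow> (real \<Rightarrow> 'a::real_normed_vector) \<Rightarrow> bool" where
  "C1_on_interval a b f \<longleftrightarrow> (\<exists>f'. (\<forall>t\<in>{a..b}. (f has_vector_derivative f' t) (at t within {a..b}))
      \<and> continuous_on {a..b} f')"

definition lag_C1 :: "('v::euclidean_space \<Rightarrow> 'v \<Rightarrow> real) \<Rightarrow> (real \<Rightarrow> 'v set) \<Rightarrow> real \<Rightarrow> real \<Rightarrow> bool" where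
  "lag_C1 \<omega> l a b \<longleftrightarrow> (\<forall>t\<in>{a..b}. lagrangian \<omega> (l t)) \<and>
     (\<exists>F :: real \<Rightarrow> nat \<Rightarrow> 'v. (\<forall>t\<in>{a..b}. l t = span (F t ` {..<DIM('v) div 2}))
        \<and> (\<forall>i. C1_on_interval a b (\<lambda>t. F t i)))"

definition crossing_form :: "('v::euclidean_space \<Rightarrow> 'v \<Rightarrow> real) \<Rightarrow> (real \<Rightarrow> 'v set) \<Rightarrow> 'v set \<Rightarrow> real \<Rightarrow> real \<Rightarrow> real \<Rightarrow> 'v \<Rightarrow> real" where
  "crossing_form \<omega> l L0 a b t0 v =
     (let W = (SOME W. lagrangian \<omega> W \<and> W \<inter> l t0 = {0});
          w = (\<lambda>t. THE w. w \<in> W \<and> v + w \<in> l t)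
      in THE D. ((\<lambda>t. \<omega> v (w t)) has_real_derivative D) (at t0 within {a..b}))"

definition is_crossing :: "(real \<Rightarrow> 'v::euclidean_space set) \<Rightarrow> 'v set \<Rightarrow> real \<Rightarrow> bool" where
  "is_crossing l L0 t \<longleftrightarrow> l t \<inter> L0 \<noteq> {0}"

definition regular_crossings :: "('v::euclidean_space \<Rightarrow> 'v \<Rightarrow> real) \<Rightarrow> (real \<Rightarrow> 'v set) \<Rightarrow> 'v set \<Rightarrow> real \<Rightarrow> real \<Rightarrow> bool" where
  "regular_crossings \<omega> l L0 a b \<longleftrightarrow> (\<forall>t\<in>{a..b}. is_crossing l L0 t \<longrightarrow>
      qf_nondegenerate (crossing_form \<omega> l L0 a b t) (l t \<inter> L0))"

definition plus_curve :: "('v::euclidean_space \<Rightarrow> 'v \<Rightarrow> real) \<Rightarrow> (real \<Rightarrow> 'v set) \<Rightarrow> 'v set \<Rightarrow> real \<Rightarrow> real \<Rightarrow> bool" where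
  "plus_curve \<omega> l L0 a b \<longleftrightarrow> lag_C1 \<omega> l a b \<and> (\<forall>t\<in>{a..b}. is_crossing l L0 t \<longrightarrow>
      qf_pos_def (crossing_form \<omega> l L0 a b t) (l t \<inter> L0))"

definition maslov_regular :: "('v::euclidean_space \<Rightarrow> 'v \<Rightarrow> real) \<Rightarrow> 'v set \<Rightarrow> (real \<Rightarrow> 'v set) \<Rightarrow> real \<Rightarrow> real \<Rightarrow> int" where
  "maslov_regular \<omega> L0 l a b =
     int (pos_index (crossing_form \<omega> l L0 a b a) (l a \<inter> L0))
     + (\<Sum>t\<in>{t. a < t \<and> t < b \<and> is_crossing l L0 t}. qf_signature (crossing_form \<omega> l L0 a b t) (l t \<inter> L0))
     - int (neg_index (crossing_form \<omega> l L0 a b b) (l b \<inter> L0))"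

text \<open>Cappell--Lee--Miller index of a continuous path: the crossing formula of any C^1 path with
only regular crossings homotopic to it with fixed endpoints (well defined by homotopy invariance).\<close>
definition iota_CLM :: "('v::euclidean_space \<Rightarrow> 'v \<Rightarrow> real) \<Rightarrow> 'v set \<Rightarrow> (real \<Rightarrow> 'v set) \<Rightarrow> real \<Rightarrow> real \<Rightarrow> int" where
  "iota_CLM \<omega> L0 l a b = (THE m. \<exists>l'. lag_C1 \<omega> l' a b \<and> regular_crossings \<omega> l' L0 a b
       \<and> lag_homotopic \<omega> a b l l' \<and> m = maslov_regular \<omega> L0 l' a b)"

end

theory Submission
  imports Defs
begin

text \<open>
  Fix a Lagrangian \<open>C\<close>. If \<open>W\<close> is transversal to \<open>L\<close>, let \<open>chart_index C W L\<close> be the positive index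
  on \<open>C\<close> of \<open>x \<mapsto> \<omega> x (P x)\<close>, where \<open>P\<close> projects onto \<open>L\<close> along \<open>W\<close>. A cocycle identity relates the
  chart indices of two Lagrangians, their triple index with \<open>C\<close>, and a form whose nullity does not
  involve \<open>C\<close>. It shows that two chart indices differ by a locally constant function of \<open>L\<close>, so they
  glue along paths and homotopies to an integer primitive. At a regular crossing the primitive jumps
  by the indices of the crossing form, hence the crossing formula is the increment of the primitive
  and is invariant under homotopy. Every path \<open>\<psi> t ` L\<close> has a regular representative, obtained by
  rotating it with a compatible complex structure.

  The same cocycle identity shows that the indices of \<open>\<psi> t ` L1\<close> and \<open>\<psi> t ` L2\<close> differ by the change
  of the triple index between the endpoints. The triple index is maximal at \<open>t = 0\<close>, so the index of
  the second path is at most \<open>k\<close>. It is at least \<open>k\<close>, because the path is a plus curve that starts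
  with a \<open>k\<close>-dimensional crossing.
\<close>

subsection \<open>Symmetric forms and their inertia indices\<close>

abbreviation sum_space :: "'a::euclidean_space set \<Rightarrow> 'a set \<Rightarrow> 'a set" where
  "sum_space S T \<equiv> {x + y | x y. x \<in> S \<and> y \<in> T}"

lemma sum_space_subset:
  assumes "subspace E" "S \<subseteq> E" "T \<subseteq> E"
  shows "sum_space S T \<subseteq> E"
  using assms by (auto intro: subspace_add)

lemma dim_sum_space_disjoint:
  assumes "subspace S" "subspace T" "S \<inter> T \<subseteq> {0}"
  shows "dim (sum_space S T) = dim S + dim T"
proof -
  have "dim (S \<inter> T) = 0" using assms(3) by (simp add: dim_eq_0)
  then show ?thesis using dim_sums_Int[OF assms(1,2)] by linarith
qed

lemma dim_image_inj_on:
  fixes f :: "'a::euclidean_space \<Rightarrow> 'b::euclidean_space"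
  assumes "linear f" "subspace S" "inj_on f S"
  shows "dim (f ` S) = dim S"
  using dim_image_eq[OF assms(1), of S] assms(2,3) by (simp add: span_eq_iff[THEN iffD2])

lemma dim_kernel_image:
  fixes f :: "'a::euclidean_space \<Rightarrow> 'b::euclidean_space"
  assumes f: "linear f" and S: "subspace S"
  shows "dim (f ` S) + dim {x\<in>S. f x = 0} = dim S"
proof -
  let ?K = "{x\<in>S. f x = 0}"
  obtain g where g: "range g \<subseteq> S" "linear g" "\<And>y. y \<in> f ` S \<Longrightarrow> f (g y) = y"
    using linear_exists_right_inverse_on[OF f S] by blast
  have image: "subspace (f ` S)" by (rule linear_subspace_image[OF f S])
  have kernel: "subspace ?K"
    using S f by (auto simp: subspace_def linear_add linear_scale linear_0)
  have section_image: "subspace (g ` f ` S)" by (rule linear_subspace_image[OF g(2) image])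
  have "sum_space (g ` f ` S) ?K = S"
  proof (intro equalityI sum_space_subset S subsetI)
    fix x assume x: "x \<in> S"
    have "f (x - g (f x)) = 0" using g(3) x by (simp add: linear_diff[OF f])
    moreover have "x - g (f x) \<in> S" using x g(1) S by (intro subspace_diff) auto
    moreover have "x = g (f x) + (x - g (f x))" by simp
    ultimately show "x \<in> sum_space (g ` f ` S) ?K" using x by blast
  qed (use g(1) in auto)
  moreover have "g ` f ` S \<inter> ?K \<subseteq> {0}" using g(3) linear_0[OF g(2)] by force
  moreover have "dim (g ` f ` S) = dim (f ` S)"
    by (intro dim_image_inj_on g(2) image inj_on_inverseI[of _ f]) (rule g(3))
  ultimately show ?thesis using dim_sum_space_disjoint[OF section_image kernel] by simp
qed

definition annihilator :: "('a::euclidean_space \<Rightarrow> 'b::euclidean_space \<Rightarrow> real) \<Rightarrow> 'a set \<Rightarrow> 'b set \<Rightarrow> 'b set"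
  where "annihilator B U S = {x\<in>S. \<forall>u\<in>U. B u x = 0}"

abbreviation form_radical :: "('a::euclidean_space \<Rightarrow> 'a \<Rightarrow> real) \<Rightarrow> 'a set \<Rightarrow> 'a set" where
  "form_radical B S \<equiv> annihilator B S S"

lemma annihilator_subset: "annihilator B U S \<subseteq> S"
  by (auto simp: annihilator_def)

lemma subspace_annihilator:
  assumes "bilinear B" "subspace S"
  shows "subspace (annihilator B U S)"
  using assms by (auto simp: annihilator_def subspace_def bilinear_rzero bilinear_radd bilinear_rmul)

lemma bilinear_uminus: "bilinear B \<Longrightarrow> bilinear (\<lambda>x y. - B x y :: real)"
  by (simp add: bilinear_def linear_compose_neg)

lemma bilinear_add: "bilinear B \<Longrightarrow> bilinear C \<Longrightarrow> bilinear (\<lambda>x y. B x y + C x y :: real)"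
  by (simp add: bilinear_def linear_compose_add)

lemma bilinear_divide: "bilinear B \<Longrightarrow> bilinear (\<lambda>x y. B x y / c :: real)"
  by (simp add: bilinear_def linear_iff add_divide_distrib)

lemma bilinear_compose:
  assumes "bilinear B" "linear f" "linear g"
  shows "bilinear (\<lambda>x y. B (f x) (g y) :: real)"
  using assms unfolding bilinear_def
  by (auto intro: linear_compose[unfolded o_def, of _ "B _"]
      linear_compose[unfolded o_def, of _ "\<lambda>x. B x _"])

lemma bilinear_represented:
  fixes B :: "'a::euclidean_space \<Rightarrow> 'b::euclidean_space \<Rightarrow> real"
  assumes B: "bilinear B"
  obtains T where "linear T" "\<And>u x. T u \<bullet> x = B u x"
proof -
  define T where "T u = adjoint (B u) 1" for u
  have T: "T u \<bullet> x = B u x" for u x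
    using adjoint_works[of "B u" x 1] B by (simp add: T_def bilinear_def inner_commute)
  moreover have "linear T"
    by (rule linearI; rule vector_eq_rdot[THEN iffD1])
      (simp_all add: inner_add_left T bilinear_ladd[OF B] bilinear_lmul[OF B])
  ultimately show ?thesis using that by blast
qed

lemma dim_annihilator:
  fixes B :: "'a::euclidean_space \<Rightarrow> 'b::euclidean_space \<Rightarrow> real"
  assumes B: "bilinear B" and U: "subspace U" and S: "subspace S"
  shows "dim (annihilator B U S) + dim U = dim S + dim (annihilator (\<lambda>x u. B u x) S U)"
proof -
  obtain \<pi> where \<pi>: "range \<pi> \<subseteq> S" "linear \<pi>" "\<And>x. x \<in> S \<Longrightarrow> \<pi> x = x"
    using linear_exists_left_inverse_on[OF linear_id S] by auto
  have "bilinear (\<lambda>u x. B u (\<pi> x))" by (rule bilinear_compose[OF B linear_ident \<pi>(2)])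
  then obtain T where T: "linear T" "\<And>u x. T u \<bullet> x = B u (\<pi> x)" using bilinear_represented by blast
  define Y where "Y = {y\<in>UNIV. \<forall>x\<in>T ` U. orthogonal x y}"
  have in_Y: "y \<in> Y \<longleftrightarrow> (\<forall>u\<in>U. B u (\<pi> y) = 0)" for y by (auto simp: Y_def orthogonal_def T)
  have "\<pi> ` Y = annihilator B U S"
  proof (intro equalityI subsetI)
    fix x assume x: "x \<in> annihilator B U S"
    then have "\<pi> x = x" using \<pi>(3) by (simp add: annihilator_def)
    then have "x \<in> Y" using x by (simp add: annihilator_def in_Y)
    then show "x \<in> \<pi> ` Y" using \<open>\<pi> x = x\<close> by (metis imageI)
  qed (use \<pi>(1) in \<open>auto simp: annihilator_def in_Y\<close>)
  moreover have "{y\<in>Y. \<pi> y = 0} = {y\<in>UNIV. \<pi> y = 0}"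
    by (auto simp: in_Y bilinear_rzero[OF B])
  moreover have "subspace Y" by (auto simp: Y_def subspace_def orthogonal_def inner_right_distrib)
  ultimately have dim_Y: "dim (annihilator B U S) + dim {y\<in>UNIV. \<pi> y = 0} = dim Y"
    using dim_kernel_image[OF \<pi>(2), of Y] by simp
  have "\<pi> ` UNIV = S" using \<pi>(1,3) by (metis rangeI subsetI subset_antisym)
  then have dim_\<pi>: "dim S + dim {y\<in>UNIV. \<pi> y = 0} = dim (UNIV :: 'b set)"
    using dim_kernel_image[OF \<pi>(2) subspace_UNIV] by simp
  have dim_Y_perp: "dim Y + dim (T ` U) = dim (UNIV :: 'b set)"
    unfolding Y_def
    by (intro dim_subspace_orthogonal_to_vectors linear_subspace_image T(1) U) auto
  have "T u = 0 \<longleftrightarrow> (\<forall>x\<in>S. B u x = 0)" for u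
  proof
    assume "T u = 0"
    then show "\<forall>x\<in>S. B u x = 0" using T(2)[of u] \<pi>(3) by (metis inner_zero_left)
  next
    assume "\<forall>x\<in>S. B u x = 0"
    then have "T u \<bullet> T u = 0" unfolding T(2) using \<pi>(1) by (simp add: image_subset_iff)
    then show "T u = 0" by simp
  qed
  then have "{u\<in>U. T u = 0} = annihilator (\<lambda>x u. B u x) S U" by (auto simp: annihilator_def)
  then have "dim (T ` U) + dim (annihilator (\<lambda>x u. B u x) S U) = dim U"
    using dim_kernel_image[OF T(1) U] by simp
  then show ?thesis using dim_Y dim_\<pi> dim_Y_perp by linarith
qed

lemma pos_index_set_finite:
  "finite {dim U | U. subspace U \<and> U \<subseteq> S \<and> (\<forall>u\<in>U. u \<noteq> 0 \<longrightarrow> q u > (0::real))}"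
  for S :: "'a::euclidean_space set"
  by (rule finite_subset[of _ "{..DIM('a)}"]) (auto simp: dim_subset_UNIV)

lemma pos_index_ge:
  assumes "subspace U" "U \<subseteq> S" "qf_pos_def q U"
  shows "dim U \<le> pos_index q S"
  unfolding pos_index_def using assms
  by (intro Max_ge pos_index_set_finite) (auto simp: qf_pos_def_def)

lemma pos_index_attained:
  assumes "subspace S"
  obtains U where "subspace U" "U \<subseteq> S" "qf_pos_def q U" "dim U = pos_index q S"
proof -
  let ?A = "{dim U | U. subspace U \<and> U \<subseteq> S \<and> (\<forall>u\<in>U. u \<noteq> 0 \<longrightarrow> q u > (0::real))}"
  have "dim {0::'a} \<in> ?A" using subspace_0[OF assms] by (intro CollectI exI[of _ "{0}"]) auto
  then have "Max ?A \<in> ?A" by (intro Max_in pos_index_set_finite) auto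
  then show ?thesis using that unfolding pos_index_def qf_pos_def_def by auto
qed

lemma pos_index_mono:
  assumes "subspace T" "T \<subseteq> S"
  shows "pos_index q T \<le> pos_index q S"
proof -
  obtain U where "subspace U" "U \<subseteq> T" "qf_pos_def q U" "dim U = pos_index q T"
    using pos_index_attained[OF assms(1)] .
  then show ?thesis using pos_index_ge[of U S q] assms(2) by auto
qed

lemma pos_index_cong:
  assumes "\<And>x. x \<in> S \<Longrightarrow> q x = q' x"
  shows "pos_index q S = pos_index q' S"
proof -
  have "(subspace U \<and> U \<subseteq> S \<and> (\<forall>u\<in>U. u \<noteq> 0 \<longrightarrow> q u > 0)) \<longleftrightarrow>
    (subspace U \<and> U \<subseteq> S \<and> (\<forall>u\<in>U. u \<noteq> 0 \<longrightarrow> q' u > 0))" for U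
    using assms by (auto simp: subset_iff)
  then show ?thesis unfolding pos_index_def by simp
qed

lemma pos_index_add_nonpos_le:
  assumes S: "subspace S" and V: "subspace V" "V \<subseteq> S" "\<And>v. v \<in> V \<Longrightarrow> q v \<le> 0"
  shows "pos_index q S + dim V \<le> dim S"
proof -
  obtain U where U: "subspace U" "U \<subseteq> S" "qf_pos_def q U" "dim U = pos_index q S"
    using pos_index_attained[OF S] .
  have "U \<inter> V \<subseteq> {0}" using U(3) V(3) by (force simp: qf_pos_def_def)
  then have "dim (sum_space U V) = dim U + dim V" by (rule dim_sum_space_disjoint[OF U(1) V(1)])
  moreover have "dim (sum_space U V) \<le> dim S"
    by (intro dim_subset sum_space_subset S U V)
  ultimately show ?thesis using U(4) by simp
qed

lemma pos_index_eqI: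
  assumes S: "subspace S" and U: "subspace U" "U \<subseteq> S" "qf_pos_def q U"
    and V: "subspace V" "V \<subseteq> S" "\<And>v. v \<in> V \<Longrightarrow> q v \<le> 0" and dims: "dim S \<le> dim U + dim V"
  shows "pos_index q S = dim U"
proof -
  have "pos_index q S + dim V \<le> dim S" using V by (intro pos_index_add_nonpos_le S)
  then show ?thesis using pos_index_ge[OF U] dims by linarith
qed

lemma pos_def_indices:
  assumes S: "subspace S" and q: "qf_pos_def q S"
  shows "pos_index q S = dim S" "neg_index q S = 0"
proof -
  obtain U where "subspace U" "U \<subseteq> S" "qf_pos_def q U" and U: "dim U = pos_index q S"
    using pos_index_attained[OF S] .
  then have "pos_index q S \<le> dim S" unfolding U[symmetric] by (intro dim_subset)
  then show "pos_index q S = dim S" using pos_index_ge[OF S order_refl q] by simp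
  obtain N where "subspace N" and N: "N \<subseteq> S" "qf_pos_def (\<lambda>x. - q x) N" "dim N = neg_index q S"
    using pos_index_attained[OF S] unfolding neg_index_def .
  have "N \<subseteq> {0}" using q N(1,2) by (force simp: qf_pos_def_def)
  then show "neg_index q S = 0" unfolding N(3)[symmetric] dim_eq_0 .
qed

lemma pos_index_linear_pullback:
  fixes g :: "'a::euclidean_space \<Rightarrow> 'b::euclidean_space"
  assumes g: "linear g" and S: "subspace S" and q_zero: "q 0 = (0::real)"
  shows "pos_index (\<lambda>x. q (g x)) S = pos_index q (g ` S)"
proof (rule antisym)
  obtain U where U: "subspace U" "U \<subseteq> S" "qf_pos_def (\<lambda>x. q (g x)) U"
      "dim U = pos_index (\<lambda>x. q (g x)) S"
    using pos_index_attained[OF S] .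
  have "inj_on g U"
    using U(3) q_zero by (subst linear_inj_on_iff_eq_0[OF g U(1)]) (force simp: qf_pos_def_def)
  then have "dim (g ` U) = dim U" by (rule dim_image_inj_on[OF g U(1)])
  moreover have "qf_pos_def q (g ` U)" using U(3) linear_0[OF g] by (auto simp: qf_pos_def_def)
  then have "dim (g ` U) \<le> pos_index q (g ` S)"
    using U(1,2) g by (intro pos_index_ge linear_subspace_image) auto
  ultimately show "pos_index (\<lambda>x. q (g x)) S \<le> pos_index q (g ` S)" using U(4) by simp
next
  obtain h where h: "range h \<subseteq> S" "linear h" "\<And>y. y \<in> g ` S \<Longrightarrow> g (h y) = y"
    using linear_exists_right_inverse_on[OF g S] by blast
  obtain U where U: "subspace U" "U \<subseteq> g ` S" "qf_pos_def q U" "dim U = pos_index q (g ` S)"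
    using pos_index_attained[OF linear_subspace_image[OF g S]] .
  have "inj_on h U" using U(2) h(3) by (intro inj_on_inverseI[of _ g]) blast
  then have "dim (h ` U) = dim U" by (rule dim_image_inj_on[OF h(2) U(1)])
  moreover have "qf_pos_def (\<lambda>x. q (g x)) (h ` U)"
    using U(2,3) h(3) linear_0[OF h(2)] by (auto simp: qf_pos_def_def subset_iff)
  then have "dim (h ` U) \<le> pos_index (\<lambda>x. q (g x)) S"
    using U(1) h(1,2) by (intro pos_index_ge linear_subspace_image) auto
  ultimately show "pos_index q (g ` S) \<le> pos_index (\<lambda>x. q (g x)) S" using U(4) by simp
qed

abbreviation form_index :: "('a::euclidean_space \<Rightarrow> 'a \<Rightarrow> real) \<Rightarrow> 'a set \<Rightarrow> nat" where
  "form_index B S \<equiv> pos_index (\<lambda>x. B x x) S"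

definition symmetric_form_on :: "('a::euclidean_space \<Rightarrow> 'a \<Rightarrow> real) \<Rightarrow> 'a set \<Rightarrow> bool" where
  "symmetric_form_on B S \<longleftrightarrow> bilinear B \<and> subspace S \<and> (\<forall>x\<in>S. \<forall>y\<in>S. B x y = B y x)"

lemma symmetric_form_onD:
  assumes "symmetric_form_on B S"
  shows "bilinear B" "subspace S" "x \<in> S \<Longrightarrow> y \<in> S \<Longrightarrow> B x y = B y x"
  using assms by (auto simp: symmetric_form_on_def)

lemma symmetric_form_on_subset:
  "symmetric_form_on B S \<Longrightarrow> subspace T \<Longrightarrow> T \<subseteq> S \<Longrightarrow> symmetric_form_on B T"
  by (auto simp: symmetric_form_on_def)

lemma symmetric_form_on_uminus: "symmetric_form_on B S \<Longrightarrow> symmetric_form_on (\<lambda>x y. - B x y) S"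
  by (simp add: symmetric_form_on_def bilinear_uminus)

lemma subspace_form_radical: "symmetric_form_on B S \<Longrightarrow> subspace (form_radical B S)"
  by (intro subspace_annihilator symmetric_form_onD)

lemma symmetric_form_square_add:
  assumes "symmetric_form_on B S" "x \<in> S" "y \<in> S"
  shows "B (x + y) (x + y) = B x x + 2 * B x y + B y y"
  using symmetric_form_onD[OF assms(1)] assms(2,3) by (simp add: bilinear_ladd bilinear_radd)

lemma qf_nondegenerate_cong:
  assumes "subspace S" "\<And>x. x \<in> S \<Longrightarrow> q x = q' x"
  shows "qf_nondegenerate q S \<longleftrightarrow> qf_nondegenerate q' S"
  using assms by (simp add: qf_nondegenerate_def subspace_add)

lemma qf_nondegenerate_form_iff:
  assumes B: "symmetric_form_on B S"
  shows "qf_nondegenerate (\<lambda>x. B x x) S \<longleftrightarrow> form_radical B S \<subseteq> {0}"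
proof -
  have "B (u + v) (u + v) - B u u - B v v = 2 * B v u" if "u \<in> S" "v \<in> S" for u v
    using symmetric_form_square_add[OF B that] symmetric_form_onD(3)[OF B that] by simp
  then show ?thesis by (auto simp: qf_nondegenerate_def annihilator_def)
qed

lemma form_index_gt:
  assumes B: "symmetric_form_on B S" and U: "subspace U" "U \<subseteq> S" "qf_pos_def (\<lambda>x. B x x) U"
    and v: "v \<in> annihilator B U S" "B v v > 0"
  shows "dim U < form_index B S"
proof -
  note bil = symmetric_form_onD(1)[OF B]
  have vS: "v \<in> S" and Uv: "\<And>u. u \<in> U \<Longrightarrow> B u v = 0" using v(1) by (auto simp: annihilator_def)
  let ?W = "span (insert v U)"
  have "v \<notin> U" using Uv v(2) by force
  then have "dim ?W = Suc (dim U)" using U(1) by (simp add: dim_insert span_eq_iff[THEN iffD2])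
  moreover have "?W \<subseteq> S"
    using vS U(2) symmetric_form_onD(2)[OF B] by (intro span_minimal) auto
  moreover have "qf_pos_def (\<lambda>x. B x x) ?W"
    unfolding qf_pos_def_def
  proof (intro ballI impI)
    fix x assume "x \<in> ?W" "x \<noteq> 0"
    then obtain c where "x - c *\<^sub>R v \<in> U"
      using U(1) by (auto simp: span_breakdown_eq span_eq_iff[THEN iffD2])
    then obtain u where u: "u \<in> U" "x = u + c *\<^sub>R v" by (metis diff_add_cancel)
    have "B u (c *\<^sub>R v) = 0" using Uv[OF u(1)] by (simp add: bilinear_rmul[OF bil])
    then have square: "B x x = B u u + c\<^sup>2 * B v v"
      using symmetric_form_square_add[OF B, of u "c *\<^sub>R v"] u U(2) vS symmetric_form_onD(2)[OF B]
      by (simp add: subset_iff subspace_scale bilinear_lmul[OF bil] bilinear_rmul[OF bil] power2_eq_square)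
    show "B x x > 0"
    proof (cases "u = 0")
      case True
      then show ?thesis using \<open>x \<noteq> 0\<close> u(2) v(2) square by (simp add: bilinear_rzero[OF bil])
    next
      case False
      then have "B u u > 0" using U(3) u(1) by (auto simp: qf_pos_def_def)
      then show ?thesis using square v(2) by (simp add: add_pos_nonneg)
    qed
  qed
  ultimately show ?thesis using pos_index_ge[OF subspace_span, of "insert v U" S "\<lambda>x. B x x"] by simp
qed

lemma pos_index_split:
  assumes B: "symmetric_form_on B S"
  obtains U where "subspace U" "U \<subseteq> S" "qf_pos_def (\<lambda>x. B x x) U" "dim U = form_index B S"
    "\<forall>v\<in>annihilator B U S. B v v \<le> 0" "dim U + dim (annihilator B U S) = dim S"
proof -
  obtain U where U: "subspace U" "U \<subseteq> S" "qf_pos_def (\<lambda>x. B x x) U" "dim U = form_index B S"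
    using pos_index_attained[OF symmetric_form_onD(2)[OF B]] .
  have "annihilator (\<lambda>x u. B u x) S U \<subseteq> {0}" using U by (force simp: annihilator_def qf_pos_def_def)
  then have "dim (annihilator (\<lambda>x u. B u x) S U) = 0" by (simp add: dim_eq_0)
  then have "dim U + dim (annihilator B U S) = dim S"
    using dim_annihilator[OF symmetric_form_onD(1)[OF B] U(1) symmetric_form_onD(2)[OF B]] by linarith
  moreover have "B v v \<le> 0" if "v \<in> annihilator B U S" for v
    using form_index_gt[OF B U(1-3) that] U(4) by force
  ultimately show ?thesis using that[OF U] by blast
qed

lemma nonpos_null_in_form_radical:
  assumes B: "symmetric_form_on B S" and nonpos: "\<And>x. x \<in> S \<Longrightarrow> B x x \<le> 0"
    and v: "v \<in> S" "B v v = 0"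
  shows "v \<in> form_radical B S"
proof -
  note bil = symmetric_form_onD(1)[OF B]
  have "B y v = 0" if y: "y \<in> S" for y
  proof (rule ccontr)
    assume nonzero: "B y v \<noteq> 0"
    define t where "t = (1 - B y y) / (2 * B y v)"
    have tv_in: "t *\<^sub>R v \<in> S" by (intro subspace_scale symmetric_form_onD(2)[OF B] v(1))
    have "B (y + t *\<^sub>R v) (y + t *\<^sub>R v) = B y y + 2 * t * B y v"
      using symmetric_form_square_add[OF B y tv_in] v(2)
      by (simp add: bilinear_lmul[OF bil] bilinear_rmul[OF bil])
    also have "\<dots> = 1" using nonzero by (simp add: t_def field_simps)
    finally show False using nonpos[of "y + t *\<^sub>R v"] y tv_in symmetric_form_onD(2)[OF B]
      by (simp add: subspace_add)
  qed
  then show ?thesis using v(1) by (simp add: annihilator_def)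
qed

lemma nonpos_form_dim_le:
  assumes B: "symmetric_form_on B S" and nonpos: "\<And>x. x \<in> S \<Longrightarrow> B x x \<le> 0"
  shows "dim S \<le> neg_index (\<lambda>x. B x x) S + dim (form_radical B S)"
proof -
  note S = symmetric_form_onD(2)[OF B]
  define N where "N = {y\<in>S. \<forall>x\<in>form_radical B S. orthogonal x y}"
  have N: "subspace N" "N \<subseteq> S" using S by (auto simp: N_def subspace_def orthogonal_def inner_right_distrib)
  have "qf_pos_def (\<lambda>x. - B x x) N"
    unfolding qf_pos_def_def
  proof (intro ballI impI)
    fix v assume v: "v \<in> N" "v \<noteq> 0"
    then have "v \<notin> form_radical B S" by (auto simp: N_def orthogonal_def)
    then have "B v v \<noteq> 0" using nonpos_null_in_form_radical[OF B nonpos] N(2) v(1) by blast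
    then show "- B v v > 0" using nonpos[of v] v(1) N(2) by force
  qed
  then have "dim N \<le> neg_index (\<lambda>x. B x x) S" unfolding neg_index_def by (intro pos_index_ge N)
  moreover have "dim N + dim (form_radical B S) = dim S"
    unfolding N_def
    by (intro dim_subspace_orthogonal_to_vectors subspace_form_radical B S annihilator_subset)
  ultimately show ?thesis by linarith
qed

lemma form_radical_annihilator:
  assumes B: "symmetric_form_on B S" and U: "U \<subseteq> S" "sum_space U (annihilator B U S) = S"
  shows "form_radical B (annihilator B U S) = form_radical B S"
proof (intro equalityI subsetI)
  fix r assume r: "r \<in> form_radical B (annihilator B U S)"
  have "B x r = 0" if "x \<in> S" for x
  proof -
    have "x \<in> sum_space U (annihilator B U S)" using that U(2) by simp
    then obtain u v where "x = u + v" "u \<in> U" "v \<in> annihilator B U S" by blast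
    then show ?thesis using r by (simp add: annihilator_def bilinear_ladd[OF symmetric_form_onD(1)[OF B]])
  qed
  then show "r \<in> form_radical B S" using r by (auto simp: annihilator_def)
qed (use U(1) in \<open>auto simp: annihilator_def\<close>)

text \<open>On the complement of a maximal positive subspace the form is nonpositive, so there its null
  vectors form its radical.\<close>

theorem sylvester_inertia:
  assumes B: "symmetric_form_on B S"
  shows "form_index B S + neg_index (\<lambda>x. B x x) S + dim (form_radical B S) = dim S"
proof -
  note bil = symmetric_form_onD(1)[OF B] and S = symmetric_form_onD(2)[OF B]
  obtain U where U: "subspace U" "U \<subseteq> S" "qf_pos_def (\<lambda>x. B x x) U" "dim U = form_index B S"
    and nonpos: "\<forall>v\<in>annihilator B U S. B v v \<le> 0"
    and dim_S: "dim U + dim (annihilator B U S) = dim S"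
    using pos_index_split[OF B] .
  let ?V = "annihilator B U S"
  have V: "subspace ?V" "?V \<subseteq> S" by (intro subspace_annihilator bil S annihilator_subset)+
  have BV: "symmetric_form_on B ?V" by (rule symmetric_form_on_subset[OF B V])
  have rad: "subspace (form_radical B ?V)" by (rule subspace_form_radical[OF BV])
  have UV: "U \<inter> ?V \<subseteq> {0}" using U(3) nonpos by (force simp: qf_pos_def_def)
  then have "sum_space U ?V = S"
    using dim_S dim_sum_space_disjoint[OF U(1) V(1)]
    by (intro subspace_dim_equal subspace_sums sum_space_subset U V S) auto
  then have rad_eq: "form_radical B ?V = form_radical B S" by (rule form_radical_annihilator[OF B U(2)])
  have "dim ?V \<le> neg_index (\<lambda>x. B x x) ?V + dim (form_radical B ?V)"
    using nonpos by (intro nonpos_form_dim_le[OF BV]) blast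
  moreover have "neg_index (\<lambda>x. B x x) ?V \<le> neg_index (\<lambda>x. B x x) S"
    unfolding neg_index_def by (rule pos_index_mono[OF V])
  moreover have "neg_index (\<lambda>x. B x x) S + dim (sum_space U (form_radical B ?V)) \<le> dim S"
    unfolding neg_index_def
  proof (intro pos_index_add_nonpos_le S subspace_sums U rad sum_space_subset)
    show "form_radical B ?V \<subseteq> S" using V(2) by (auto simp: annihilator_def)
    fix w assume "w \<in> sum_space U (form_radical B ?V)"
    then obtain u r where ur: "w = u + r" "u \<in> U" "r \<in> form_radical B ?V" by blast
    then have "B w w = B u u"
      using symmetric_form_square_add[OF B, of u r] U(2) V(2) by (auto simp: annihilator_def)
    moreover have "B u u \<ge> 0"
      using U(3) ur(2) bilinear_rzero[OF bil] by (cases "u = 0") (auto simp: qf_pos_def_def less_imp_le)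
    ultimately show "- B w w \<le> 0" by simp
  qed
  moreover have "dim (sum_space U (form_radical B ?V)) = dim U + dim (form_radical B ?V)"
    using UV by (intro dim_sum_space_disjoint U rad) (auto simp: annihilator_def)
  ultimately show ?thesis unfolding rad_eq U(4)[symmetric] using dim_S by linarith
qed

lemma form_index_le_orthogonal_sum:
  assumes C: "symmetric_form_on C E" and F: "subspace F" "F \<subseteq> E" and G: "subspace G" "G \<subseteq> E"
    and orth: "\<And>x y. x \<in> F \<Longrightarrow> y \<in> G \<Longrightarrow> C x y = 0" and dim_E: "dim F + dim G = dim E + d"
  shows "form_index C E + d \<le> form_index C F + form_index C G + dim (F \<inter> G)"
proof -
  obtain U where "subspace U" "U \<subseteq> F" "qf_pos_def (\<lambda>x. C x x) U" and U: "dim U = form_index C F"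
      "\<forall>v\<in>annihilator C U F. C v v \<le> 0" "dim U + dim (annihilator C U F) = dim F"
    using pos_index_split[OF symmetric_form_on_subset[OF C F]] .
  obtain W where "subspace W" "W \<subseteq> G" "qf_pos_def (\<lambda>x. C x x) W" and W: "dim W = form_index C G"
      "\<forall>v\<in>annihilator C W G. C v v \<le> 0" "dim W + dim (annihilator C W G) = dim G"
    using pos_index_split[OF symmetric_form_on_subset[OF C G]] .
  let ?V = "annihilator C U F" and ?V' = "annihilator C W G"
  have V: "subspace ?V" "subspace ?V'"
    by (intro subspace_annihilator symmetric_form_onD(1)[OF C] F G)+
  have "form_index C E + dim (sum_space ?V ?V') \<le> dim E"
  proof (intro pos_index_add_nonpos_le symmetric_form_onD(2)[OF C] subspace_sums V sum_space_subset)
    fix w assume "w \<in> sum_space ?V ?V'"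
    then obtain x y where xy: "w = x + y" "x \<in> ?V" "y \<in> ?V'" by blast
    then have "x \<in> F" "y \<in> G" by (auto simp: annihilator_def)
    then have "C w w = C x x + C y y"
      using symmetric_form_square_add[OF C, of x y] orth[of x y] F(2) G(2) xy(1) by auto
    then show "C w w \<le> 0" using bspec[OF U(2) xy(2)] bspec[OF W(2) xy(3)] by simp
  qed (use F(2) G(2) in \<open>auto simp: annihilator_def\<close>)
  moreover have "dim (?V \<inter> ?V') \<le> dim (F \<inter> G)" by (rule dim_subset) (auto simp: annihilator_def)
  ultimately show ?thesis using dim_sums_Int[OF V] U W dim_E by linarith
qed

theorem form_index_orthogonal_decomp:
  assumes B: "symmetric_form_on B E" and F: "subspace F" "F \<subseteq> E"
  shows "form_index B E + dim (F \<inter> form_radical B E) =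
    form_index B F + form_index B (annihilator B F E) + dim (form_radical B F)"
proof -
  note bil = symmetric_form_onD(1)[OF B] and E = symmetric_form_onD(2)[OF B]
    and sym = symmetric_form_onD(3)[OF B]
  let ?G = "annihilator B F E"
  have G: "subspace ?G" "?G \<subseteq> E" by (intro subspace_annihilator bil E annihilator_subset)+
  have BF: "symmetric_form_on B F" "symmetric_form_on B ?G"
    by (intro symmetric_form_on_subset[OF B] F G)+
  have rads: "subspace (form_radical B F)" "subspace (form_radical B E)"
    by (intro subspace_form_radical BF B)+
  have orth: "B x y = 0" if "x \<in> F" "y \<in> ?G" for x y using that by (simp add: annihilator_def)
  have F_Int_G: "F \<inter> ?G = form_radical B F" using F(2) by (auto simp: annihilator_def)
  have "annihilator (\<lambda>x f. B f x) E F = F \<inter> form_radical B E"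
    using F(2) sym by (auto simp: annihilator_def subset_iff)
  then have dims: "dim F + dim ?G = dim E + dim (F \<inter> form_radical B E)"
    using dim_annihilator[OF bil F(1) E] by simp
  have "form_index B E + dim (F \<inter> form_radical B E) \<le>
      form_index B F + form_index B ?G + dim (form_radical B F)"
    using form_index_le_orthogonal_sum[OF B F G orth dims] by (simp add: F_Int_G)
  moreover have "neg_index (\<lambda>x. B x x) E + dim (F \<inter> form_radical B E) \<le>
      neg_index (\<lambda>x. B x x) F + neg_index (\<lambda>x. B x x) ?G + dim (form_radical B F)"
    using form_index_le_orthogonal_sum[OF symmetric_form_on_uminus[OF B] F G _ dims] orth
    by (simp add: F_Int_G neg_index_def)
  moreover have "dim (form_radical B F) + dim (form_radical B E) \<le>
      dim (form_radical B ?G) + dim (F \<inter> form_radical B E)"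
  proof -
    have "form_radical B F \<subseteq> form_radical B ?G" "form_radical B E \<subseteq> form_radical B ?G"
      using F(2) sym by (auto simp: annihilator_def subset_iff)
    then have "sum_space (form_radical B F) (form_radical B E) \<subseteq> form_radical B ?G"
      by (intro sum_space_subset subspace_form_radical BF)
    then have "dim (sum_space (form_radical B F) (form_radical B E)) \<le> dim (form_radical B ?G)"
      by (rule dim_subset)
    moreover have "form_radical B F \<inter> form_radical B E = F \<inter> form_radical B E"
      using F(2) by (auto simp: annihilator_def)
    ultimately show ?thesis using dim_sums_Int[OF rads] by simp
  qed
  ultimately show ?thesis
    using dims sylvester_inertia[OF B] sylvester_inertia[OF BF(1)] sylvester_inertia[OF BF(2)] by linarith
qed

lemma form_index_Times:
  assumes B: "symmetric_form_on B S" and C: "symmetric_form_on C T"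
  shows "form_index (\<lambda>p q. B (fst p) (fst q) + C (snd p) (snd q)) (S \<times> T) =
    form_index B S + form_index C T"
proof -
  obtain U where U: "subspace U" "U \<subseteq> S" "qf_pos_def (\<lambda>x. B x x) U" "dim U = form_index B S"
      "\<forall>v\<in>annihilator B U S. B v v \<le> 0" "dim U + dim (annihilator B U S) = dim S"
    using pos_index_split[OF B] .
  obtain W where W: "subspace W" "W \<subseteq> T" "qf_pos_def (\<lambda>x. C x x) W" "dim W = form_index C T"
      "\<forall>v\<in>annihilator C W T. C v v \<le> 0" "dim W + dim (annihilator C W T) = dim T"
    using pos_index_split[OF C] .
  let ?V = "annihilator B U S" and ?V' = "annihilator C W T"
  note bil = symmetric_form_onD(1)[OF B] symmetric_form_onD(1)[OF C]
    and sub = symmetric_form_onD(2)[OF B] symmetric_form_onD(2)[OF C]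
  have V: "subspace ?V" "subspace ?V'" by (intro subspace_annihilator bil sub)+
  have "form_index (\<lambda>p q. B (fst p) (fst q) + C (snd p) (snd q)) (S \<times> T) = dim (U \<times> W)"
  proof (rule pos_index_eqI[where V = "?V \<times> ?V'"])
    show "dim (S \<times> T) \<le> dim (U \<times> W) + dim (?V \<times> ?V')"
      using U(1,6) W(1,6) V sub by (simp add: dim_Times)
    show "qf_pos_def (\<lambda>p. B (fst p) (fst p) + C (snd p) (snd p)) (U \<times> W)"
      using U(3) W(3) bilinear_rzero[OF bil(1)] bilinear_rzero[OF bil(2)]
      unfolding qf_pos_def_def by (force simp: zero_prod_def intro: add_pos_pos)
    show "B (fst v) (fst v) + C (snd v) (snd v) \<le> 0" if "v \<in> ?V \<times> ?V'" for v
      using that bspec[OF U(5), of "fst v"] bspec[OF W(5), of "snd v"] by auto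
  qed (use U(1,2) W(1,2) V sub in \<open>auto intro!: subspace_Times simp: annihilator_def\<close>)
  then show ?thesis using U(1,4) W(1,4) by (simp add: dim_Times)
qed

subsection \<open>Perturbation of symmetric forms\<close>

lemma pos_def_coercive:
  fixes B :: "'a::euclidean_space \<Rightarrow> 'a \<Rightarrow> real"
  assumes B: "bilinear B" and U: "subspace U" and pos: "qf_pos_def (\<lambda>x. B x x) U"
  obtains c where "c > 0" "\<And>u. u \<in> U \<Longrightarrow> B u u \<ge> c * (norm u)\<^sup>2"
proof (cases "U \<subseteq> {0}")
  case True
  show ?thesis
    by (rule that[of 1]) (use True bilinear_rzero[OF B] in auto)
next
  case False
  let ?K = "U \<inter> sphere 0 1"
  have compact_K: "compact ?K" using closed_subspace[OF U] by (simp add: closed_Int_compact)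
  have normalized: "x /\<^sub>R norm x \<in> ?K" if "x \<in> U" "x \<noteq> 0" for x
    using that U by (auto intro: subspace_scale)
  then have nonempty_K: "?K \<noteq> {}" using False by blast
  have "bounded_bilinear B" using B bilinear_conv_bounded_bilinear by blast
  then have "continuous_on ?K (\<lambda>u. B u u)"
    by (intro bounded_bilinear.continuous_on[of B] continuous_intros)
  from continuous_attains_inf[OF compact_K nonempty_K this]
  obtain m where m: "m \<in> ?K" and minimal: "\<And>u. u \<in> ?K \<Longrightarrow> B m m \<le> B u u" by blast
  show ?thesis
  proof (rule that[of "B m m"])
    show "B m m > 0" using m pos by (force simp: qf_pos_def_def)
    show "B m m * (norm u)\<^sup>2 \<le> B u u" if u: "u \<in> U" for u
    proof (cases "u = 0")
      case False
      have "B m m \<le> B (u /\<^sub>R norm u) (u /\<^sub>R norm u)" by (intro minimal normalized u False)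
      also have "\<dots> = B u u / (norm u)\<^sup>2"
        by (simp add: bilinear_lmul[OF B] bilinear_rmul[OF B] power2_eq_square field_simps)
      finally show ?thesis using False by (simp add: field_simps)
    qed (simp add: bilinear_rzero[OF B])
  qed
qed

lemma bilinear_bound_Basis:
  fixes B :: "'a::euclidean_space \<Rightarrow> 'b::euclidean_space \<Rightarrow> real"
  assumes B: "bilinear B"
  shows "\<bar>B x y\<bar> \<le> (\<Sum>i\<in>Basis. \<Sum>j\<in>Basis. \<bar>B i j\<bar>) * norm x * norm y"
proof -
  have "B x y = B (\<Sum>i\<in>Basis. (x \<bullet> i) *\<^sub>R i) (\<Sum>j\<in>Basis. (y \<bullet> j) *\<^sub>R j)"
    by (simp add: euclidean_representation)
  also have "\<dots> = (\<Sum>(i, j)\<in>Basis \<times> Basis. (x \<bullet> i) * (y \<bullet> j) * B i j)"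
    by (simp add: bilinear_sum[OF B] bilinear_lmul[OF B] bilinear_rmul[OF B] mult_ac case_prod_unfold)
  also have "\<bar>\<dots>\<bar> \<le> (\<Sum>(i, j)\<in>Basis \<times> Basis. norm x * norm y * \<bar>B i j\<bar>)"
    unfolding case_prod_unfold
    by (intro order_trans[OF sum_abs] sum_mono)
      (auto simp: abs_mult mem_Times_iff intro!: mult_right_mono mult_mono Basis_le_norm)
  also have "\<dots> = (\<Sum>i\<in>Basis. \<Sum>j\<in>Basis. \<bar>B i j\<bar>) * norm x * norm y"
    by (simp add: sum.cartesian_product sum_distrib_left sum_distrib_right case_prod_unfold mult_ac)
  finally show ?thesis .
qed

lemma bilinear_tendsto_uniformly:
  fixes B :: "'i \<Rightarrow> 'a::euclidean_space \<Rightarrow> 'b::euclidean_space \<Rightarrow> real"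
  assumes bil: "\<forall>\<^sub>F t in F. bilinear (B t)" "bilinear B0"
    and lim: "\<And>x y. ((\<lambda>t. B t x y) \<longlongrightarrow> B0 x y) F" and e: "e > 0"
  shows "\<forall>\<^sub>F t in F. \<forall>x y. \<bar>B t x y - B0 x y\<bar> \<le> e * norm x * norm y"
proof -
  let ?S = "\<lambda>t. \<Sum>i\<in>Basis. \<Sum>j\<in>Basis. \<bar>B t i j - B0 i j\<bar>"
  have "((\<lambda>t. \<bar>B t i j - B0 i j\<bar>) \<longlongrightarrow> 0) F" for i j
    using tendsto_rabs_zero[OF LIM_zero[OF lim]] .
  then have "(?S \<longlongrightarrow> (\<Sum>i\<in>(Basis :: 'a set). \<Sum>j\<in>(Basis :: 'b set). 0)) F" by (intro tendsto_sum)
  then have "\<forall>\<^sub>F t in F. ?S t < e" using e by (intro order_tendstoD(2)[of _ 0]) simp_all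
  with bil(1) show ?thesis
  proof eventually_elim
    case (elim t)
    have "bilinear (\<lambda>x y. B t x y - B0 x y)"
      using bilinear_add[OF elim(1) bilinear_uminus[OF bil(2)]] by simp
    then have "\<bar>B t x y - B0 x y\<bar> \<le> ?S t * norm x * norm y" for x y by (rule bilinear_bound_Basis)
    moreover have "?S t * norm x * norm y \<le> e * norm x * norm y" for x :: 'a and y :: 'b
      using elim(2) by (intro mult_right_mono) auto
    ultimately show ?case by (meson order_trans)
  qed
qed

lemma bilinear_quotient_tendsto_uniformly:
  fixes B :: "'i \<Rightarrow> 'a::euclidean_space \<Rightarrow> 'a \<Rightarrow> real"
  assumes B: "\<forall>\<^sub>F t in F. bilinear (B t)" and B0: "bilinear B0" and B': "bilinear B'"
    and deriv: "\<And>x y. ((\<lambda>t. (B t x y - B0 x y) / h t) \<longlongrightarrow> B' x y) F" and e: "e > 0"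
  shows "\<forall>\<^sub>F t in F. \<forall>x y. \<bar>(B t x y - B0 x y) / h t - B' x y\<bar> \<le> e * norm x * norm y"
proof (rule bilinear_tendsto_uniformly[OF _ B' deriv e])
  show "\<forall>\<^sub>F t in F. bilinear (\<lambda>x y. (B t x y - B0 x y) / h t)"
    using B
  proof eventually_elim
    case (elim t)
    show ?case using bilinear_divide[OF bilinear_add[OF elim bilinear_uminus[OF B0]]] by simp
  qed
qed

lemma form_index_lower_semicontinuous:
  assumes B: "bilinear B0" "\<forall>\<^sub>F t in F. bilinear (B t)" and S: "subspace S"
    and lim: "\<And>x y. ((\<lambda>t. B t x y) \<longlongrightarrow> B0 x y) F"
  shows "\<forall>\<^sub>F t in F. form_index B0 S \<le> form_index (B t) S"
proof -
  obtain U where U: "subspace U" "U \<subseteq> S" "qf_pos_def (\<lambda>x. B0 x x) U" "dim U = form_index B0 S"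
    using pos_index_attained[OF S] .
  obtain c where "c > 0" and coercive: "\<And>u. u \<in> U \<Longrightarrow> B0 u u \<ge> c * (norm u)\<^sup>2"
    using pos_def_coercive[OF B(1) U(1,3)] by blast
  have "\<forall>\<^sub>F t in F. \<forall>x y. \<bar>B t x y - B0 x y\<bar> \<le> c / 2 * norm x * norm y"
    using \<open>c > 0\<close> by (intro bilinear_tendsto_uniformly B lim) simp
  then show ?thesis
  proof eventually_elim
    case (elim t)
    have "qf_pos_def (\<lambda>x. B t x x) U"
      unfolding qf_pos_def_def
    proof (intro ballI impI)
      fix u assume u: "u \<in> U" "u \<noteq> 0"
      have "\<bar>B t u u - B0 u u\<bar> \<le> c / 2 * (norm u)\<^sup>2"
        using elim by (simp add: power2_eq_square flip: mult.assoc)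
      moreover have "c * (norm u)\<^sup>2 > 0" using \<open>c > 0\<close> u(2) by simp
      ultimately show "B t u u > 0" using coercive[OF u(1)] by linarith
    qed
    then show ?case unfolding U(4)[symmetric] by (intro pos_index_ge U)
  qed
qed

lemma form_index_locally_constant:
  assumes B: "symmetric_form_on B0 S"
    "\<forall>\<^sub>F t in F. symmetric_form_on (B t) S \<and> dim (form_radical (B t) S) = dim (form_radical B0 S)"
    and lim: "\<And>x y. ((\<lambda>t. B t x y) \<longlongrightarrow> B0 x y) F"
  shows "\<forall>\<^sub>F t in F. form_index (B t) S = form_index B0 S"
proof -
  note bil = symmetric_form_onD(1)[OF B(1)] and S = symmetric_form_onD(2)[OF B(1)]
  have bil_ev: "\<forall>\<^sub>F t in F. bilinear (B t)" using B(2) by eventually_elim (auto dest: symmetric_form_onD)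
  have pos_ev: "\<forall>\<^sub>F t in F. form_index B0 S \<le> form_index (B t) S"
    by (rule form_index_lower_semicontinuous[OF bil bil_ev S lim])
  have "\<forall>\<^sub>F t in F. form_index (\<lambda>x y. - B0 x y) S \<le> form_index (\<lambda>x y. - B t x y) S"
    using bil_ev
    by (intro form_index_lower_semicontinuous bilinear_uminus bil S tendsto_minus lim)
      (auto elim: eventually_mono intro: bilinear_uminus)
  with pos_ev B(2) show ?thesis
  proof eventually_elim
    case (elim t)
    then show ?case
      using sylvester_inertia[OF B(1)] sylvester_inertia[of "B t" S] by (simp add: neg_index_def)
  qed
qed

text \<open>The cross term satisfies \<open>2 C a b \<le> (g / 4) b\<^sup>2 + (4 C\<^sup>2 / g) a\<^sup>2\<close>.\<close>

lemma perturbation_pos: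
  fixes a b c g h C :: real
  assumes pos: "g > 0" "h > 0" and small: "h * (C + 4 * C\<^sup>2 / g) < c"
    and nonzero: "a \<noteq> 0 \<or> b \<noteq> 0"
    and bounds: "p \<ge> c * a\<^sup>2" "\<bar>x\<bar> \<le> C * a\<^sup>2" "\<bar>y\<bar> \<le> 2 * C * a * b" "z \<ge> g / 2 * b\<^sup>2"
  shows "p + h * (x + y + z) > 0"
proof -
  have "0 \<le> (g / 2 * b - 2 * C * a)\<^sup>2 / g" using pos(1) by simp
  also have "\<dots> = g / 4 * b\<^sup>2 + 4 * C\<^sup>2 / g * a\<^sup>2 - 2 * C * a * b"
    using pos(1) by (simp add: power2_eq_square field_simps)
  finally have "x + y + z \<ge> g / 4 * b\<^sup>2 - C * a\<^sup>2 - 4 * C\<^sup>2 / g * a\<^sup>2"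
    using bounds(2-4) by linarith
  then have "h * (x + y + z) \<ge> h * (g / 4 * b\<^sup>2 - C * a\<^sup>2 - 4 * C\<^sup>2 / g * a\<^sup>2)"
    using pos(2) by (intro mult_left_mono) auto
  also have "h * (g / 4 * b\<^sup>2 - C * a\<^sup>2 - 4 * C\<^sup>2 / g * a\<^sup>2) =
      h * (g / 4) * b\<^sup>2 - h * (C + 4 * C\<^sup>2 / g) * a\<^sup>2"
    by (simp only: right_diff_distrib distrib_left distrib_right mult.assoc diff_diff_eq)
  finally have "p + h * (x + y + z) \<ge> (c - h * (C + 4 * C\<^sup>2 / g)) * a\<^sup>2 + h * (g / 4) * b\<^sup>2"
    using bounds(1) unfolding left_diff_distrib by linarith
  moreover have "(c - h * (C + 4 * C\<^sup>2 / g)) * a\<^sup>2 + h * (g / 4) * b\<^sup>2 > 0"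
    using nonzero
  proof
    assume "a \<noteq> 0"
    then show ?thesis using small pos by (intro add_pos_nonneg) auto
  next
    assume "b \<noteq> 0"
    then show ?thesis using small pos by (intro add_nonneg_pos) auto
  qed
  ultimately show ?thesis by linarith
qed

lemma perturbed_form_pos_def:
  fixes A B D :: "'a::euclidean_space \<Rightarrow> 'a \<Rightarrow> real"
  assumes B: "bilinear B" "\<And>x y. B x y = A x y + h * D x y"
    and null: "\<And>u n. u \<in> U \<Longrightarrow> n \<in> N \<Longrightarrow> A u n = 0" "\<And>u n. u \<in> U \<Longrightarrow> n \<in> N \<Longrightarrow> A n u = 0"
      "\<And>n. n \<in> N \<Longrightarrow> A n n = 0"
    and coercive: "\<And>u. u \<in> U \<Longrightarrow> A u u \<ge> c * (norm u)\<^sup>2" "\<And>n. n \<in> N \<Longrightarrow> D n n \<ge> g / 2 * (norm n)\<^sup>2"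
    and bound: "\<And>x y. \<bar>D x y\<bar> \<le> C * norm x * norm y"
    and small: "g > 0" "h > 0" "h * (C + 4 * C\<^sup>2 / g) < c"
  shows "qf_pos_def (\<lambda>x. B x x) (sum_space U N)"
  unfolding qf_pos_def_def
proof (intro ballI impI)
  fix x assume "x \<in> sum_space U N" "x \<noteq> 0"
  then obtain u n where x: "x = u + n" "u \<in> U" "n \<in> N" by blast
  have "B x x = B u u + (B u n + B n u) + B n n"
    unfolding x by (simp add: bilinear_ladd[OF B(1)] bilinear_radd[OF B(1)])
  also have "\<dots> = A u u + h * (D u u + (D u n + D n u) + D n n)"
    using null(1,2)[OF x(2,3)] null(3)[OF x(3)] by (simp add: B(2) algebra_simps)
  also have "\<dots> > 0"
  proof (rule perturbation_pos[OF small])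
    show "norm u \<noteq> 0 \<or> norm n \<noteq> 0" using \<open>x \<noteq> 0\<close> x(1) by auto
    show "\<bar>D u u\<bar> \<le> C * (norm u)\<^sup>2" using bound[of u u] by (simp add: power2_eq_square mult.assoc)
    show "\<bar>D u n + D n u\<bar> \<le> 2 * C * norm u * norm n"
      using bound[of u n] bound[of n u] by (simp add: mult_ac)
  qed (use coercive(1)[OF x(2)] coercive(2)[OF x(3)] in auto)
  finally show "B x x > 0" .
qed

lemma form_index_perturbation_ge:
  fixes B :: "'i \<Rightarrow> 'a::euclidean_space \<Rightarrow> 'a \<Rightarrow> real"
  assumes B0: "symmetric_form_on B0 S" and B: "\<forall>\<^sub>F t in F. bilinear (B t)" and B': "bilinear B'"
    and K: "subspace K" "K \<subseteq> form_radical B0 S"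
    and step: "\<forall>\<^sub>F t in F. h t > 0" "(h \<longlongrightarrow> 0) F"
    and deriv: "\<And>x y. ((\<lambda>t. (B t x y - B0 x y) / h t) \<longlongrightarrow> B' x y) F"
  shows "\<forall>\<^sub>F t in F. form_index B0 S + form_index B' K \<le> form_index (B t) S"
proof -
  note bil = symmetric_form_onD(1)[OF B0] and S = symmetric_form_onD(2)[OF B0]
  obtain U where U: "subspace U" "U \<subseteq> S" "qf_pos_def (\<lambda>x. B0 x x) U" "dim U = form_index B0 S"
    using pos_index_attained[OF S] .
  obtain N where N: "subspace N" "N \<subseteq> K" "qf_pos_def (\<lambda>x. B' x x) N" "dim N = form_index B' K"
    using pos_index_attained[OF K(1)] .
  obtain c where c_pos: "c > 0" and B0_coercive: "\<And>u. u \<in> U \<Longrightarrow> B0 u u \<ge> c * (norm u)\<^sup>2"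
    using pos_def_coercive[OF bil U(1,3)] by blast
  obtain g where g_pos: "g > 0" and B'_coercive: "\<And>n. n \<in> N \<Longrightarrow> B' n n \<ge> g * (norm n)\<^sup>2"
    using pos_def_coercive[OF B' N(1,3)] by blast
  obtain k where B'_bound: "\<And>x y. \<bar>B' x y\<bar> \<le> k * norm x * norm y"
    using bilinear_bounded_pos[OF B'] by auto
  have N_S: "N \<subseteq> S" using K(2) N(2) by (auto simp: annihilator_def)
  have null: "B0 x n = 0" "B0 n x = 0" if "x \<in> S" "n \<in> N" for x n
    using that K(2) N(2) N_S symmetric_form_onD(3)[OF B0 _ that(1), of n] by (auto simp: annihilator_def)
  have UN: "U \<inter> N \<subseteq> {0}" using U(2,3) null(1) by (force simp: qf_pos_def_def)
  have close: "\<forall>\<^sub>F t in F. \<forall>x y. \<bar>(B t x y - B0 x y) / h t - B' x y\<bar> \<le> g / 2 * norm x * norm y"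
    using g_pos by (intro bilinear_quotient_tendsto_uniformly B B' bil deriv) simp
  define C where "C = k + g / 2"
  have "((\<lambda>t. h t * (C + 4 * C\<^sup>2 / g)) \<longlongrightarrow> 0 * (C + 4 * C\<^sup>2 / g)) F" by (intro tendsto_intros step(2))
  then have small: "\<forall>\<^sub>F t in F. h t * (C + 4 * C\<^sup>2 / g) < c" using c_pos
    by (intro order_tendstoD(2)) simp_all
  from close small B step(1) show ?thesis
  proof eventually_elim
    case (elim t)
    define D where "D x y = (B t x y - B0 x y) / h t" for x y
    have close: "\<bar>D x y - B' x y\<bar> \<le> g / 2 * norm x * norm y" for x y using elim(1) by (simp add: D_def)
    have "qf_pos_def (\<lambda>x. B t x x) (sum_space U N)"
    proof (rule perturbed_form_pos_def[where B = "B t" and A = B0 and D = D and h = "h t"])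
      show "B t x y = B0 x y + h t * D x y" for x y using elim(4) by (simp add: D_def)
      show "\<bar>D x y\<bar> \<le> C * norm x * norm y" for x y
        using close[of x y] B'_bound[of x y] unfolding C_def distrib_right by linarith
      show "D n n \<ge> g / 2 * (norm n)\<^sup>2" if "n \<in> N" for n
        using close[of n n] B'_coercive[OF that] unfolding power2_eq_square mult.assoc[symmetric]
        by linarith
    qed (use elim(2-4) null U(2) N_S B0_coercive g_pos in auto)
    then have "dim (sum_space U N) \<le> form_index (B t) S"
      by (intro pos_index_ge subspace_sums sum_space_subset S U(1,2) N(1) N_S)
    then show ?case using dim_sum_space_disjoint[OF U(1) N(1) UN] U(4) N(4) by simp
  qed
qed

theorem form_index_jump:
  fixes B :: "'i \<Rightarrow> 'a::euclidean_space \<Rightarrow> 'a \<Rightarrow> real"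
  assumes B0: "symmetric_form_on B0 S" and B': "symmetric_form_on B' K"
    and B: "\<forall>\<^sub>F t in F. symmetric_form_on (B t) S \<and> r \<le> dim (form_radical (B t) S)"
    and K: "K \<subseteq> form_radical B0 S" "dim (form_radical B0 S) = dim K + r" "form_radical B' K \<subseteq> {0}"
    and step: "\<forall>\<^sub>F t in F. h t > 0" "(h \<longlongrightarrow> 0) F"
    and deriv: "\<And>x y. ((\<lambda>t. (B t x y - B0 x y) / h t) \<longlongrightarrow> B' x y) F"
  shows "\<forall>\<^sub>F t in F. form_index (B t) S = form_index B0 S + form_index B' K \<and>
    dim (form_radical (B t) S) = r"
proof -
  note bil' = symmetric_form_onD(1)[OF B'] and sub_K = symmetric_form_onD(2)[OF B']
  have bil: "\<forall>\<^sub>F t in F. bilinear (B t)" using B by eventually_elim (auto dest: symmetric_form_onD)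
  have pos: "\<forall>\<^sub>F t in F. form_index B0 S + form_index B' K \<le> form_index (B t) S"
    by (rule form_index_perturbation_ge[OF B0 bil bil' sub_K K(1) step deriv])
  have "((\<lambda>t. (- B t x y - - B0 x y) / h t) \<longlongrightarrow> - B' x y) F" for x y
    using tendsto_minus[OF deriv[of x y]] by (simp add: minus_divide_left)
  then have "\<forall>\<^sub>F t in F. form_index (\<lambda>x y. - B0 x y) S + form_index (\<lambda>x y. - B' x y) K
      \<le> form_index (\<lambda>x y. - B t x y) S"
    using K(1) bil
    by (intro form_index_perturbation_ge[OF _ _ _ sub_K _ step] symmetric_form_on_uminus B0
        bilinear_uminus bil')
      (auto simp: annihilator_def elim: eventually_mono intro: bilinear_uminus)
  with pos B show ?thesis
  proof eventually_elim
    case (elim t)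
    have "dim (form_radical B' K) = 0" using K(3) by (simp add: dim_eq_0)
    moreover have "form_index (B t) S + neg_index (\<lambda>x. B t x x) S + dim (form_radical (B t) S) = dim S"
      by (intro sylvester_inertia) (use elim in simp)
    ultimately show ?case
      using elim K(2) sylvester_inertia[OF B0] sylvester_inertia[OF B'] unfolding neg_index_def
      by (intro conjI) linarith+
  qed
qed

subsection \<open>Lagrangian projections\<close>

locale symplectic =
  fixes \<omega> :: "'v::euclidean_space \<Rightarrow> 'v \<Rightarrow> real"
  assumes symplectic_form: "symplectic_form \<omega>"
begin

lemma bilinear_omega: "bilinear \<omega>"
  and omega_skew: "\<omega> x y = - \<omega> y x"
  and omega_nondegenerate: "(\<And>y. \<omega> x y = 0) \<Longrightarrow> x = 0"
  using symplectic_form unfolding symplectic_form_def by blast+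

lemma bounded_bilinear_omega: "bounded_bilinear \<omega>"
  using bilinear_omega bilinear_conv_bounded_bilinear by blast

lemmas omega_simps =
  bilinear_ladd[OF bilinear_omega] bilinear_radd[OF bilinear_omega]
  bilinear_lsub[OF bilinear_omega] bilinear_rsub[OF bilinear_omega]
  bilinear_lmul[OF bilinear_omega] bilinear_rmul[OF bilinear_omega]
  bilinear_lzero[OF bilinear_omega] bilinear_rzero[OF bilinear_omega]
  bilinear_lneg[OF bilinear_omega] bilinear_rneg[OF bilinear_omega]

lemma omega_self [simp]: "\<omega> x x = 0"
  using omega_skew[of x x] by simp

lemma omega_nondegenerate_right: "(\<And>y. \<omega> y x = 0) \<Longrightarrow> x = 0"
  using omega_nondegenerate[of x] omega_skew[of x] by simp

lemma omega_represented:
  fixes B :: "'b::euclidean_space \<Rightarrow> 'v \<Rightarrow> real"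
  assumes "bilinear B"
  obtains Z where "linear Z" "\<And>u x. \<omega> (Z u) x = B u x"
proof -
  obtain S where S: "linear S" "\<And>u x. S u \<bullet> x = B u x" using bilinear_represented[OF assms] by blast
  obtain T where T: "linear T" "\<And>u x. T u \<bullet> x = \<omega> u x"
    using bilinear_represented[OF bilinear_omega] by blast
  have "u = 0" if "T u = 0" for u using omega_nondegenerate[of u] T(2)[of u] that by simp
  then have "inj T" using linear_injective_0[OF T(1)] by blast
  then obtain T' where T': "linear T'" "\<And>x. T (T' x) = x"
    using linear_injective_isomorphism[OF T(1)] by blast
  show ?thesis
  proof (rule that)
    show "linear (T' \<circ> S)" by (rule linear_compose[OF S(1) T'(1)])
    show "\<omega> ((T' \<circ> S) u) x = B u x" for u x by (simp add: S(2) T' flip: T(2))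
  qed
qed

lemma lagrangian_subspace: "lagrangian \<omega> L \<Longrightarrow> subspace L"
  and lagrangian_dim: "lagrangian \<omega> L \<Longrightarrow> 2 * dim L = DIM('v)"
  and lagrangian_isotropic: "lagrangian \<omega> L \<Longrightarrow> x \<in> L \<Longrightarrow> y \<in> L \<Longrightarrow> \<omega> x y = 0"
  by (auto simp: lagrangian_def)

lemma lagrangian_annihilator:
  assumes L: "lagrangian \<omega> L"
  shows "annihilator \<omega> L UNIV = L"
proof -
  have "annihilator (\<lambda>x u. \<omega> u x) UNIV L \<subseteq> {0}" using omega_nondegenerate by (auto simp: annihilator_def)
  then have "dim (annihilator (\<lambda>x u. \<omega> u x) UNIV L) = 0" by (simp add: dim_eq_0)
  moreover have "dim (UNIV :: 'v set) = 2 * dim L" using lagrangian_dim[OF L] by simp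
  ultimately have "dim (annihilator \<omega> L UNIV) = dim L"
    using dim_annihilator[OF bilinear_omega lagrangian_subspace[OF L] subspace_UNIV] by linarith
  moreover have "L \<subseteq> annihilator \<omega> L UNIV"
    using lagrangian_isotropic[OF L] by (auto simp: annihilator_def)
  ultimately have "L = annihilator \<omega> L UNIV"
    by (intro subspace_dim_equal lagrangian_subspace[OF L] subspace_annihilator bilinear_omega
        subspace_UNIV)
      simp_all
  then show ?thesis ..
qed

lemma lagrangian_maximal: "lagrangian \<omega> L \<Longrightarrow> (\<And>y. y \<in> L \<Longrightarrow> \<omega> y x = 0) \<Longrightarrow> x \<in> L"
  using lagrangian_annihilator[of L] by (auto simp: annihilator_def)

definition transversal :: "'v set \<Rightarrow> 'v set \<Rightarrow> bool" where
  "transversal W L \<longleftrightarrow> lagrangian \<omega> W \<and> lagrangian \<omega> L \<and> W \<inter> L = {0}"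

lemma transversal_sym: "transversal W L \<Longrightarrow> transversal L W"
  by (auto simp: transversal_def)

lemma transversalI:
  "lagrangian \<omega> W \<Longrightarrow> lagrangian \<omega> L \<Longrightarrow> (\<And>x. x \<in> W \<Longrightarrow> x \<in> L \<Longrightarrow> x = 0) \<Longrightarrow> transversal W L"
  using subspace_0[OF lagrangian_subspace] unfolding transversal_def by blast

text \<open>Let \<open>p\<close> be a linear projection with kernel \<open>L\<close> and \<open>\<omega> (Z x) y = - \<omega> (p x) (p y) / 2\<close>. Then
  the correction \<open>Z x \<in> L\<close> makes the complement \<open>{p x + Z x}\<close> isotropic.\<close>

lemma isotropic_projection_exists:
  assumes L: "lagrangian \<omega> L"
  obtains T where "linear T" "\<And>x. T x \<in> L \<longleftrightarrow> x \<in> L" "\<And>x. T x = 0 \<longleftrightarrow> x \<in> L" "\<And>x y. \<omega> (T x) (T y) = 0"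
proof -
  have sL: "subspace L" by (rule lagrangian_subspace[OF L])
  obtain \<pi> where \<pi>: "range \<pi> \<subseteq> L" "linear \<pi>" "\<And>x. x \<in> L \<Longrightarrow> \<pi> x = x"
    using linear_exists_left_inverse_on[OF linear_id sL] by auto
  define p where "p x = x - \<pi> x" for x
  have p: "linear p" unfolding p_def by (intro linear_compose_sub linear_ident \<pi>(2))
  have \<pi>_L: "\<pi> x \<in> L" for x using \<pi>(1) by auto
  have p_zero: "p x = 0 \<longleftrightarrow> x \<in> L" for x using \<pi>_L[of x] \<pi>(3) by (auto simp: p_def)
  have p_p: "p (p x) = p x" for x by (simp add: p_def linear_diff[OF \<pi>(2)] \<pi>(3) \<pi>_L)
  have "bilinear (\<lambda>x y. - \<omega> (p x) (p y) / 2)"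
    by (intro bilinear_divide bilinear_uminus bilinear_compose[OF bilinear_omega] p)
  then obtain Z where Z: "linear Z" "\<And>x y. \<omega> (Z x) y = - \<omega> (p x) (p y) / 2"
    using omega_represented by blast
  have Z_L: "Z x \<in> L" for x
  proof (rule lagrangian_maximal[OF L])
    fix y assume "y \<in> L"
    then have "p y = 0" using p_zero by simp
    then show "\<omega> y (Z x) = 0" using omega_skew[of y "Z x"] by (simp add: Z(2) omega_simps)
  qed
  have Z_zero: "Z x = 0" if "p x = 0" for x
    using that by (intro omega_nondegenerate) (simp add: Z(2) omega_simps)
  have L_iff: "p x + Z x \<in> L \<longleftrightarrow> x \<in> L" for x
  proof -
    have "p x + Z x \<in> L \<longleftrightarrow> p x \<in> L" using span_add_eq2[of "Z x" L "p x"] Z_L[of x] sL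
      by (simp add: span_eq_iff[THEN iffD2])
    also have "\<dots> \<longleftrightarrow> x \<in> L" using p_zero[of "p x"] p_zero[of x] by (simp add: p_p)
    finally show ?thesis .
  qed
  show ?thesis
  proof (rule that)
    show "linear (\<lambda>x. p x + Z x)" by (intro linear_compose_add p Z(1))
    show "p x + Z x = 0 \<longleftrightarrow> x \<in> L" for x
      using L_iff[of x] p_zero[of x] Z_zero[of x] subspace_0[OF sL] by auto
    show "\<omega> (p x + Z x) (p y + Z y) = 0" for x y
      using lagrangian_isotropic[OF L Z_L Z_L] omega_skew[of "p x" "Z y"] omega_skew[of "p x" "p y"]
      by (simp add: omega_simps Z(2) p_p)
  qed (rule L_iff)
qed

lemma transversal_exists:
  assumes L: "lagrangian \<omega> L"
  obtains W where "transversal W L"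
proof -
  obtain T where T: "linear T" "\<And>x. T x \<in> L \<longleftrightarrow> x \<in> L" "\<And>x. T x = 0 \<longleftrightarrow> x \<in> L"
    "\<And>x y. \<omega> (T x) (T y) = 0"
    by (rule isotropic_projection_exists[OF L]) (rule that; assumption)
  have "{x\<in>UNIV. T x = 0} = L" using T(3) by simp
  then have "dim (range T) + dim L = DIM('v)" using dim_kernel_image[OF T(1) subspace_UNIV] by simp
  then have "lagrangian \<omega> (range T)"
    using lagrangian_dim[OF L] linear_subspace_image[OF T(1) subspace_UNIV] T(4)
    by (auto simp: lagrangian_def)
  then have "transversal (range T) L"
    using T(2,3) by (auto intro!: transversalI[OF _ L])
  then show ?thesis by (rule that)
qed

definition proj :: "'v set \<Rightarrow> 'v set \<Rightarrow> 'v \<Rightarrow> 'v" where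
  "proj W L x = (THE y. y \<in> L \<and> x - y \<in> W)"

definition chart_form :: "'v set \<Rightarrow> 'v set \<Rightarrow> 'v \<Rightarrow> 'v \<Rightarrow> real" where
  "chart_form W L x y = \<omega> x (proj W L y)"

definition chart_index :: "'v set \<Rightarrow> 'v set \<Rightarrow> 'v set \<Rightarrow> nat" where
  "chart_index C W L = form_index (chart_form W L) C"

context
  fixes W L assumes tr: "transversal W L"
begin

lemma transversal_lagrangian: "lagrangian \<omega> W" "lagrangian \<omega> L"
  and transversal_subspace: "subspace W" "subspace L"
  and transversal_Int: "x \<in> W \<Longrightarrow> x \<in> L \<Longrightarrow> x = 0"
  using tr by (auto simp: transversal_def lagrangian_subspace)

lemma transversal_sum: "sum_space L W = UNIV"
proof (rule subspace_dim_equal)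
  show "subspace (sum_space L W)" by (intro subspace_sums transversal_subspace)
  have "dim (sum_space L W) = dim L + dim W"
    using transversal_Int by (intro dim_sum_space_disjoint transversal_subspace) auto
  then show "dim (UNIV :: 'v set) \<le> dim (sum_space L W)"
    using lagrangian_dim[OF transversal_lagrangian(1)] lagrangian_dim[OF transversal_lagrangian(2)]
    by simp
qed auto

lemma proj_unique:
  assumes y: "y \<in> L" "x - y \<in> W"
  shows "proj W L x = y"
  unfolding proj_def
proof (rule the_equality)
  fix z assume z: "z \<in> L \<and> x - z \<in> W"
  have "z - y \<in> L" using y z transversal_subspace by (simp add: subspace_diff)
  moreover have "(x - y) - (x - z) \<in> W" using y z subspace_diff[OF transversal_subspace(1)] by blast
  ultimately show "z = y" using transversal_Int[of "z - y"] by simp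
qed (use y in simp)

lemma proj_in: "proj W L x \<in> L" and proj_diff_in: "x - proj W L x \<in> W"
proof -
  have "x \<in> sum_space L W" using transversal_sum by simp
  then obtain y w where "x = y + w" "y \<in> L" "w \<in> W" by blast
  then have "y \<in> L" "x - y \<in> W" by auto
  then show "proj W L x \<in> L" "x - proj W L x \<in> W" using proj_unique by metis+
qed

lemma proj_id: "x \<in> L \<Longrightarrow> proj W L x = x"
  using transversal_subspace by (intro proj_unique) (auto simp: subspace_0)

lemma proj_zero: "x \<in> W \<Longrightarrow> proj W L x = 0"
  using transversal_subspace by (intro proj_unique) (auto simp: subspace_0)

lemma linear_proj: "linear (proj W L)"
proof (rule linearI)
  fix x y c
  have "(x - proj W L x) + (y - proj W L y) \<in> W" by (intro subspace_add transversal_subspace proj_diff_in)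
  then show "proj W L (x + y) = proj W L x + proj W L y"
    by (intro proj_unique subspace_add transversal_subspace proj_in) (simp add: algebra_simps)
  have "c *\<^sub>R (x - proj W L x) \<in> W" by (intro subspace_scale transversal_subspace proj_diff_in)
  then show "proj W L (c *\<^sub>R x) = c *\<^sub>R proj W L x"
    by (intro proj_unique subspace_scale transversal_subspace proj_in) (simp add: scaleR_diff_right)
qed

lemmas proj_diff = linear_diff[OF linear_proj]

lemma bilinear_chart_form: "bilinear (chart_form W L)"
  unfolding chart_form_def by (rule bilinear_compose[OF bilinear_omega linear_ident linear_proj])

lemma chart_form_diff_swap: "chart_form W L x y - chart_form W L y x = \<omega> x y"
proof -
  let ?P = "proj W L"
  have "\<omega> (x - ?P x) (y - ?P y) = 0"
    by (intro lagrangian_isotropic[OF transversal_lagrangian(1)] proj_diff_in)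
  moreover have "\<omega> (?P x) (?P y) = 0"
    by (intro lagrangian_isotropic[OF transversal_lagrangian(2)] proj_in)
  ultimately show ?thesis using omega_skew[of y "?P x"] by (simp add: chart_form_def omega_simps)
qed

lemma symmetric_form_on_chart_form:
  assumes C: "lagrangian \<omega> C"
  shows "symmetric_form_on (chart_form W L) C"
  using bilinear_chart_form lagrangian_subspace[OF C] lagrangian_isotropic[OF C] chart_form_diff_swap
  unfolding symmetric_form_on_def by (metis eq_iff_diff_eq_0)

lemma form_radical_chart_form:
  assumes C: "lagrangian \<omega> C"
  shows "form_radical (chart_form W L) C = sum_space (C \<inter> L) (C \<inter> W)"
proof -
  have "(\<forall>u\<in>C. \<omega> u (proj W L x) = 0) \<longleftrightarrow> proj W L x \<in> C" for x
    using lagrangian_maximal[OF C] lagrangian_isotropic[OF C] by blast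
  then have "form_radical (chart_form W L) C = {x\<in>C. proj W L x \<in> C}"
    by (simp add: annihilator_def chart_form_def)
  also have "\<dots> = sum_space (C \<inter> L) (C \<inter> W)"
  proof (intro equalityI subsetI)
    fix x assume x: "x \<in> {x\<in>C. proj W L x \<in> C}"
    then have "x - proj W L x \<in> C \<inter> W" "proj W L x \<in> C \<inter> L"
      using proj_in proj_diff_in subspace_diff[OF lagrangian_subspace[OF C]] by auto
    moreover have "x = proj W L x + (x - proj W L x)" by simp
    ultimately show "x \<in> sum_space (C \<inter> L) (C \<inter> W)" by blast
  next
    fix x assume "x \<in> sum_space (C \<inter> L) (C \<inter> W)"
    then obtain y w where x: "x = y + w" "y \<in> C \<inter> L" "w \<in> C \<inter> W" by blast
    then have "proj W L x = y" by (intro proj_unique) auto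
    then show "x \<in> {x\<in>C. proj W L x \<in> C}" using x subspace_add[OF lagrangian_subspace[OF C]] by auto
  qed
  finally show ?thesis .
qed

lemma dim_Int_sum_space:
  assumes C: "subspace C" and M: "subspace M" "M \<subseteq> L"
  shows "dim (sum_space (C \<inter> M) (C \<inter> W)) = dim (C \<inter> M) + dim (C \<inter> W)"
  using transversal_Int M(2)
  by (intro dim_sum_space_disjoint subspace_inter C M(1) transversal_subspace) auto

lemma dim_form_radical_chart_form:
  assumes C: "lagrangian \<omega> C"
  shows "dim (form_radical (chart_form W L) C) = dim (C \<inter> L) + dim (C \<inter> W)"
  unfolding form_radical_chart_form[OF C]
  by (intro dim_Int_sum_space lagrangian_subspace[OF C] transversal_subspace order_refl)

end

lemma proj_swap: "transversal W L \<Longrightarrow> proj L W x = x - proj W L x"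
  by (rule proj_unique[OF transversal_sym]) (auto simp: proj_in proj_diff_in)

lemma chart_index_swap:
  assumes tr: "transversal W L" and C: "lagrangian \<omega> C"
  shows "chart_index C W L + chart_index C L W + dim (C \<inter> L) + dim (C \<inter> W) = dim C"
proof -
  have "chart_index C L W = neg_index (\<lambda>x. chart_form W L x x) C"
    unfolding chart_index_def neg_index_def chart_form_def
    by (intro pos_index_cong) (simp add: proj_swap[OF tr] omega_simps)
  then show ?thesis
    using sylvester_inertia[OF symmetric_form_on_chart_form[OF tr C]] dim_form_radical_chart_form[OF tr C]
    unfolding chart_index_def by simp
qed

subsection \<open>The cocycle identity for the triple index\<close>

lemma triple_Q_eq:
  assumes L: "lagrangian \<omega> \<beta>" "lagrangian \<omega> \<gamma>" and yz: "y \<in> \<beta>" "z \<in> \<gamma>"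
  shows "triple_Q \<omega> \<beta> \<gamma> (y + z) = \<omega> y z"
proof -
  let ?S = "SOME (y', z'). y' \<in> \<beta> \<and> z' \<in> \<gamma> \<and> y + z = y' + z'"
  have "case ?S of (y', z') \<Rightarrow> y' \<in> \<beta> \<and> z' \<in> \<gamma> \<and> y + z = y' + z'"
    by (rule someI[of _ "(y, z)"]) (use yz in simp)
  then obtain y' z' where S: "?S = (y', z')" and chosen: "y' \<in> \<beta>" "z' \<in> \<gamma>" "y + z = y' + z'"
    by (cases ?S) auto
  have diff: "y - y' = z' - z" using chosen(3) by (simp add: algebra_simps)
  have "y - y' \<in> \<beta>" by (intro subspace_diff lagrangian_subspace L yz chosen)
  moreover have "y - y' \<in> \<gamma>"
    unfolding diff by (intro subspace_diff lagrangian_subspace L yz chosen)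
  ultimately have "\<omega> (y - y') y' = 0" "\<omega> (y - y') z' = 0"
    using lagrangian_isotropic[OF L(1)] lagrangian_isotropic[OF L(2)] chosen by auto
  then have "\<omega> y (y' + z') = \<omega> y' z'" by (simp add: omega_simps)
  moreover have "\<omega> y (y' + z') = \<omega> y z" unfolding chosen(3)[symmetric] by (simp add: omega_simps)
  ultimately have "\<omega> y z = \<omega> y' z'" by simp
  then show ?thesis unfolding triple_Q_def S by simp
qed

lemma triple_index_le:
  assumes L: "lagrangian \<omega> A" "lagrangian \<omega> B" "lagrangian \<omega> C"
  shows "triple_index \<omega> A B C \<le> int (dim A) - int (dim (A \<inter> B))"
proof -
  let ?S = "A \<inter> sum_space B C" and ?Z = "sum_space (A \<inter> B) (A \<inter> C)"
  have sub: "subspace A" "subspace B" "subspace C" using L by (auto dest: lagrangian_subspace)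
  have "pos_index (triple_Q \<omega> B C) ?S + dim ?Z \<le> dim ?S"
  proof (intro pos_index_add_nonpos_le subspace_inter subspace_sums sub)
    show "?Z \<subseteq> ?S" using sub(1) by (auto intro: subspace_add)
    fix v assume "v \<in> ?Z"
    then obtain y z where v: "v = y + z" "y \<in> A" "y \<in> B" "z \<in> A" "z \<in> C" by auto
    then show "triple_Q \<omega> B C v \<le> 0"
      using lagrangian_isotropic[OF L(1)] by (simp add: triple_Q_eq[OF L(2,3)])
  qed
  moreover have "dim ?S \<le> dim A" by (rule dim_subset) auto
  moreover have "dim ?Z + dim ((A \<inter> B) \<inter> (A \<inter> C)) = dim (A \<inter> B) + dim (A \<inter> C)"
    using sub by (intro dim_sums_Int subspace_inter)
  moreover have "(A \<inter> B) \<inter> (A \<inter> C) = A \<inter> B \<inter> C" by auto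
  ultimately show ?thesis unfolding triple_index_def by simp
qed

definition diff_form :: "'v set \<Rightarrow> 'v set \<Rightarrow> 'v set \<Rightarrow> 'v \<Rightarrow> 'v \<Rightarrow> real" where
  "diff_form X A B x y = chart_form X A x y - chart_form X B x y"

text \<open>Restricted to the diagonal of \<open>C\<close> this form is \<open>chart_form X A\<close>; on the orthogonal complement
  of the diagonal it is a pullback of \<open>triple_Q\<close>.\<close>

definition cocycle_form :: "'v set \<Rightarrow> 'v set \<Rightarrow> 'v set \<Rightarrow> 'v \<times> 'v \<Rightarrow> 'v \<times> 'v \<Rightarrow> real" where
  "cocycle_form X A B p q = diff_form X A B (fst p) (fst q) + chart_form X B (snd p) (snd q)"

abbreviation diagonal :: "'v set \<Rightarrow> ('v \<times> 'v) set" where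
  "diagonal S \<equiv> (\<lambda>x. (x, x)) ` S"

lemma linear_diag: "linear (\<lambda>x::'v. (x, x))"
  by (rule linearI) auto

lemma subspace_diagonal: "subspace S \<Longrightarrow> subspace (diagonal S)"
  by (rule linear_subspace_image[OF linear_diag])

lemma dim_diagonal: "subspace S \<Longrightarrow> dim (diagonal S) = dim S"
  by (intro dim_image_inj_on linear_diag) (auto simp: inj_on_def)

context
  fixes X A B assumes A: "transversal X A" and B: "transversal X B"
begin

lemma symmetric_form_on_diff_form: "symmetric_form_on (diff_form X A B) UNIV"
proof -
  have "bilinear (diff_form X A B)"
    using bilinear_add[OF bilinear_chart_form[OF A] bilinear_uminus[OF bilinear_chart_form[OF B]]]
    by (simp add: diff_form_def[abs_def])
  moreover have "diff_form X A B x y = diff_form X A B y x" for x y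
    using chart_form_diff_swap[OF A, of x y] chart_form_diff_swap[OF B, of x y] by (simp add: diff_form_def)
  ultimately show ?thesis by (simp add: symmetric_form_on_def)
qed

lemma form_radical_diff_form: "form_radical (diff_form X A B) UNIV = sum_space (A \<inter> B) X"
proof -
  have "(\<forall>u. \<omega> u (proj X A x - proj X B x) = 0) \<longleftrightarrow> proj X A x = proj X B x" for x
    using omega_nondegenerate_right[of "proj X A x - proj X B x"] by (auto simp: omega_simps)
  then have "form_radical (diff_form X A B) UNIV = {x. proj X A x = proj X B x}"
    by (simp add: annihilator_def diff_form_def chart_form_def omega_simps)
  also have "\<dots> = sum_space (A \<inter> B) X"
  proof (intro equalityI subsetI)
    fix x assume "x \<in> {x. proj X A x = proj X B x}"
    then have "proj X A x \<in> A \<inter> B" using proj_in[OF A, of x] proj_in[OF B, of x] by simp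
    moreover have "x = proj X A x + (x - proj X A x)" by simp
    ultimately show "x \<in> sum_space (A \<inter> B) X" using proj_diff_in[OF A, of x] by blast
  next
    fix x assume "x \<in> sum_space (A \<inter> B) X"
    then obtain a w where x: "x = a + w" "a \<in> A \<inter> B" "w \<in> X" by blast
    then have "proj X A x = a" "proj X B x = a" by (auto intro: proj_unique[OF A] proj_unique[OF B])
    then show "x \<in> {x. proj X A x = proj X B x}" by simp
  qed
  finally show ?thesis .
qed

lemma dim_form_radical_diff_form:
  "dim (form_radical (diff_form X A B) UNIV) = dim (A \<inter> B) + dim X"
  unfolding form_radical_diff_form
  using dim_Int_sum_space[OF A subspace_UNIV, of "A \<inter> B"] transversal_subspace[OF A]
      transversal_subspace[OF B]
  by (simp add: subspace_inter)

lemma bilinear_cocycle_form: "bilinear (cocycle_form X A B)"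
  unfolding cocycle_form_def[abs_def]
  by (intro bilinear_add linear_fst linear_snd bilinear_chart_form[OF B]
      bilinear_compose[OF symmetric_form_onD(1)[OF symmetric_form_on_diff_form]]
      bilinear_compose[OF bilinear_chart_form[OF B]])

lemma cocycle_form_diagonal:
  "cocycle_form X A B (c, c) q = \<omega> c (proj X A (fst q) - proj X B (fst q) + proj X B (snd q))"
  by (simp add: cocycle_form_def diff_form_def chart_form_def omega_simps)

context
  fixes C assumes C: "lagrangian \<omega> C"
begin

lemma symmetric_form_on_cocycle_form: "symmetric_form_on (cocycle_form X A B) (UNIV \<times> C)"
  using bilinear_cocycle_form subspace_Times[OF subspace_UNIV lagrangian_subspace[OF C]]
    symmetric_form_onD(3)[OF symmetric_form_on_diff_form]
        symmetric_form_onD(3)[OF symmetric_form_on_chart_form[OF B C]]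
  unfolding symmetric_form_on_def by (auto simp: cocycle_form_def)

lemma form_index_cocycle_form_diagonal: "form_index (cocycle_form X A B) (diagonal C) = chart_index C X A"
proof -
  have "pos_index (\<lambda>c. cocycle_form X A B (c, c) (c, c)) C = form_index (cocycle_form X A B) (diagonal C)"
    by (intro pos_index_linear_pullback[OF linear_diag lagrangian_subspace[OF C]] bilinear_lzero
        bilinear_cocycle_form)
  then show ?thesis by (simp add: cocycle_form_diagonal chart_index_def chart_form_def)
qed

lemma dim_form_radical_cocycle_form_diagonal:
  "dim (form_radical (cocycle_form X A B) (diagonal C)) = dim (C \<inter> A) + dim (C \<inter> X)"
proof -
  have "form_radical (cocycle_form X A B) (diagonal C) = diagonal (form_radical (chart_form X A) C)"
    by (auto simp: annihilator_def cocycle_form_diagonal chart_form_def)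
  then show ?thesis
    using dim_form_radical_chart_form[OF A C]
      dim_diagonal[OF subspace_form_radical[OF symmetric_form_on_chart_form[OF A C]]] by simp
qed

lemma dim_diagonal_Int_form_radical_cocycle_form:
  "dim (diagonal C \<inter> form_radical (cocycle_form X A B) (UNIV \<times> C)) = dim (A \<inter> B \<inter> C) + dim (C \<inter> X)"
proof -
  have null_iff: "(\<forall>q\<in>UNIV \<times> C. cocycle_form X A B q (c, c) = 0) \<longleftrightarrow>
      (\<forall>v. diff_form X A B v c = 0) \<and> (\<forall>u\<in>C. chart_form X B u c = 0)" for c
  proof
    assume null: "\<forall>q\<in>UNIV \<times> C. cocycle_form X A B q (c, c) = 0"
    have "cocycle_form X A B (v, 0) (c, c) = 0" for v
      using null subspace_0[OF lagrangian_subspace[OF C]] by simp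
    then have "diff_form X A B v c = 0" for v by (simp add: cocycle_form_def chart_form_def omega_simps)
    then show "(\<forall>v. diff_form X A B v c = 0) \<and> (\<forall>u\<in>C. chart_form X B u c = 0)"
      using null by (force simp: cocycle_form_def)
  qed (auto simp: cocycle_form_def)
  have "diagonal C \<inter> form_radical (cocycle_form X A B) (UNIV \<times> C) =
      diagonal {c\<in>C. \<forall>q\<in>UNIV \<times> C. cocycle_form X A B q (c, c) = 0}"
    by (auto simp: annihilator_def)
  also have "{c\<in>C. \<forall>q\<in>UNIV \<times> C. cocycle_form X A B q (c, c) = 0} =
      form_radical (diff_form X A B) UNIV \<inter> form_radical (chart_form X B) C"
    unfolding null_iff by (auto simp: annihilator_def)
  also have "form_radical (diff_form X A B) UNIV \<inter> form_radical (chart_form X B) C =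
      sum_space (C \<inter> (A \<inter> B)) (C \<inter> X)"
    unfolding form_radical_diff_form form_radical_chart_form[OF B C]
  proof (intro equalityI subsetI)
    fix x assume "x \<in> sum_space (A \<inter> B) X \<inter> sum_space (C \<inter> B) (C \<inter> X)"
    then obtain a w b z where x: "x = a + w" "a \<in> A \<inter> B" "w \<in> X" "x = b + z" "b \<in> C \<inter> B" "z \<in> C \<inter> X"
      by blast
    have "proj X B x = a" using x(1-3) by (intro proj_unique[OF B]) auto
    moreover have "proj X B x = b" using x(4-6) by (intro proj_unique[OF B]) auto
    ultimately show "x \<in> sum_space (C \<inter> (A \<inter> B)) (C \<inter> X)" using x by blast
  qed blast
  also have "dim (diagonal (sum_space (C \<inter> (A \<inter> B)) (C \<inter> X))) = dim (C \<inter> (A \<inter> B)) + dim (C \<inter> X)"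
  proof -
    have AB: "subspace (A \<inter> B)"
      by (intro subspace_inter transversal_subspace(2)[OF A] transversal_subspace(2)[OF B])
    have "subspace (sum_space (C \<inter> (A \<inter> B)) (C \<inter> X))"
      by (intro subspace_sums subspace_inter AB lagrangian_subspace C transversal_subspace(1)[OF A])
    then show ?thesis
      using dim_diagonal dim_Int_sum_space[OF A lagrangian_subspace[OF C] AB] by simp
  qed
  finally show ?thesis by (simp add: Int_commute Int_left_commute)
qed

lemma annihilator_diagonal_iff:
  "(v, c) \<in> annihilator (cocycle_form X A B) (diagonal C) (UNIV \<times> C) \<longleftrightarrow>
    c \<in> C \<and> proj X A v + (proj X B c - proj X B v) \<in> C"
proof -
  have "(\<forall>u\<in>C. \<omega> u y = 0) \<longleftrightarrow> y \<in> C" for y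
    using lagrangian_maximal[OF C] lagrangian_isotropic[OF C] by blast
  then show ?thesis by (auto simp: annihilator_def cocycle_form_diagonal algebra_simps)
qed

lemma cocycle_form_eq_triple_Q:
  assumes "(v, c) \<in> annihilator (cocycle_form X A B) (diagonal C) (UNIV \<times> C)"
  shows "cocycle_form X A B (v, c) (v, c) = triple_Q \<omega> B C (proj X A v)"
proof -
  define a b where "a = proj X A v" and "b = proj X B c - proj X B v"
  note isotropic_X = lagrangian_isotropic[OF transversal_lagrangian(1)[OF A]]
  have c: "c \<in> C" "a + b \<in> C" using assms by (auto simp: annihilator_diagonal_iff a_def b_def)
  have "b \<in> B" unfolding b_def by (intro subspace_diff proj_in transversal_subspace(2)[OF B] B)
  then have b: "b \<in> B" "- b \<in> B" using subspace_neg[OF transversal_subspace(2)[OF B]] by auto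
  have "(v - proj X B v) - (v - a) \<in> X"
    unfolding a_def by (intro subspace_diff transversal_subspace(1)[OF A] proj_diff_in A B)
  then have aX: "a - proj X B v \<in> X" by simp
  have "v - a \<in> X" unfolding a_def by (rule proj_diff_in[OF A])
  then have "\<omega> (v - a) (a - proj X B v) = 0" using aX by (rule isotropic_X)
  then have diff: "diff_form X A B v v = - \<omega> a (proj X B v)"
    by (simp add: diff_form_def chart_form_def a_def omega_simps)
  have "(c - proj X B c) - (a - proj X B v) \<in> X"
    by (intro subspace_diff transversal_subspace(1)[OF A] proj_diff_in B aX)
  then have "c - (a + b) \<in> X" by (simp add: b_def algebra_simps)
  then have "\<omega> (c - (a + b)) (c - proj X B c) = 0" by (rule isotropic_X[OF _ proj_diff_in[OF B]])
  moreover have "\<omega> (c - (a + b)) c = 0"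
    by (intro lagrangian_isotropic[OF C] subspace_diff lagrangian_subspace[OF C] c)
  ultimately have "\<omega> c (proj X B c) = \<omega> a (proj X B c) + \<omega> b (proj X B c)" by (simp add: omega_simps)
  moreover have "\<omega> b (proj X B c) = 0"
    by (rule lagrangian_isotropic[OF transversal_lagrangian(2)[OF B] b(1) proj_in[OF B]])
  ultimately have "cocycle_form X A B (v, c) (v, c) = \<omega> a b"
    using diff by (simp add: cocycle_form_def chart_form_def b_def omega_simps)
  also have "\<dots> = \<omega> (- b) (a + b)" using omega_skew[of a b] by (simp add: omega_simps)
  also have "\<dots> = triple_Q \<omega> B C (- b + (a + b))"
    by (rule triple_Q_eq[OF transversal_lagrangian(2)[OF B] C b(2) c(2), symmetric])
  finally show ?thesis by (simp add: a_def)
qed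

lemma form_index_cocycle_form_annihilator:
  "form_index (cocycle_form X A B) (annihilator (cocycle_form X A B) (diagonal C) (UNIV \<times> C)) =
    pos_index (triple_Q \<omega> B C) (A \<inter> sum_space B C)"
    (is "form_index _ ?G = _")
proof -
  note LB = transversal_lagrangian(2)[OF B]
  define g where "g p = proj X A (fst p)" for p :: "'v \<times> 'v"
  have g: "linear g" unfolding g_def
    using linear_compose[OF linear_fst linear_proj[OF A]] by (simp add: o_def)
  have G: "subspace ?G"
    by (intro subspace_annihilator bilinear_cocycle_form subspace_Times subspace_UNIV lagrangian_subspace C)
  have "g ` ?G = A \<inter> sum_space B C"
  proof (intro equalityI subsetI)
    fix a assume "a \<in> g ` ?G"
    then obtain v c where "a = proj X A v" "proj X A v + (proj X B c - proj X B v) \<in> C"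
      by (auto simp: g_def annihilator_diagonal_iff)
    moreover have "proj X B v - proj X B c \<in> B"
      by (intro subspace_diff transversal_subspace(2)[OF B] proj_in B)
    moreover have "proj X A v = (proj X B v - proj X B c) + (proj X A v + (proj X B c - proj X B v))"
      by simp
    ultimately show "a \<in> A \<inter> sum_space B C" using proj_in[OF A, of v] by blast
  next
    fix a assume "a \<in> A \<inter> sum_space B C"
    then obtain b c where a: "a \<in> A" "a = b + c" "b \<in> B" "c \<in> C" by blast
    then have "proj X B a = b + proj X B c" by (simp add: linear_add[OF linear_proj[OF B]] proj_id[OF B])
    then have "(a, c) \<in> ?G" using a by (simp add: annihilator_diagonal_iff proj_id[OF A])
    moreover have "g (a, c) = a" using a by (simp add: g_def proj_id[OF A])
    ultimately show "a \<in> g ` ?G" by (metis imageI)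
  qed
  moreover have "triple_Q \<omega> B C 0 = 0"
    using triple_Q_eq[OF LB C, of 0 0] subspace_0 lagrangian_subspace LB C by (auto simp: omega_simps)
  then have "pos_index (\<lambda>p. triple_Q \<omega> B C (g p)) ?G = pos_index (triple_Q \<omega> B C) (g ` ?G)"
    by (rule pos_index_linear_pullback[OF g G])
  moreover have "form_index (cocycle_form X A B) ?G = pos_index (\<lambda>p. triple_Q \<omega> B C (g p)) ?G"
    by (rule pos_index_cong) (auto simp: g_def cocycle_form_eq_triple_Q)
  ultimately show ?thesis by simp
qed

theorem triple_index_cocycle:
  "int (chart_index C X A) - int (chart_index C X B) + triple_index \<omega> A B C =
    int (form_index (diff_form X A B) UNIV)"
proof -
  have "form_index (cocycle_form X A B) (UNIV \<times> C) = form_index (diff_form X A B) UNIV + chart_index C X B"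
    unfolding cocycle_form_def chart_index_def
    by (rule form_index_Times[OF symmetric_form_on_diff_form symmetric_form_on_chart_form[OF B C]])
  moreover have "subspace (diagonal C)" "diagonal C \<subseteq> UNIV \<times> C"
    using subspace_diagonal[OF lagrangian_subspace[OF C]] by auto
  note form_index_orthogonal_decomp[OF symmetric_form_on_cocycle_form this]
  moreover have "A \<inter> C = C \<inter> A" by auto
  ultimately show ?thesis
    unfolding triple_index_def
    using form_index_cocycle_form_diagonal dim_form_radical_cocycle_form_diagonal
      dim_diagonal_Int_form_radical_cocycle_form form_index_cocycle_form_annihilator by simp
qed

end

end

end

subsection \<open>Convergence in the gap topology\<close>

lemma subspace_dist_approx:
  assumes L: "subspace L" and M: "subspace M" and x: "x \<in> L"
  obtains y where "y \<in> M" "norm (x - y) \<le> subspace_dist L M * norm x"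
proof (cases "x = 0")
  case True
  then show ?thesis using that[of 0] subspace_0[OF M] by simp
next
  case False
  let ?u = "x /\<^sub>R norm x"
  have u: "?u \<in> L \<inter> cball 0 1" using x L False by (auto intro: subspace_scale)
  have "bdd_above ((\<lambda>x. infdist x M) ` (L \<inter> cball 0 1))"
    by (rule bdd_aboveI2[of _ _ 1]) (auto intro: infdist_le2[OF subspace_0[OF M]])
  then have "infdist ?u M \<le> (SUP x\<in>L \<inter> cball 0 1. infdist x M)" by (rule cSUP_upper[OF u])
  then have dist_le: "infdist ?u M \<le> subspace_dist L M" by (simp add: subspace_dist_def)
  have "M \<noteq> {}" using subspace_0[OF M] by auto
  then obtain y where y: "y \<in> M" "infdist ?u M = dist ?u y"
    using infdist_attains_inf[OF closed_subspace[OF M]] by blast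
  show ?thesis
  proof (rule that[of "norm x *\<^sub>R y"])
    show "norm x *\<^sub>R y \<in> M" using y M by (auto intro: subspace_scale)
    have "x - norm x *\<^sub>R y = norm x *\<^sub>R (?u - y)" using False by (simp add: scaleR_diff_right)
    then have "norm (x - norm x *\<^sub>R y) = norm x * dist ?u y" by (simp add: dist_norm)
    then show "norm (x - norm x *\<^sub>R y) \<le> subspace_dist L M * norm x"
      using dist_le y(2) by (simp add: mult.commute mult_left_mono)
  qed
qed

lemma subspace_continuous_on_compose:
  assumes "subspace_continuous_on D H" "continuous_on D' g" "g ` D' \<subseteq> D"
  shows "subspace_continuous_on D' (\<lambda>x. H (g x))"
  unfolding subspace_continuous_on_def
proof (intro ballI allI impI)
  fix p and e :: real assume p: "p \<in> D'" and "e > 0"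
  then obtain d where d_pos: "d > 0" and near: "\<forall>q\<in>D. dist q (g p) < d \<longrightarrow> subspace_dist (H q) (H (g p)) < e"
    using assms(1,3) unfolding subspace_continuous_on_def by blast
  obtain d' where "d' > 0" "\<forall>q\<in>D'. dist q p < d' \<longrightarrow> dist (g q) (g p) < d"
    using assms(2) p d_pos unfolding continuous_on_iff by blast
  then show "\<exists>d>0. \<forall>q\<in>D'. dist q p < d \<longrightarrow> subspace_dist (H (g q)) (H (g p)) < e"
    using near assms(3) by blast
qed

context symplectic
begin

definition lag_tendsto :: "('i \<Rightarrow> 'v set) \<Rightarrow> 'v set \<Rightarrow> 'i filter \<Rightarrow> bool" where
  "lag_tendsto H L F \<longleftrightarrow> (\<forall>e>0. \<forall>\<^sub>F q in F. lagrangian \<omega> (H q) \<and> subspace_dist (H q) L < e)"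

lemma subspace_continuous_on_lag_tendsto:
  assumes cont: "subspace_continuous_on D H" and H: "\<And>q. q \<in> D \<Longrightarrow> lagrangian \<omega> (H q)" and p: "p \<in> D"
  shows "lag_tendsto H (H p) (at p within D)"
  unfolding lag_tendsto_def
proof (intro allI impI)
  fix e :: real assume "e > 0"
  then obtain d where "d > 0" "\<forall>q\<in>D. dist q p < d \<longrightarrow> subspace_dist (H q) (H p) < e"
    using cont p unfolding subspace_continuous_on_def by blast
  then show "\<forall>\<^sub>F q in at p within D. lagrangian \<omega> (H q) \<and> subspace_dist (H q) (H p) < e"
    using H unfolding eventually_at by blast
qed

lemma proj_displacement_bound:
  assumes W: "transversal W L0"
  obtains K where "K > 0"
    "\<And>L y. lagrangian \<omega> L \<Longrightarrow> y \<in> L \<Longrightarrow> norm (proj W L0 y - y) \<le> K * subspace_dist L L0 * norm y"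
proof -
  let ?P = "proj W L0"
  obtain k where k_pos: "k > 0" and proj_le: "\<And>x. norm (?P x) \<le> k * norm x"
    using linear_bounded_pos[OF linear_proj[OF W]] by blast
  show ?thesis
  proof (rule that[of "k + 1"])
    fix L y assume L: "lagrangian \<omega> L" and y: "y \<in> L"
    obtain z where z: "z \<in> L0" "norm (y - z) \<le> subspace_dist L L0 * norm y"
      using subspace_dist_approx[OF lagrangian_subspace[OF L] transversal_subspace(2)[OF W] y] by blast
    have "?P y - y = ?P (y - z) - (y - z)" using z(1) by (simp add: proj_diff[OF W] proj_id[OF W])
    then have "norm (?P y - y) \<le> norm (?P (y - z)) + norm (y - z)" by (metis norm_triangle_ineq4)
    also have "\<dots> \<le> (k + 1) * norm (y - z)" using proj_le[of "y - z"] by (simp add: distrib_right)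
    also have "\<dots> \<le> (k + 1) * (subspace_dist L L0 * norm y)" using z(2) k_pos by (intro mult_left_mono) auto
    finally show "norm (?P y - y) \<le> (k + 1) * subspace_dist L L0 * norm y" by (simp add: mult.assoc)
  qed (use k_pos in simp)
qed

lemma lag_tendsto_proj_displacement:
  assumes W: "transversal W L0" and H: "lag_tendsto H L0 F" and e: "e > 0"
  shows "\<forall>\<^sub>F q in F. lagrangian \<omega> (H q) \<and> (\<forall>y\<in>H q. norm (proj W L0 y - y) \<le> e * norm y)"
proof -
  obtain K where K_pos: "K > 0"
    and displacement_le: "\<And>L y. lagrangian \<omega> L \<Longrightarrow> y \<in> L \<Longrightarrow>
        norm (proj W L0 y - y) \<le> K * subspace_dist L L0 * norm y"
    using proj_displacement_bound[OF W] by blast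
  have "e / K > 0" using e K_pos by simp
  then have "\<forall>\<^sub>F q in F. lagrangian \<omega> (H q) \<and> subspace_dist (H q) L0 < e / K"
    using H unfolding lag_tendsto_def by blast
  then show ?thesis
  proof eventually_elim
    case (elim q)
    then have "K * subspace_dist (H q) L0 \<le> e" using K_pos by (simp add: field_simps)
    then have "K * subspace_dist (H q) L0 * norm y \<le> e * norm y" for y :: 'v by (rule mult_right_mono) simp
    then show ?case using displacement_le elim by (meson order_trans)
  qed
qed

lemma lag_tendsto_transversal:
  assumes W: "transversal W L0" and H: "lag_tendsto H L0 F"
  shows "\<forall>\<^sub>F q in F. transversal W (H q)"
proof -
  have "\<forall>\<^sub>F q in F. lagrangian \<omega> (H q) \<and> (\<forall>y\<in>H q. norm (proj W L0 y - y) \<le> 1 / 2 * norm y)"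
    by (rule lag_tendsto_proj_displacement[OF W H]) simp
  then show ?thesis
  proof eventually_elim
    case (elim q)
    show ?case
    proof (rule transversalI[OF transversal_lagrangian(1)[OF W]])
      fix x assume "x \<in> W" "x \<in> H q"
      then have "norm x \<le> 1 / 2 * norm x" using elim proj_zero[OF W] by fastforce
      then show "x = 0" by simp
    qed (use elim in blast)
  qed
qed

lemma tendsto_proj:
  assumes W: "transversal W L0" and H: "lag_tendsto H L0 F"
  shows "((\<lambda>q. proj W (H q) x) \<longlongrightarrow> proj W L0 x) F"
proof (rule tendstoI)
  fix \<epsilon> :: real assume \<epsilon>: "\<epsilon> > 0"
  let ?x0 = "proj W L0 x"
  let ?b = "2 * (norm ?x0 + 1)"
  define e where "e = min (1 / 2) (\<epsilon> / ?b)"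
  have b: "?b > 0" by (simp add: add_nonneg_pos)
  then have e: "e > 0" "e \<le> 1 / 2" using \<epsilon> unfolding e_def by (simp, intro min.cobounded1)
  have "e \<le> \<epsilon> / ?b" unfolding e_def by (rule min.cobounded2)
  then have e_b: "e * ?b \<le> \<epsilon>" using b by (simp add: pos_le_divide_eq)
  from lag_tendsto_transversal[OF W H] lag_tendsto_proj_displacement[OF W H e(1)]
  show "\<forall>\<^sub>F q in F. dist (proj W (H q) x) ?x0 < \<epsilon>"
  proof eventually_elim
    case (elim q)
    let ?y = "proj W (H q) x"
    have "proj W L0 (x - ?y) = 0" by (rule proj_zero[OF W proj_diff_in[OF elim(1)]])
    then have diff_le: "norm (?x0 - ?y) \<le> e * norm ?y"
      using elim(2) proj_in[OF elim(1), of x] by (simp add: proj_diff[OF W])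
    have "norm ?y \<le> norm ?x0 + norm (?x0 - ?y)" by (metis norm_minus_commute norm_triangle_sub)
    also have "norm (?x0 - ?y) \<le> 1 / 2 * norm ?y"
      using diff_le mult_right_mono[OF e(2) norm_ge_zero[of ?y]] by linarith
    finally have "norm ?y \<le> 2 * norm ?x0" by simp
    then have "e * norm ?y \<le> e * (2 * norm ?x0)" using e(1) by (intro mult_left_mono) auto
    also have "\<dots> < e * ?b" using e(1) by simp
    finally show ?case using diff_le e_b by (simp add: dist_norm norm_minus_commute)
  qed
qed

lemma form_index_diff_form_locally_constant:
  assumes A: "transversal X0 A0" and B: "transversal X0 B0"
    and eventually_transversal: "\<forall>\<^sub>F t in F. transversal (X t) (A t) \<and> transversal (X t) (B t) \<and>
        dim (A t \<inter> B t) = dim (A0 \<inter> B0)"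
    and lim: "\<And>x. ((\<lambda>t. proj (X t) (A t) x) \<longlongrightarrow> proj X0 A0 x) F"
        "\<And>x. ((\<lambda>t. proj (X t) (B t) x) \<longlongrightarrow> proj X0 B0 x) F"
  shows "\<forall>\<^sub>F t in F. form_index (diff_form (X t) (A t) (B t)) UNIV = form_index (diff_form X0 A0 B0) UNIV"
proof (rule form_index_locally_constant[OF symmetric_form_on_diff_form[OF A B],
      of "\<lambda>t. diff_form (X t) (A t) (B t)"])
  show "\<forall>\<^sub>F t in F. symmetric_form_on (diff_form (X t) (A t) (B t)) UNIV \<and>
    dim (form_radical (diff_form (X t) (A t) (B t)) UNIV) = dim (form_radical (diff_form X0 A0 B0) UNIV)"
    using eventually_transversal
  proof eventually_elim
    case (elim t)
    then have t: "transversal (X t) (A t)" "transversal (X t) (B t)" by auto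
    have "dim (X t) = dim X0"
      using lagrangian_dim[OF transversal_lagrangian(1)[OF t(1)]]
          lagrangian_dim[OF transversal_lagrangian(1)[OF A]]
      by simp
    then show ?case
      using elim by (simp add: symmetric_form_on_diff_form dim_form_radical_diff_form[OF t]
          dim_form_radical_diff_form[OF A B])
  qed
  show "((\<lambda>t. diff_form (X t) (A t) (B t) x y) \<longlongrightarrow> diff_form X0 A0 B0 x y) F" for x y
    unfolding diff_form_def chart_form_def
    by (intro tendsto_diff bounded_bilinear.tendsto[OF bounded_bilinear_omega] tendsto_const lim)
qed

lemma chart_index_diff_locally_constant:
  assumes C: "lagrangian \<omega> C" and W: "transversal W L0" "transversal W' L0" and H: "lag_tendsto H L0 F"
  shows "\<forall>\<^sub>F q in F. int (chart_index C W (H q)) - int (chart_index C W' (H q)) =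
    int (chart_index C W L0) - int (chart_index C W' L0)"
proof -
  have transversal_H: "\<forall>\<^sub>F q in F. transversal W (H q) \<and> transversal W' (H q)"
    by (intro eventually_conj lag_tendsto_transversal[OF _ H] W)
  have lim: "((\<lambda>q. proj (H q) V x) \<longlongrightarrow> proj L0 V x) F" if V: "transversal V L0" for V x
  proof -
    have "((\<lambda>q. x - proj V (H q) x) \<longlongrightarrow> proj L0 V x) F"
      unfolding proj_swap[OF V] by (intro tendsto_diff tendsto_const tendsto_proj[OF V H])
    moreover have "\<forall>\<^sub>F q in F. x - proj V (H q) x = proj (H q) V x"
      using lag_tendsto_transversal[OF V H] by eventually_elim (simp add: proj_swap)
    ultimately show ?thesis by (rule Lim_transform_eventually)
  qed
  have "\<forall>\<^sub>F q in F. form_index (diff_form (H q) W W') UNIV = form_index (diff_form L0 W W') UNIV"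
    by (rule form_index_diff_form_locally_constant[OF W[THEN transversal_sym] _ lim[OF W(1)] lim[OF W(2)]])
      (use transversal_H in eventually_elim, auto intro: transversal_sym)
  with transversal_H show ?thesis
  proof eventually_elim
    case (elim q)
    then have q: "transversal W (H q)" "transversal W' (H q)" by auto
    show ?case
      using elim(2) triple_index_cocycle[OF transversal_sym[OF q(1)] transversal_sym[OF q(2)] C]
        triple_index_cocycle[OF transversal_sym[OF W(1)] transversal_sym[OF W(2)] C]
        chart_index_swap[OF q(1) C] chart_index_swap[OF q(2) C]
        chart_index_swap[OF W(1) C] chart_index_swap[OF W(2) C] by linarith
  qed
qed

end

subsection \<open>Primitives of the chart indices\<close>

lemma rectangle_subset_ball:
  fixes s t :: real
  assumes "x \<le> s \<and> s \<le> y \<and> y - x < r / 2" "u \<le> t \<and> t \<le> v \<and> v - u < r / 2"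
  shows "{x..y} \<times> {u..v} \<subseteq> ball (s, t) r"
proof
  fix p assume p: "p \<in> {x..y} \<times> {u..v}"
  have "dist (s, t) p \<le> dist s (fst p) + dist t (snd p)"
    unfolding dist_prod_def fst_conv snd_conv by (rule sqrt_sum_squares_le_sum) auto
  also have "\<dots> < r" using p assms by (auto simp: dist_real_def)
  finally show "p \<in> ball (s, t) r" by simp
qed

lemma rectangle_subdivision:
  fixes P :: "real \<Rightarrow> real \<Rightarrow> real \<Rightarrow> real \<Rightarrow> bool"
  assumes ab: "a \<le> b" "c \<le> d"
    and glue_fst: "\<And>x y z u v. P x y u v \<Longrightarrow> P y z u v \<Longrightarrow> x \<le> y \<Longrightarrow> y \<le> z \<Longrightarrow> P x z u v"
    and glue_snd: "\<And>x y u v w. P x y u v \<Longrightarrow> P x y v w \<Longrightarrow> u \<le> v \<Longrightarrow> v \<le> w \<Longrightarrow> P x y u w"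
    and small: "\<And>s t. s \<in> {a..b} \<Longrightarrow> t \<in> {c..d} \<Longrightarrow>
      \<exists>r>0. \<forall>x y u v. x \<le> s \<and> s \<le> y \<and> y - x < r \<longrightarrow> u \<le> t \<and> t \<le> v \<and> v - u < r \<longrightarrow> P x y u v"
  shows "P a b c d"
  using ab(1)
proof (induction rule: Bolzano)
  case (trans x y z)
  then show ?case by (rule glue_fst)
next
  case (local s)
  show "\<exists>r>0. \<forall>x y. x \<le> s \<and> s \<le> y \<and> y - x < r \<longrightarrow> P x y c d"
    using ab(2)
  proof (induction rule: Bolzano)
    case (trans u v w)
    obtain r where r: "r > 0" "\<And>x y. x \<le> s \<and> s \<le> y \<and> y - x < r \<Longrightarrow> P x y u v" using trans(1) by blast
    obtain r' where r': "r' > 0" "\<And>x y. x \<le> s \<and> s \<le> y \<and> y - x < r' \<Longrightarrow> P x y v w" using trans(2) by blast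
    show ?case
      using r r' glue_snd[OF r(2) r'(2) trans(3,4)] by (intro exI[of _ "min r r'"]) simp
  next
    case (local t)
    obtain r where "r > 0"
      "\<And>x y u v. x \<le> s \<and> s \<le> y \<and> y - x < r \<Longrightarrow> u \<le> t \<and> t \<le> v \<and> v - u < r \<Longrightarrow> P x y u v"
      using small[of s t] local \<open>a \<le> s\<close> \<open>s \<le> b\<close> by auto
    then show ?case by blast
  qed
qed

context symplectic
begin

text \<open>The increment of a primitive along a path is the Maslov index of the path with respect to
  \<open>C\<close>.\<close>

definition primitive :: "'v set \<Rightarrow> 'a::topological_space set \<Rightarrow> ('a \<Rightarrow> 'v set) \<Rightarrow> ('a \<Rightarrow> int) \<Rightarrow> bool" where
  "primitive C D H M \<longleftrightarrow> (\<forall>p\<in>D. \<forall>W. transversal W (H p) \<longrightarrow> (\<forall>\<^sub>F q in at p within D.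
     M q - M p = int (chart_index C W (H q)) - int (chart_index C W (H p))))"

lemma primitiveD:
  assumes "primitive C D H M" "p \<in> D" "transversal W (H p)"
  shows "\<forall>\<^sub>F q in at p within D. M q - M p = int (chart_index C W (H q)) - int (chart_index C W (H p))"
  using assms unfolding primitive_def by blast

lemma primitive_subset: "primitive C D H M \<Longrightarrow> D' \<subseteq> D \<Longrightarrow> primitive C D' H M"
  unfolding primitive_def by (meson at_le filter_leD subsetD)

lemma primitive_cong:
  assumes M: "primitive C D H M" and H: "\<And>p. p \<in> D \<Longrightarrow> H p = H' p"
    and M': "\<And>p. p \<in> D \<Longrightarrow> M' p = M p + k"
  shows "primitive C D H' M'"
  unfolding primitive_def
proof (intro ballI allI impI)
  fix p W assume p: "p \<in> D" and W: "transversal W (H' p)"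
  have "\<forall>\<^sub>F q in at p within D. q \<in> D" by (auto simp: eventually_at_filter)
  moreover have "transversal W (H p)" using W H[OF p] by simp
  note primitiveD[OF M p this]
  ultimately show "\<forall>\<^sub>F q in at p within D. M' q - M' p =
      int (chart_index C W (H' q)) - int (chart_index C W (H' p))"
    by eventually_elim (simp add: H[symmetric] M' p)
qed

lemma primitive_diff_constant:
  assumes M: "primitive C D H M" "primitive C D H M'" and D: "connected D"
    and H: "\<And>p. p \<in> D \<Longrightarrow> lagrangian \<omega> (H p)" and pq: "p \<in> D" "q \<in> D"
  shows "M p - M' p = M q - M' q"
proof (rule connected_local_const[OF D pq, of "\<lambda>x. M x - M' x"], intro ballI)
  fix a assume a: "a \<in> D"
  obtain W where W: "transversal W (H a)" using transversal_exists[OF H[OF a]] .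
  from primitiveD[OF M(1) a W] primitiveD[OF M(2) a W]
  show "\<forall>\<^sub>F b in at a within D. M a - M' a = M b - M' b"
    by eventually_elim simp
qed

lemma primitive_compose:
  assumes M: "primitive C D H M" and g: "continuous_on D' g" "g ` D' \<subseteq> D"
  shows "primitive C D' (\<lambda>x. H (g x)) (\<lambda>x. M (g x))"
  unfolding primitive_def
proof (intro ballI allI impI)
  fix p W assume p: "p \<in> D'" and W: "transversal W (H (g p))"
  let ?P = "\<lambda>q. M q - M (g p) = int (chart_index C W (H q)) - int (chart_index C W (H (g p)))"
  have "g p \<in> D" using p g(2) by auto
  then have "\<forall>\<^sub>F q in nhds (g p). q \<in> D \<longrightarrow> ?P q"
    using primitiveD[OF M _ W] unfolding eventually_at_filter by (auto elim!: eventually_mono)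
  moreover have "(g \<longlongrightarrow> g p) (at p within D')" using g(1) p by (simp add: continuous_on_def)
  ultimately have "\<forall>\<^sub>F q in at p within D'. g q \<in> D \<longrightarrow> ?P (g q)" by (rule eventually_compose_filterlim)
  moreover have "\<forall>\<^sub>F q in at p within D'. g q \<in> D"
    using g(2) by (auto simp: eventually_at_filter intro!: always_eventually)
  ultimately show "\<forall>\<^sub>F q in at p within D'. ?P (g q)" by (auto elim: eventually_elim2)
qed

lemma primitive_closed_union:
  assumes D: "closed D1" "closed D2" and M: "primitive C D1 H M" "primitive C D2 H M"
  shows "primitive C (D1 \<union> D2) H M"
  unfolding primitive_def
proof (intro ballI allI impI)
  fix p W assume W: "transversal W (H p)"
  have "\<forall>\<^sub>F q in at p within E. M q - M p = int (chart_index C W (H q)) - int (chart_index C W (H p))"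
    if E: "primitive C E H M" "closed E" for E
  proof (cases "p \<in> E")
    case False
    have "closure (E - {p}) \<subseteq> E" using E(2) by (intro closure_minimal) auto
    then have "at p within E = bot" using False by (auto simp: at_within_eq_bot_iff)
    then show ?thesis by simp
  qed (rule primitiveD[OF E(1) _ W])
  then show "\<forall>\<^sub>F q in at p within D1 \<union> D2. M q - M p =
      int (chart_index C W (H q)) - int (chart_index C W (H p))"
    unfolding at_within_union eventually_sup using M D by blast
qed

lemma primitive_glue:
  assumes M: "primitive C D1 H M1" "primitive C D2 H M2"
    and D: "closed D1" "closed D2" "connected (D1 \<inter> D2)"
    and H: "\<And>p. p \<in> D1 \<Longrightarrow> lagrangian \<omega> (H p)"
  obtains M where "primitive C (D1 \<union> D2) H M"
proof -
  obtain k where difference: "\<And>p. p \<in> D1 \<inter> D2 \<Longrightarrow> M1 p - M2 p = k"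
  proof (cases "D1 \<inter> D2 = {}")
    case False
    then obtain p0 where p0: "p0 \<in> D1 \<inter> D2" by auto
    have "primitive C (D1 \<inter> D2) H M1" "primitive C (D1 \<inter> D2) H M2"
      using M by (auto intro: primitive_subset)
    from primitive_diff_constant[OF this D(3) _ _ p0] H that show ?thesis by blast
  qed (use that in blast)
  define M where "M p = (if p \<in> D1 then M1 p else M2 p + k)" for p
  have M_D2: "M p = M2 p + k" if "p \<in> D2" for p using difference[of p] that by (auto simp: M_def)
  have "primitive C D1 H M" by (rule primitive_cong[OF M(1), where k = 0]) (auto simp: M_def)
  moreover have "primitive C D2 H M" by (rule primitive_cong[OF M(2)]) (auto simp: M_D2)
  ultimately show ?thesis using that primitive_closed_union[OF D(1,2)] by blast
qed

lemma primitive_local: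
  fixes H :: "'a::metric_space \<Rightarrow> 'v set"
  assumes C: "lagrangian \<omega> C" and H: "\<And>p. p \<in> D \<Longrightarrow> lagrangian \<omega> (H p)"
    and cont: "subspace_continuous_on D H" and p: "p \<in> D"
  obtains r M where "r > 0" "primitive C (D \<inter> ball p r) H M"
proof -
  obtain W where W: "transversal W (H p)" using transversal_exists[OF H[OF p]] .
  have "\<forall>\<^sub>F q in at p within D. transversal W (H q)"
    by (rule lag_tendsto_transversal[OF W subspace_continuous_on_lag_tendsto[OF cont H p]])
  then obtain r where r_pos: "r > 0" and near: "\<And>q. q \<in> D \<Longrightarrow> q \<noteq> p \<Longrightarrow> dist q p < r \<Longrightarrow> transversal W (H q)"
    unfolding eventually_at by blast
  have "primitive C (D \<inter> ball p r) H (\<lambda>q. int (chart_index C W (H q)))"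
    unfolding primitive_def
  proof (intro ballI allI impI)
    fix q W' assume q: "q \<in> D \<inter> ball p r" and W': "transversal W' (H q)"
    then have Wq: "transversal W (H q)" using near[of q] W by (cases "q = p") (auto simp: dist_commute)
    have "lag_tendsto H (H q) (at q within D)"
      using q by (intro subspace_continuous_on_lag_tendsto cont H) auto
    then have "\<forall>\<^sub>F x in at q within D. int (chart_index C W (H x)) - int (chart_index C W (H q)) =
        int (chart_index C W' (H x)) - int (chart_index C W' (H q))"
      by (rule chart_index_diff_locally_constant[OF C Wq W', THEN eventually_mono]) simp
    then show
        "\<forall>\<^sub>F x in at q within D \<inter> ball p r. int (chart_index C W (H x)) - int (chart_index C W (H q)) =
        int (chart_index C W' (H x)) - int (chart_index C W' (H q))"
      by (rule filter_leD[OF at_le, rotated]) auto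
  qed
  then show ?thesis using that r_pos by blast
qed

lemma primitive_convex_union:
  fixes H :: "'a::real_normed_vector \<Rightarrow> 'v set"
  assumes M: "\<exists>M. primitive C D1 H M" "\<exists>M. primitive C D2 H M"
    and D: "closed D1" "closed D2" "convex D1" "convex D2"
    and H: "\<And>p. p \<in> D1 \<Longrightarrow> lagrangian \<omega> (H p)"
  shows "\<exists>M. primitive C (D1 \<union> D2) H M"
proof -
  obtain M1 M2 where M12: "primitive C D1 H M1" "primitive C D2 H M2" using M by blast
  have "connected (D1 \<inter> D2)" by (intro convex_connected convex_Int D(3,4))
  then obtain M where "primitive C (D1 \<union> D2) H M"
    by (rule primitive_glue[OF M12 D(1,2) _ H])
  then show ?thesis by blast
qed

lemma primitive_rectangle:
  fixes H :: "real \<times> real \<Rightarrow> 'v set"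
  assumes C: "lagrangian \<omega> C" and ab: "a \<le> b" "c \<le> d"
    and H: "\<And>p. p \<in> {a..b} \<times> {c..d} \<Longrightarrow> lagrangian \<omega> (H p)"
    and cont: "subspace_continuous_on ({a..b} \<times> {c..d}) H"
  obtains M where "primitive C ({a..b} \<times> {c..d}) H M"
proof -
  define R where "R x y u v = ({a..b} \<times> {c..d}) \<inter> {x..y} \<times> {u..v}" for x y u v
  have glue: "\<exists>M. primitive C (R x y u v \<union> R x' y' u' v') H M"
    if "\<exists>M. primitive C (R x y u v) H M" "\<exists>M. primitive C (R x' y' u' v') H M" for x y u v x' y' u' v'
    using that unfolding R_def
    by (rule primitive_convex_union)
      (auto intro!: closed_Int closed_Times convex_Int convex_Times convex_real_interval H)
  have "\<exists>M. primitive C (R a b c d) H M"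
  proof (rule rectangle_subdivision[OF ab])
    show "\<exists>M. primitive C (R x z u v) H M"
      if "\<exists>M. primitive C (R x y u v) H M" "\<exists>M. primitive C (R y z u v) H M" "x \<le> y" "y \<le> z" for x y z u v
    proof -
      have "R x z u v = R x y u v \<union> R y z u v" using that(3,4) by (auto simp: R_def)
      then show ?thesis using glue[OF that(1,2)] by simp
    qed
    show "\<exists>M. primitive C (R x y u w) H M"
      if "\<exists>M. primitive C (R x y u v) H M" "\<exists>M. primitive C (R x y v w) H M" "u \<le> v" "v \<le> w" for x y u v w
    proof -
      have "R x y u w = R x y u v \<union> R x y v w" using that(3,4) by (auto simp: R_def)
      then show ?thesis using glue[OF that(1,2)] by simp
    qed
    fix s t assume "s \<in> {a..b}" "t \<in> {c..d}"
    then have "(s, t) \<in> {a..b} \<times> {c..d}" by simp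
    then obtain r M where r: "r > 0" and M: "primitive C (({a..b} \<times> {c..d}) \<inter> ball (s, t) r) H M"
      using primitive_local[OF C H cont] by blast
    have "\<exists>M. primitive C (R x y u v) H M"
      if "x \<le> s \<and> s \<le> y \<and> y - x < r / 2" "u \<le> t \<and> t \<le> v \<and> v - u < r / 2" for x y u v
    proof -
      have "R x y u v \<subseteq> ({a..b} \<times> {c..d}) \<inter> ball (s, t) r"
        unfolding R_def using rectangle_subset_ball[OF that] by blast
      then show ?thesis using primitive_subset[OF M] by blast
    qed
    then show "\<exists>r>0. \<forall>x y u v. x \<le> s \<and> s \<le> y \<and> y - x < r \<longrightarrow> u \<le> t \<and> t \<le> v \<and> v - u < r \<longrightarrow>
        (\<exists>M. primitive C (R x y u v) H M)"
      using r by (intro exI[of _ "r / 2"]) simp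
  qed
  then show ?thesis using that by (auto simp: R_def)
qed

lemma primitive_interval:
  fixes l :: "real \<Rightarrow> 'v set"
  assumes C: "lagrangian \<omega> C" and ab: "a \<le> b" and l: "\<And>t. t \<in> {a..b} \<Longrightarrow> lagrangian \<omega> (l t)"
    and cont: "subspace_continuous_on {a..b} l"
  obtains M where "primitive C {a..b} l M"
proof -
  have "subspace_continuous_on ({0..1::real} \<times> {a..b}) (\<lambda>p. l (snd p))"
    by (rule subspace_continuous_on_compose[OF cont]) (auto intro: continuous_intros)
  then obtain M where M: "primitive C ({0..1::real} \<times> {a..b}) (\<lambda>p. l (snd p)) M"
    using primitive_rectangle[OF C zero_le_one ab, of "\<lambda>p. l (snd p)"] l by force
  have "primitive C {a..b} (\<lambda>t. l (snd (0::real, t))) (\<lambda>t. M (0, t))"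
    by (rule primitive_compose[OF M]) (auto intro!: continuous_intros)
  then show ?thesis using that by simp
qed

lemma primitive_homotopy:
  assumes C: "lagrangian \<omega> C" and ab: "a \<le> b" and hom: "lag_homotopic \<omega> a b l l'"
    and M: "primitive C {a..b} l M" and M': "primitive C {a..b} l' M'"
  shows "M' b - M' a = M b - M a"
proof -
  obtain H where H: "\<And>p. p \<in> {0..1::real} \<times> {a..b} \<Longrightarrow> lagrangian \<omega> (H p)"
      "subspace_continuous_on ({0..1} \<times> {a..b}) H"
    and sides: "\<And>t. t \<in> {a..b} \<Longrightarrow> H (0, t) = l t" "\<And>t. t \<in> {a..b} \<Longrightarrow> H (1, t) = l' t"
    and ends: "\<And>s. s \<in> {0..1} \<Longrightarrow> H (s, a) = l a" "\<And>s. s \<in> {0..1} \<Longrightarrow> H (s, b) = l b"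
    using hom unfolding lag_homotopic_def by (elim exE conjE) (metis SigmaI)
  obtain F where F: "primitive C ({0..1} \<times> {a..b}) H F"
    using primitive_rectangle[OF C zero_le_one ab H] by blast
  have slice: "primitive C {a..b} (\<lambda>t. H (s, t)) (\<lambda>t. F (s, t))" if "s \<in> {0..1}" for s
    by (rule primitive_compose[OF F]) (use that in \<open>auto intro!: continuous_intros\<close>)
  have constant_end: "F (1, t) = F (0, t)" if t: "t \<in> {a..b}" "\<And>s. s \<in> {0..1} \<Longrightarrow> H (s, t) = L" for t L
  proof -
    have F_t: "primitive C {0..1} (\<lambda>s. H (s, t)) (\<lambda>s. F (s, t))"
      by (rule primitive_compose[OF F]) (use t in \<open>auto intro!: continuous_intros\<close>)
    have "primitive C {0..1::real} (\<lambda>s. L) (\<lambda>s. 0)" by (simp add: primitive_def)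
    then have zero: "primitive C {0..1} (\<lambda>s. H (s, t)) (\<lambda>s. 0)"
      by (rule primitive_cong[where k = 0]) (simp_all add: t(2))
    have "F (1, t) - 0 = F (0, t) - 0"
      by (rule primitive_diff_constant[OF F_t zero]) (use t(1) H(1) in auto)
    then show ?thesis by simp
  qed
  have side: "F (s, b) - N b = F (s, a) - N a"
    if "s \<in> {0..1}" "primitive C {a..b} k N" "\<And>t. t \<in> {a..b} \<Longrightarrow> H (s, t) = k t" for s k N
  proof (rule primitive_diff_constant[of C "{a..b}" k "\<lambda>t. F (s, t)"])
    show "primitive C {a..b} k (\<lambda>t. F (s, t))"
      by (rule primitive_cong[OF slice, where k = 0]) (use that in auto)
    show "lagrangian \<omega> (k t)" if t: "t \<in> {a..b}" for t
      using H(1)[of "(s, t)"] \<open>s \<in> {0..1}\<close> that(1) \<open>\<And>t. t \<in> {a..b} \<Longrightarrow> H (s, t) = k t\<close>[OF t] t by simp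
  qed (use that ab in auto)
  have "F (0, b) - M b = F (0, a) - M a" by (rule side[OF _ M]) (use sides in auto)
  moreover have "F (1, b) - M' b = F (1, a) - M' a" by (rule side[OF _ M']) (use sides in auto)
  moreover have "F (1, a) = F (0, a)" by (rule constant_end) (use ab ends in auto)
  moreover have "F (1, b) = F (0, b)" by (rule constant_end) (use ab ends in auto)
  ultimately show ?thesis by simp
qed

end

subsection \<open>Continuously differentiable paths of Lagrangians\<close>

lemma linear_blinfun: "linear (blinfun_apply A)"
  by (simp add: blinfun.bounded_linear_right bounded_linear.linear)

lemma C1_on_interval_continuous: "C1_on_interval a b f \<Longrightarrow> continuous_on {a..b} f"
  unfolding C1_on_interval_def
  by (meson continuous_on_eq_continuous_within has_vector_derivative_continuous)

lemma C1_on_interval_bounded_linear: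
  assumes "bounded_linear h" "C1_on_interval a b f"
  shows "C1_on_interval a b (\<lambda>t. h (f t))"
proof -
  obtain f' where "\<forall>t\<in>{a..b}. (f has_vector_derivative f' t) (at t within {a..b})" "continuous_on {a..b} f'"
    using assms(2) unfolding C1_on_interval_def by blast
  then show ?thesis
    unfolding C1_on_interval_def
    by (intro exI[of _ "\<lambda>t. h (f' t)"])
      (auto intro: bounded_linear.has_vector_derivative[OF assms(1)]
          bounded_linear.continuous_on[OF assms(1)])
qed

lemma C1_on_interval_sum:
  assumes "\<And>i. i \<in> I \<Longrightarrow> C1_on_interval a b (f i)"
  shows "C1_on_interval a b (\<lambda>t. \<Sum>i\<in>I. f i t)"
proof -
  obtain f' where "\<And>i t. i \<in> I \<Longrightarrow> t \<in> {a..b} \<Longrightarrow> (f i has_vector_derivative f' i t) (at t within {a..b})"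
    "\<And>i. i \<in> I \<Longrightarrow> continuous_on {a..b} (f' i)"
    using assms unfolding C1_on_interval_def by metis
  then show ?thesis unfolding C1_on_interval_def
    by (intro exI[of _ "\<lambda>t. \<Sum>i\<in>I. f' i t"]) (auto intro!: has_vector_derivative_sum continuous_on_sum)
qed

lemma subspace_dist_image_le:
  fixes A B :: "'a::euclidean_space \<Rightarrow> 'b::euclidean_space"
  assumes L: "subspace L" and lin: "linear A" "linear B" and c: "c > 0" and e: "e \<ge> 0"
    and below: "\<And>x. x \<in> L \<Longrightarrow> c * norm x \<le> norm (A x)" "\<And>x. x \<in> L \<Longrightarrow> c * norm x \<le> norm (B x)"
    and close: "\<And>x. x \<in> L \<Longrightarrow> norm (A x - B x) \<le> e * norm x"
  shows "subspace_dist (A ` L) (B ` L) \<le> e / c"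
proof -
  have "(SUP x\<in>P ` L \<inter> cball 0 1. infdist x (Q ` L)) \<le> e / c"
    if P: "linear P" "\<And>x. x \<in> L \<Longrightarrow> c * norm x \<le> norm (P x)"
      and PQ: "\<And>x. x \<in> L \<Longrightarrow> norm (P x - Q x) \<le> e * norm x" for P Q
  proof (rule cSUP_least)
    have "P 0 \<in> P ` L \<inter> cball 0 1" using subspace_0[OF L] linear_0[OF P(1)] by auto
    then show "P ` L \<inter> cball 0 1 \<noteq> {}" by blast
    fix y assume "y \<in> P ` L \<inter> cball 0 1"
    then obtain x where x: "x \<in> L" "y = P x" "norm (P x) \<le> 1" by auto
    then have "norm x \<le> 1 / c" using P(2)[OF x(1)] c by (simp add: pos_le_divide_eq mult.commute)
    have "infdist y (Q ` L) \<le> dist y (Q x)" using x by (intro infdist_le) auto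
    also have "\<dots> \<le> e * norm x" using PQ[OF x(1)] x(2) by (simp add: dist_norm)
    also have "\<dots> \<le> e * (1 / c)" using \<open>norm x \<le> 1 / c\<close> e by (rule mult_left_mono)
    finally show "infdist y (Q ` L) \<le> e / c" by simp
  qed
  from this[OF lin(1) below(1) close] this[OF lin(2) below(2)] close show ?thesis
    unfolding subspace_dist_def by (simp add: norm_minus_commute)
qed

lemma subspace_continuous_on_image:
  fixes A :: "'a::metric_space \<Rightarrow> ('b::euclidean_space \<Rightarrow>\<^sub>L 'v::euclidean_space)"
  assumes A: "continuous_on D A" and inj: "\<And>p. p \<in> D \<Longrightarrow> inj_on (A p) L" and L: "subspace L"
  shows "subspace_continuous_on D (\<lambda>p. A p ` L)"
  unfolding subspace_continuous_on_def
proof (intro ballI allI impI)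
  fix p and e :: real assume p: "p \<in> D" and e: "e > 0"
  have "\<forall>x\<in>L. A p x = 0 \<longrightarrow> x = 0"
    using inj[OF p] linear_inj_on_iff_eq_0[OF linear_blinfun L] by auto
  then obtain c where c_pos: "c > 0" and lower_bound: "\<And>x. x \<in> L \<Longrightarrow> c * norm x \<le> norm (A p x)"
    using injective_imp_isometric[OF closed_subspace[OF L] L blinfun.bounded_linear_right] by blast
  define r where "r = min (c / 2) (c * e / 4)"
  have r: "r > 0" "r \<le> c / 2" "r / (c / 2) < e" using c_pos e by (auto simp: r_def field_simps min_def)
  obtain d where d_pos: "d > 0" and near: "\<And>q. q \<in> D \<Longrightarrow> dist q p < d \<Longrightarrow> dist (A q) (A p) < r"
    using A p r(1) unfolding continuous_on_iff by metis
  have "subspace_dist (A q ` L) (A p ` L) < e" if q: "q \<in> D" "dist q p < d" for q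
  proof -
    have close: "norm (A q x - A p x) \<le> r * norm x" for x
      using norm_blinfun[of "A q - A p" x] near[OF q] mult_right_mono[of "norm (A q - A p)" r "norm x"]
      by (simp add: blinfun.diff_left dist_norm)
    have "subspace_dist (A q ` L) (A p ` L) \<le> r / (c / 2)"
    proof (rule subspace_dist_image_le[OF L linear_blinfun linear_blinfun])
      fix x assume x: "x \<in> L"
      have "c / 2 * norm x \<le> norm (A p x) - r * norm x"
        using lower_bound[OF x] mult_right_mono[OF r(2) norm_ge_zero[of x]] by (simp add: field_simps)
      then show "c / 2 * norm x \<le> norm (A q x)" "c / 2 * norm x \<le> norm (A p x)"
        using close[of x] norm_triangle_ineq3[of "A q x" "A p x"] r(1) mult_nonneg_nonneg[of r "norm x"]
        by linarith+
    qed (use c_pos r(1) close in auto)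
    then show ?thesis using r(3) by linarith
  qed
  then show "\<exists>d>0. \<forall>q\<in>D. dist q p < d \<longrightarrow> subspace_dist (A q ` L) (A p ` L) < e" using d_pos by blast
qed

lemma has_vector_derivative_tendsto_quotient:
  assumes "(f has_vector_derivative D) (at t within S)"
  shows "((\<lambda>s. (f s - f t) /\<^sub>R (s - t)) \<longlongrightarrow> D) (at t within S)"
proof -
  have "((\<lambda>s. norm (f s - f t - (s - t) *\<^sub>R D) / norm (s - t)) \<longlongrightarrow> 0) (at t within S)"
    using assms by (simp add: has_vector_derivative_def has_derivative_iff_norm)
  moreover have "\<forall>\<^sub>F s in at t within S.
      norm (f s - f t - (s - t) *\<^sub>R D) / norm (s - t) = norm ((f s - f t) /\<^sub>R (s - t) - D)"
    unfolding eventually_at_filter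
  proof (intro always_eventually allI impI)
    fix s assume "s \<noteq> t"
    then have "(f s - f t) /\<^sub>R (s - t) - D = (f s - f t - (s - t) *\<^sub>R D) /\<^sub>R (s - t)"
      by (simp add: scaleR_diff_right)
    then show "norm (f s - f t - (s - t) *\<^sub>R D) / norm (s - t) = norm ((f s - f t) /\<^sub>R (s - t) - D)"
      by (simp add: divide_inverse mult.commute)
  qed
  ultimately have "((\<lambda>s. norm ((f s - f t) /\<^sub>R (s - t) - D)) \<longlongrightarrow> 0) (at t within S)"
    by (rule Lim_transform_eventually)
  then show ?thesis using tendsto_norm_zero_iff LIM_zero_iff by blast
qed

lemma has_real_derivative_unique_within:
  fixes f :: "real \<Rightarrow> real"
  assumes "at t within S \<noteq> bot" "(f has_real_derivative D) (at t within S)"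
      "(f has_real_derivative E) (at t within S)"
  shows "D = E"
  using assms vector_derivative_unique_within by (simp add: has_real_derivative_iff_has_vector_derivative)

lemma at_within_Icc_neq_bot: "a < b \<Longrightarrow> t \<in> {a..b} \<Longrightarrow> at t within {a..b::real} \<noteq> bot"
  by (simp add: trivial_limit_within islimpt_Icc)

lemma C1_frame_operator:
  fixes F :: "real \<Rightarrow> nat \<Rightarrow> 'a::euclidean_space"
  assumes n: "n \<le> DIM('a)" and F: "\<And>i. C1_on_interval a b (\<lambda>t. F t i)"
  obtains A :: "real \<Rightarrow> ('a \<Rightarrow>\<^sub>L 'a)" and L where "C1_on_interval a b A" "subspace L" "dim L = n"
    "\<And>t. A t ` L = span (F t ` {..<n})"
proof -
  obtain e :: "nat \<Rightarrow> 'a" where e: "bij_betw e {0..<DIM('a)} Basis"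
    using ex_bij_betw_nat_finite[OF finite_Basis] by blast
  have e_Basis: "e ` {..<n} \<subseteq> Basis" and e_inj: "inj_on e {..<n}"
    using e n by (auto simp: bij_betw_def intro: inj_on_subset)
  define A where "A t = (\<Sum>i<n. blinfun_scaleR_left (F t i) o\<^sub>L blinfun_inner_left (e i))" for t
  have A_e: "A t (e j) = F t j" if j: "j \<in> {..<n}" for t j
  proof -
    have "e j \<bullet> e i = (if i = j then 1 else 0)" if "i \<in> {..<n}" for i
      using e_Basis j that inner_Basis[of "e j" "e i"] inj_on_eq_iff[OF e_inj j that]
      by (auto simp: image_subset_iff)
    then have "A t (e j) = (\<Sum>i<n. (if i = j then 1 else 0) *\<^sub>R F t i)"
      by (simp add: A_def blinfun.sum_left)
    also have "\<dots> = (\<Sum>i<n. if i = j then F t i else 0)" by (intro sum.cong) auto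
    finally show ?thesis using j by simp
  qed
  have "independent (e ` {..<n})" using e_Basis independent_Basis independent_mono by blast
  then have dim: "dim (span (e ` {..<n})) = n"
    by (simp add: dim_eq_card_independent card_image[OF e_inj])
  have A_image: "A t ` span (e ` {..<n}) = span (F t ` {..<n})" for t
  proof -
    have "A t ` span (e ` {..<n}) = span (A t ` e ` {..<n})"
      by (rule linear_span_image[OF linear_blinfun, symmetric])
    also have "A t ` e ` {..<n} = F t ` {..<n}" unfolding image_image by (intro image_cong refl A_e)
    finally show ?thesis .
  qed
  have "C1_on_interval a b A"
    unfolding A_def
    by (intro C1_on_interval_sum C1_on_interval_bounded_linear[OF _ F]
        bounded_linear_compose[OF bounded_bilinear.bounded_linear_left[OF bounded_bilinear_blinfun_compose]
          bounded_linear_blinfun_scaleR_left])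
  then show ?thesis by (rule that[OF _ subspace_span dim A_image])
qed

context symplectic
begin

lemma lag_C1_lagrangian: "lag_C1 \<omega> l a b \<Longrightarrow> t \<in> {a..b} \<Longrightarrow> lagrangian \<omega> (l t)"
  unfolding lag_C1_def by blast

lemma lag_C1_frame:
  assumes l: "lag_C1 \<omega> l a b"
  obtains A :: "real \<Rightarrow> ('v \<Rightarrow>\<^sub>L 'v)" and L where "C1_on_interval a b A" "subspace L"
    "\<And>t. t \<in> {a..b} \<Longrightarrow> inj_on (A t) L" "\<And>t. t \<in> {a..b} \<Longrightarrow> l t = A t ` L"
proof -
  obtain F where F: "\<And>t. t \<in> {a..b} \<Longrightarrow> l t = span (F t ` {..<DIM('v) div 2})"
      "\<And>i. C1_on_interval a b (\<lambda>t. F t i)"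
    using l unfolding lag_C1_def by blast
  obtain A :: "real \<Rightarrow> ('v \<Rightarrow>\<^sub>L 'v)" and L where A: "C1_on_interval a b A"
    and L: "subspace L" "dim L = DIM('v) div 2" and A_L: "\<And>t. A t ` L = span (F t ` {..<DIM('v) div 2})"
    by (rule C1_frame_operator[where F = F, OF div_le_dividend F(2)]) (rule that; assumption)
  have "inj_on (A t) L" if t: "t \<in> {a..b}" for t
  proof -
    have "dim (A t ` L) = dim L"
      using lagrangian_dim[OF lag_C1_lagrangian[OF l t]] by (simp add: A_L F(1)[OF t] L(2))
    then have "dim {x\<in>L. A t x = 0} = 0" using dim_kernel_image[OF linear_blinfun L(1), of "A t"]
      by linarith
    then show ?thesis by (auto simp: linear_inj_on_iff_eq_0[OF linear_blinfun L(1)])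
  qed
  then show ?thesis using that[OF A L(1)] F(1) A_L by auto
qed

lemma lag_C1_continuous: "lag_C1 \<omega> l a b \<Longrightarrow> subspace_continuous_on {a..b} l"
proof -
  assume l: "lag_C1 \<omega> l a b"
  obtain A :: "real \<Rightarrow> ('v \<Rightarrow>\<^sub>L 'v)" and L where A: "C1_on_interval a b A" "subspace L"
    "\<And>t. t \<in> {a..b} \<Longrightarrow> inj_on (A t) L" "\<And>t. t \<in> {a..b} \<Longrightarrow> l t = A t ` L"
    using lag_C1_frame[OF l] by blast
  have "subspace_continuous_on {a..b} (\<lambda>t. A t ` L)"
    by (rule subspace_continuous_on_image[OF C1_on_interval_continuous[OF A(1)] A(3,2)])
  then show ?thesis unfolding subspace_continuous_on_def using A(4) by simp
qed

lemma lag_C1_lag_tendsto: "lag_C1 \<omega> l a b \<Longrightarrow> t0 \<in> {a..b} \<Longrightarrow> lag_tendsto l (l t0) (at t0 within {a..b})"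
  by (intro subspace_continuous_on_lag_tendsto lag_C1_continuous lag_C1_lagrangian)

subsection \<open>Crossing forms as derivatives of chart forms\<close>

lemma chart_form_increment:
  assumes W: "transversal W L0" "transversal W L" and u: "u \<in> L"
  shows "chart_form W L x v - chart_form W L0 x v = \<omega> (proj W L x) (u - proj W L0 v)"
proof -
  let ?u0 = "proj W L0 v"
  have "proj W L (v - ?u0) = 0" by (intro proj_zero[OF W(2)] proj_diff_in[OF W(1)])
  then have "proj W L v = proj W L ?u0" by (simp add: proj_diff[OF W(2)])
  then have "chart_form W L x v - chart_form W L0 x v = \<omega> x (u - ?u0) - chart_form W L x (u - ?u0)"
    by (simp add: chart_form_def proj_diff[OF W(2)] proj_id[OF W(2) u] omega_simps)
  also have "\<dots> = - chart_form W L (u - ?u0) x" using chart_form_diff_swap[OF W(2), of x "u - ?u0"] by simp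
  also have "\<dots> = \<omega> (proj W L x) (u - ?u0)"
    unfolding chart_form_def using omega_skew[of "u - ?u0" "proj W L x"] by simp
  finally show ?thesis .
qed

lemma chart_form_has_derivative:
  assumes W: "transversal W (l t0)" and l: "lag_tendsto l (l t0) (at t0 within S)"
    and u: "\<And>t. t \<in> S \<Longrightarrow> u t \<in> l t" "u t0 = proj W (l t0) v" "(u has_vector_derivative u') (at t0 within S)"
  shows "((\<lambda>t. chart_form W (l t) x v) has_real_derivative \<omega> (proj W (l t0) x) u') (at t0 within S)"
  unfolding has_field_derivative_iff
proof (rule Lim_transform_eventually)
  show "((\<lambda>t. \<omega> (proj W (l t) x) ((u t - u t0) /\<^sub>R (t - t0))) \<longlongrightarrow> \<omega> (proj W (l t0) x) u') (at t0 within S)"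
    by (intro bounded_bilinear.tendsto[OF bounded_bilinear_omega] tendsto_proj[OF W l]
        has_vector_derivative_tendsto_quotient u(3))
  have "\<forall>\<^sub>F t in at t0 within S. t \<in> S" by (auto simp: eventually_at_filter)
  with lag_tendsto_transversal[OF W l]
  show "\<forall>\<^sub>F t in at t0 within S. \<omega> (proj W (l t) x) ((u t - u t0) /\<^sub>R (t - t0)) =
      (chart_form W (l t) x v - chart_form W (l t0) x v) / (t - t0)"
    by eventually_elim (simp add: chart_form_increment[OF W _ u(1)] u(2) omega_simps divide_inverse
        mult.commute)
qed

lemma crossing_form_eq:
  assumes ab: "a < b" and l: "lag_C1 \<omega> l a b" and t0: "t0 \<in> {a..b}"
    and u: "\<And>t. t \<in> {a..b} \<Longrightarrow> u t \<in> l t" "(u has_vector_derivative u') (at t0 within {a..b})"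
  shows "crossing_form \<omega> l C a b t0 (u t0) = \<omega> (u t0) u'"
proof -
  let ?F = "at t0 within {a..b}" and ?v = "u t0"
  have v: "?v \<in> l t0" by (rule u(1)[OF t0])
  have lim: "lag_tendsto l (l t0) ?F" by (rule lag_C1_lag_tendsto[OF l t0])
  define W where "W = (SOME W. lagrangian \<omega> W \<and> W \<inter> l t0 = {0})"
  have "\<exists>W. lagrangian \<omega> W \<and> W \<inter> l t0 = {0}"
    using transversal_exists[OF lag_C1_lagrangian[OF l t0]] unfolding transversal_def by metis
  then have "lagrangian \<omega> W \<and> W \<inter> l t0 = {0}" unfolding W_def by (rule someI_ex)
  then have W: "transversal W (l t0)" using lag_C1_lagrangian[OF l t0] by (simp add: transversal_def)
  define w where "w t = (THE w. w \<in> W \<and> ?v + w \<in> l t)" for t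
  have w: "\<omega> ?v (w t) = chart_form W (l t) ?v ?v" if tr: "transversal W (l t)" for t
  proof -
    have "w t = proj W (l t) ?v - ?v"
      unfolding w_def
    proof (rule the_equality)
      show "proj W (l t) ?v - ?v \<in> W \<and> ?v + (proj W (l t) ?v - ?v) \<in> l t"
        using subspace_neg[OF transversal_subspace(1)[OF tr] proj_diff_in[OF tr, of ?v]] proj_in[OF tr]
        by simp
      fix z assume z: "z \<in> W \<and> ?v + z \<in> l t"
      then have "?v - (?v + z) \<in> W" using subspace_neg[OF transversal_subspace(1)[OF tr]] by simp
      then have "proj W (l t) ?v = ?v + z" using z by (intro proj_unique[OF tr]) auto
      then show "z = proj W (l t) ?v - ?v" by simp
    qed
    then show ?thesis by (simp add: chart_form_def omega_simps)
  qed
  have "((\<lambda>t. chart_form W (l t) ?v ?v) has_real_derivative \<omega> ?v u') ?F"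
    using chart_form_has_derivative[OF W lim u(1) _ u(2), of ?v ?v] by (simp add: proj_id[OF W v])
  moreover have "\<forall>\<^sub>F t in nhds t0. t \<in> {a..b} \<longrightarrow> chart_form W (l t) ?v ?v = \<omega> ?v (w t)"
    using lag_tendsto_transversal[OF W lim] W w unfolding eventually_at_filter
    by (auto elim!: eventually_mono)
  ultimately have deriv: "((\<lambda>t. \<omega> ?v (w t)) has_real_derivative \<omega> ?v u') ?F"
    using has_vector_derivative_cong_ev[of "{a..b}" "\<lambda>t. chart_form W (l t) ?v ?v" "\<lambda>t. \<omega> ?v (w t)" t0]
      w[OF W] by (simp add: has_real_derivative_iff_has_vector_derivative)
  then have "(THE D. ((\<lambda>t. \<omega> ?v (w t)) has_real_derivative D) ?F) = \<omega> ?v u'"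
    using has_real_derivative_unique_within[OF at_within_Icc_neq_bot[OF ab t0]] by blast
  then show ?thesis unfolding crossing_form_def Let_def W_def[symmetric] w_def[symmetric] .
qed

lemma lag_C1_curves:
  assumes l: "lag_C1 \<omega> l a b" and t0: "t0 \<in> {a..b}"
  obtains \<gamma> :: "'v \<Rightarrow> real \<Rightarrow> 'v" and D where "linear D" "\<And>y t. t \<in> {a..b} \<Longrightarrow> \<gamma> y t \<in> l t"
    "\<And>y. y \<in> l t0 \<Longrightarrow> \<gamma> y t0 = y" "\<And>y. (\<gamma> y has_vector_derivative D y) (at t0 within {a..b})"
proof -
  obtain A :: "real \<Rightarrow> ('v \<Rightarrow>\<^sub>L 'v)" and L where A: "C1_on_interval a b A" "subspace L"
    "\<And>t. t \<in> {a..b} \<Longrightarrow> inj_on (A t) L" "\<And>t. t \<in> {a..b} \<Longrightarrow> l t = A t ` L"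
    using lag_C1_frame[OF l] by blast
  obtain A' where A': "(A has_vector_derivative A') (at t0 within {a..b})"
    using A(1) t0 unfolding C1_on_interval_def by blast
  obtain g where g: "range g \<subseteq> L" "linear g" "\<And>y. y \<in> A t0 ` L \<Longrightarrow> A t0 (g y) = y"
    using linear_exists_right_inverse_on[OF linear_blinfun[of "A t0"] A(2)] by blast
  show ?thesis
  proof (rule that)
    show "linear (\<lambda>y. A' (g y))" using linear_compose[OF g(2) linear_blinfun[of A']] by (simp add: o_def)
    show "A t (g y) \<in> l t" if "t \<in> {a..b}" for y t
      using A(4)[OF that] g(1) by (simp add: image_subset_iff)
    show "A t0 (g y) = y" if "y \<in> l t0" for y using g(3) A(4)[OF t0] that by simp
    show "((\<lambda>t. A t (g y)) has_vector_derivative A' (g y)) (at t0 within {a..b})" for y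
      by (rule bounded_linear.has_vector_derivative[OF blinfun.bounded_linear_left A'])
  qed
qed

lemma chart_form_derivative_exists:
  assumes ab: "a < b" and l: "lag_C1 \<omega> l a b" and t0: "t0 \<in> {a..b}" and W: "transversal W (l t0)"
  obtains B where "bilinear B" "symmetric_form_on B (l t0)"
    "\<And>x y. ((\<lambda>t. chart_form W (l t) x y) has_real_derivative B x y) (at t0 within {a..b})"
    "\<And>C v. v \<in> l t0 \<Longrightarrow> crossing_form \<omega> l C a b t0 v = B v v"
proof -
  obtain \<gamma> :: "'v \<Rightarrow> real \<Rightarrow> 'v" and D where D: "linear D"
    and curve: "\<And>y t. t \<in> {a..b} \<Longrightarrow> \<gamma> y t \<in> l t" and start: "\<And>y. y \<in> l t0 \<Longrightarrow> \<gamma> y t0 = y"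
    and velocity: "\<And>y. (\<gamma> y has_vector_derivative D y) (at t0 within {a..b})"
    by (rule lag_C1_curves[OF l t0]) (rule that; assumption)
  define B where "B x y = \<omega> (proj W (l t0) x) (D (proj W (l t0) y))" for x y
  show ?thesis
  proof (rule that)
    show bil: "bilinear B"
      unfolding B_def
      using bilinear_compose[OF bilinear_omega linear_proj[OF W] linear_compose[OF linear_proj[OF W] D]]
      by (simp add: o_def)
    have "B x y = B y x" if xy: "x \<in> l t0" "y \<in> l t0" for x y
    proof -
      have "((\<lambda>t. \<omega> (\<gamma> x t) (\<gamma> y t)) has_vector_derivative
          \<omega> (\<gamma> x t0) (D y) + \<omega> (D x) (\<gamma> y t0)) (at t0 within {a..b})"
        by (intro bounded_bilinear.has_vector_derivative[OF bounded_bilinear_omega] velocity)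
      moreover have "((\<lambda>t. \<omega> (\<gamma> x t) (\<gamma> y t)) has_vector_derivative 0) (at t0 within {a..b})"
        by (rule has_vector_derivative_transform[OF t0 _ has_vector_derivative_const[of 0]])
          (rule lagrangian_isotropic[OF lag_C1_lagrangian[OF l] curve curve])
      ultimately have "\<omega> (\<gamma> x t0) (D y) + \<omega> (D x) (\<gamma> y t0) = 0"
        by (rule vector_derivative_unique_within[OF at_within_Icc_neq_bot[OF ab t0]])
      then show ?thesis
        using xy omega_skew[of "D x" y] by (simp add: B_def start proj_id[OF W])
    qed
    then show "symmetric_form_on B (l t0)"
      using bil transversal_subspace(2)[OF W] by (simp add: symmetric_form_on_def)
    show "((\<lambda>t. chart_form W (l t) x y) has_real_derivative B x y) (at t0 within {a..b})" for x y
      unfolding B_def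
      by (rule chart_form_has_derivative[OF W lag_C1_lag_tendsto[OF l t0] curve start[OF proj_in[OF W]]
            velocity])
    show "crossing_form \<omega> l C a b t0 v = B v v" if v: "v \<in> l t0" for C v
      using crossing_form_eq[where C = C, OF ab l t0 curve[of _ v] velocity[of v]]
      by (simp add: B_def start[OF v] proj_id[OF W v])
  qed
qed

lemma crossing_form_definite_nondegenerate:
  assumes ab: "a < b" and l: "lag_C1 \<omega> l a b" and t0: "t0 \<in> {a..b}" and C: "lagrangian \<omega> C"
    and definite: "\<And>v. v \<in> l t0 \<inter> C \<Longrightarrow> v \<noteq> 0 \<Longrightarrow> crossing_form \<omega> l C a b t0 v \<noteq> 0"
  shows "qf_nondegenerate (crossing_form \<omega> l C a b t0) (l t0 \<inter> C)"
proof -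
  obtain W where W: "transversal W (l t0)" using transversal_exists[OF lag_C1_lagrangian[OF l t0]] .
  obtain B where B: "symmetric_form_on B (l t0)" "\<And>v. v \<in> l t0 \<Longrightarrow> crossing_form \<omega> l C a b t0 v = B v v"
    using chart_form_derivative_exists[OF ab l t0 W] by metis
  have K: "subspace (l t0 \<inter> C)"
    by (intro subspace_inter transversal_subspace(2)[OF W] lagrangian_subspace C)
  have "form_radical B (l t0 \<inter> C) \<subseteq> {0}" using definite B(2) by (force simp: annihilator_def)
  then have "qf_nondegenerate (\<lambda>v. B v v) (l t0 \<inter> C)"
    using qf_nondegenerate_form_iff[OF symmetric_form_on_subset[OF B(1) K]] by simp
  then show ?thesis using qf_nondegenerate_cong[OF K, of "crossing_form \<omega> l C a b t0" "\<lambda>v. B v v"] B(2)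
    by simp
qed

lemma chart_index_jump_along:
  assumes C: "lagrangian \<omega> C" and W: "transversal W L0" and H: "lag_tendsto H L0 F"
    and B: "symmetric_form_on B (L0 \<inter> C)" "form_radical B (L0 \<inter> C) \<subseteq> {0}"
    and step: "\<forall>\<^sub>F t in F. h t > 0" "(h \<longlongrightarrow> 0) F"
    and deriv: "\<And>x y. ((\<lambda>t. (chart_form W (H t) x y - chart_form W L0 x y) / h t) \<longlongrightarrow> B x y) F"
  shows "\<forall>\<^sub>F t in F. H t \<inter> C = {0} \<and> chart_index C W (H t) = chart_index C W L0 + form_index B (L0 \<inter> C)"
proof -
  have "\<forall>\<^sub>F t in F. symmetric_form_on (chart_form W (H t)) C \<and>
      dim (C \<inter> W) \<le> dim (form_radical (chart_form W (H t)) C)"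
    using lag_tendsto_transversal[OF W H]
    by eventually_elim (simp add: symmetric_form_on_chart_form C dim_form_radical_chart_form)
  moreover have "L0 \<inter> C \<subseteq> form_radical (chart_form W L0) C"
  proof
    fix x assume "x \<in> L0 \<inter> C"
    moreover have "0 \<in> C \<inter> W" using lagrangian_subspace[OF C] transversal_subspace(1)[OF W]
      by (simp add: subspace_0)
    ultimately show "x \<in> form_radical (chart_form W L0) C"
      unfolding form_radical_chart_form[OF W C] by force
  qed
  moreover have "dim (form_radical (chart_form W L0) C) = dim (L0 \<inter> C) + dim (C \<inter> W)"
    using dim_form_radical_chart_form[OF W C] by (simp add: Int_commute)
  ultimately have "\<forall>\<^sub>F t in F. form_index (chart_form W (H t)) C =
      form_index (chart_form W L0) C + form_index B (L0 \<inter> C) \<and>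
      dim (form_radical (chart_form W (H t)) C) = dim (C \<inter> W)"
    using form_index_jump[OF symmetric_form_on_chart_form[OF W C] B(1) _ _ _ B(2) step deriv] by blast
  with lag_tendsto_transversal[OF W H] show ?thesis
  proof eventually_elim
    case (elim t)
    then have "dim (C \<inter> H t) = 0" using dim_form_radical_chart_form[OF elim(1) C] by simp
    then have "C \<inter> H t \<subseteq> {0}" by simp
    then have "H t \<inter> C = {0}"
      using subspace_0 lagrangian_subspace[OF C] transversal_subspace(2)[OF elim(1)] by blast
    then show ?case using elim(2) by (simp add: chart_index_def)
  qed
qed

lemma chart_index_jump_side:
  assumes l: "lag_C1 \<omega> l a b" and t0: "t0 \<in> {a..b}" and C: "lagrangian \<omega> C" and W: "transversal W (l t0)"
    and B: "symmetric_form_on B (l t0 \<inter> C)" "form_radical B (l t0 \<inter> C) \<subseteq> {0}"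
    and deriv: "\<And>x y. ((\<lambda>t. chart_form W (l t) x y) has_real_derivative B x y) (at t0 within {a..b})"
    and S: "S \<subseteq> {a..b}" and \<sigma>: "\<sigma> = 1 \<or> \<sigma> = -1" "\<And>t. t \<in> S \<Longrightarrow> \<sigma> * (t - t0) > 0"
  shows "\<forall>\<^sub>F t in at t0 within S. l t \<inter> C = {0} \<and>
    chart_index C W (l t) = chart_index C W (l t0) + form_index (\<lambda>x y. \<sigma> * B x y) (l t0 \<inter> C)"
proof (rule chart_index_jump_along[OF C W, where B = "\<lambda>x y. \<sigma> * B x y" and h = "\<lambda>t. \<sigma> * (t - t0)"])
  show "lag_tendsto l (l t0) (at t0 within S)"
    using lag_C1_lag_tendsto[OF l t0] filter_leD[OF at_le[OF S]] unfolding lag_tendsto_def by blast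
  show "symmetric_form_on (\<lambda>x y. \<sigma> * B x y) (l t0 \<inter> C)"
    using \<sigma>(1) B(1) symmetric_form_on_uminus[OF B(1)] by auto
  show "form_radical (\<lambda>x y. \<sigma> * B x y) (l t0 \<inter> C) \<subseteq> {0}"
    using \<sigma>(1) B(2) by (auto simp: annihilator_def)
  show "\<forall>\<^sub>F t in at t0 within S. \<sigma> * (t - t0) > 0"
    using \<sigma>(2) by (auto simp: eventually_at_filter intro: always_eventually)
  show "((\<lambda>t. \<sigma> * (t - t0)) \<longlongrightarrow> 0) (at t0 within S)" by (auto intro!: tendsto_eq_intros)
  fix x y
  have "((\<lambda>t. \<sigma> * ((chart_form W (l t) x y - chart_form W (l t0) x y) / (t - t0))) \<longlongrightarrow> \<sigma> * B x y) (at t0 within S)"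
    using has_field_derivative_subset[OF deriv S]
    by (intro tendsto_mult tendsto_const) (simp add: has_field_derivative_iff)
  moreover have "\<sigma> * (z / (t - t0)) = z / (\<sigma> * (t - t0))" for z t
    using \<sigma>(1) minus_divide_right[of z "t - t0"] by auto
  ultimately show "((\<lambda>t. (chart_form W (l t) x y - chart_form W (l t0) x y) / (\<sigma> * (t - t0))) \<longlongrightarrow> \<sigma> * B x y)
      (at t0 within S)" by simp
qed

lemma eventually_at_within_sides:
  fixes t0 :: real
  assumes "\<forall>\<^sub>F t in at t0 within (S \<inter> {t0<..}). t0 < t \<longrightarrow> P t"
    and "\<forall>\<^sub>F t in at t0 within (S \<inter> {..<t0}). t < t0 \<longrightarrow> P t"
  shows "\<forall>\<^sub>F t in at t0 within S. P t"
  using assms unfolding eventually_at_filter by eventually_elim auto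

theorem chart_index_jump:
  assumes ab: "a < b" and l: "lag_C1 \<omega> l a b" and t0: "t0 \<in> {a..b}"
    and C: "lagrangian \<omega> C" and W: "transversal W (l t0)"
    and nondegenerate: "qf_nondegenerate (crossing_form \<omega> l C a b t0) (l t0 \<inter> C)"
  shows "\<forall>\<^sub>F t in at t0 within {a..b}. l t \<inter> C = {0} \<and>
    chart_index C W (l t) = chart_index C W (l t0) +
      (if t0 < t then pos_index (crossing_form \<omega> l C a b t0) (l t0 \<inter> C)
       else neg_index (crossing_form \<omega> l C a b t0) (l t0 \<inter> C))"
proof -
  let ?K = "l t0 \<inter> C" and ?q = "crossing_form \<omega> l C a b t0"
  obtain B where B: "symmetric_form_on B (l t0)"
    "\<And>x y. ((\<lambda>t. chart_form W (l t) x y) has_real_derivative B x y) (at t0 within {a..b})"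
    and q: "\<And>v. v \<in> l t0 \<Longrightarrow> ?q v = B v v"
    using chart_form_derivative_exists[OF ab l t0 W] by metis
  have sub_K: "subspace ?K" by (intro subspace_inter transversal_subspace(2)[OF W] lagrangian_subspace C)
  have sym: "symmetric_form_on B ?K" by (rule symmetric_form_on_subset[OF B(1) sub_K]) auto
  have "qf_nondegenerate (\<lambda>v. B v v) ?K"
    using nondegenerate qf_nondegenerate_cong[OF sub_K, of ?q "\<lambda>v. B v v"] q by simp
  then have "form_radical B ?K \<subseteq> {0}" using qf_nondegenerate_form_iff[OF sym] by simp
  note B_K = sym this
  note jump = chart_index_jump_side[OF l t0 C W B_K B(2)]
  have right: "\<forall>\<^sub>F t in at t0 within ({a..b} \<inter> {t0<..}). l t \<inter> C = {0} \<and>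
      chart_index C W (l t) = chart_index C W (l t0) + form_index (\<lambda>x y. 1 * B x y) ?K"
    by (rule jump) auto
  have left: "\<forall>\<^sub>F t in at t0 within ({a..b} \<inter> {..<t0}). l t \<inter> C = {0} \<and>
      chart_index C W (l t) = chart_index C W (l t0) + form_index (\<lambda>x y. -1 * B x y) ?K"
    by (rule jump) auto
  have "pos_index ?q ?K = form_index B ?K" "neg_index ?q ?K = form_index (\<lambda>x y. - B x y) ?K"
    unfolding neg_index_def by (intro pos_index_cong; simp add: q)+
  then show ?thesis
    by (intro eventually_at_within_sides[OF eventually_mono[OF right] eventually_mono[OF left]]) simp_all
qed

end

subsection \<open>The crossing formula\<close>

definition jump_sum :: "(real \<Rightarrow> int) \<Rightarrow> (real \<Rightarrow> int) \<Rightarrow> real set \<Rightarrow> real \<Rightarrow> real \<Rightarrow> int" where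
  "jump_sum r l X s t = (\<Sum>u\<in>X \<inter> {s..<t}. r u) - (\<Sum>u\<in>X \<inter> {s<..t}. l u)"

lemma jump_sum_combine:
  assumes X: "finite (X \<inter> {s..u})" and "s \<le> t" "t \<le> u"
  shows "jump_sum r l X s u = jump_sum r l X s t + jump_sum r l X t u"
proof -
  have "X \<inter> {s..<u} = X \<inter> {s..<t} \<union> X \<inter> {t..<u}" "X \<inter> {s<..u} = X \<inter> {s<..t} \<union> X \<inter> {t<..u}"
    using assms(2,3) by auto
  moreover have fin: "finite (X \<inter> I)" if "I \<subseteq> {s..u}" for I
    by (rule finite_subset[OF _ X]) (use that in auto)
  ultimately have "(\<Sum>v\<in>X \<inter> {s..<u}. r v) = (\<Sum>v\<in>X \<inter> {s..<t}. r v) + (\<Sum>v\<in>X \<inter> {t..<u}. r v)"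
    "(\<Sum>v\<in>X \<inter> {s<..u}. l v) = (\<Sum>v\<in>X \<inter> {s<..t}. l v) + (\<Sum>v\<in>X \<inter> {t<..u}. l v)"
    using assms(2,3) by (auto intro!: sum.union_disjoint fin)
  then show ?thesis by (simp add: jump_sum_def)
qed

lemma sum_Int_singleton:
  fixes f :: "'a \<Rightarrow> int"
  assumes "x \<notin> X \<Longrightarrow> f x = 0"
  shows "sum f (X \<inter> {x}) = f x"
  using assms by (cases "x \<in> X") simp_all

lemma jump_sum_isolated:
  assumes zero: "t \<notin> X \<Longrightarrow> r t = 0" "t \<notin> X \<Longrightarrow> l t = 0"
  shows "s < t \<Longrightarrow> X \<inter> {s..<t} = {} \<Longrightarrow> jump_sum r l X s t = - l t"
    "t < u \<Longrightarrow> X \<inter> {t<..u} = {} \<Longrightarrow> jump_sum r l X t u = r t"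
proof -
  assume s: "s < t" "X \<inter> {s..<t} = {}"
  then have "X \<inter> {s<..t} = X \<inter> {t}" by (auto simp: disjoint_iff le_less)
  then show "jump_sum r l X s t = - l t"
    using s sum_Int_singleton[of t X l] zero(2) by (simp add: jump_sum_def)
next
  assume u: "t < u" "X \<inter> {t<..u} = {}"
  then have "X \<inter> {t..<u} = X \<inter> {t}" by (auto simp: disjoint_iff le_less)
  then show "jump_sum r l X t u = r t"
    using u sum_Int_singleton[of t X r] zero(1) by (simp add: jump_sum_def)
qed

lemma jump_sum_endpoints:
  assumes ab: "a < b" and X: "finite (X \<inter> {a..b})"
    and zero: "a \<notin> X \<Longrightarrow> r a = 0" "b \<notin> X \<Longrightarrow> l b = 0"
  shows "jump_sum r l X a b = r a + (\<Sum>t\<in>X \<inter> {a<..<b}. r t - l t) - l b"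
proof -
  have "X \<inter> {a..<b} = X \<inter> {a} \<union> X \<inter> {a<..<b}" "X \<inter> {a<..b} = X \<inter> {a<..<b} \<union> X \<inter> {b}"
    using ab by auto
  moreover have "finite (X \<inter> {a<..<b})" by (rule finite_subset[OF _ X]) auto
  ultimately have "(\<Sum>u\<in>X \<inter> {a..<b}. r u) = sum r (X \<inter> {a}) + (\<Sum>u\<in>X \<inter> {a<..<b}. r u)"
    "(\<Sum>u\<in>X \<inter> {a<..b}. l u) = (\<Sum>u\<in>X \<inter> {a<..<b}. l u) + sum l (X \<inter> {b})"
    by (auto intro!: sum.union_disjoint)
  then show ?thesis
    by (simp add: jump_sum_def sum_subtractf sum_Int_singleton[of a X r, OF zero(1)]
        sum_Int_singleton[of b X l, OF zero(2)])
qed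

lemma increment_eq_sum_of_jumps:
  fixes f r l :: "real \<Rightarrow> int"
  assumes ab: "a < b"
    and jump: "\<And>t. t \<in> {a..b} \<Longrightarrow> \<forall>\<^sub>F s in at t within {a..b}. s \<notin> X \<and>
        f s = f t + (if t < s then r t else l t)"
    and zero: "\<And>t. t \<notin> X \<Longrightarrow> r t = 0" "\<And>t. t \<notin> X \<Longrightarrow> l t = 0"
  shows "f b - f a = r a + (\<Sum>t\<in>X \<inter> {a<..<b}. r t - l t) - l b"
proof -
  have "\<not> t islimpt (X \<inter> {a..b})" if "t \<in> {a..b}" for t
    using jump[OF that] unfolding islimpt_iff_eventually eventually_at_filter
    by (auto elim: eventually_mono)
  then have "finite ({a..b} \<inter> (X \<inter> {a..b}))" by (intro finite_not_islimpt_in_compact compact_Icc)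
  then have fin: "finite (X \<inter> {a..b})" by (rule finite_subset[rotated]) auto
  define P where "P s t \<longleftrightarrow> (a \<le> s \<and> t \<le> b \<longrightarrow> f t - f s = jump_sum r l X s t)" for s t
  have combine: "P s u" if "P s t" "P t u" "s \<le> t" "t \<le> u" for s t u
    unfolding P_def
  proof (intro impI, elim conjE)
    assume su: "a \<le> s" "u \<le> b"
    then have "finite (X \<inter> {s..u})" by (intro finite_subset[OF _ fin]) auto
    then have "jump_sum r l X s u = jump_sum r l X s t + jump_sum r l X t u"
      using that(3,4) by (rule jump_sum_combine)
    moreover have "f t - f s = jump_sum r l X s t" "f u - f t = jump_sum r l X t u"
      using that su unfolding P_def by auto
    ultimately show "f u - f s = jump_sum r l X s u" by linarith
  qed
  have "P a b"
  proof (rule Bolzano[OF less_imp_le[OF ab]])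
    fix t assume "a \<le> t" "t \<le> b"
    then obtain d where d_pos: "d > 0" and near: "\<And>s. s \<in> {a..b} \<Longrightarrow> s \<noteq> t \<Longrightarrow> \<bar>s - t\<bar> < d \<Longrightarrow>
        s \<notin> X \<and> f s = f t + (if t < s then r t else l t)"
      using jump[of t] unfolding eventually_at dist_real_def by auto
    have left: "P s t" if s: "s \<le> t" "t - s < d" for s
    proof (cases "s = t \<or> s < a")
      case False
      then have "X \<inter> {s..<t} = {}" "f s = f t + l t" using s near \<open>t \<le> b\<close> by (auto simp: disjoint_iff)
      then show ?thesis using False s(1) jump_sum_isolated(1)[of t X r l s, OF zero] by (simp add: P_def)
    qed (auto simp: P_def jump_sum_def)
    have right: "P t u" if u: "t \<le> u" "u - t < d" for u
    proof (cases "u = t \<or> b < u")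
      case False
      then have "X \<inter> {t<..u} = {}" "f u = f t + r t" using u near \<open>a \<le> t\<close> by (auto simp: disjoint_iff)
      then show ?thesis using False u(1) jump_sum_isolated(2)[of t X r l u, OF zero] by (simp add: P_def)
    qed (auto simp: P_def jump_sum_def)
    show "\<exists>d>0. \<forall>s u. s \<le> t \<and> t \<le> u \<and> u - s < d \<longrightarrow> P s u"
      using d_pos by (intro exI[of _ d]) (auto intro!: combine[OF left right])
  qed (rule combine)
  then show ?thesis using jump_sum_endpoints[OF ab fin zero] by (simp add: P_def)
qed

context symplectic
begin

theorem maslov_regular_eq_primitive:
  assumes ab: "a < b" and l: "lag_C1 \<omega> l a b" and C: "lagrangian \<omega> C"
    and regular: "regular_crossings \<omega> l C a b" and M: "primitive C {a..b} l M"
  shows "maslov_regular \<omega> C l a b = M b - M a"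
proof -
  let ?q = "crossing_form \<omega> l C a b" and ?X = "{t. is_crossing l C t}"
  let ?r = "\<lambda>t. int (pos_index (?q t) (l t \<inter> C))" and ?l = "\<lambda>t. int (neg_index (?q t) (l t \<inter> C))"
  have "pos_index q {0} = 0" "neg_index q {0} = 0" for q :: "'v \<Rightarrow> real"
    using pos_def_indices[of "{0}" q] by (simp_all add: qf_pos_def_def)
  then have zero: "?r t = 0" "?l t = 0" if "t \<notin> ?X" for t using that by (simp_all add: is_crossing_def)
  have "\<forall>\<^sub>F s in at t within {a..b}. s \<notin> ?X \<and> M s = M t + (if t < s then ?r t else ?l t)"
    if t: "t \<in> {a..b}" for t
  proof -
    obtain W where W: "transversal W (l t)" using transversal_exists[OF lag_C1_lagrangian[OF l t]] .
    have "qf_nondegenerate (?q t) (l t \<inter> C)"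
      using regular t
      by (cases "is_crossing l C t") (auto simp: regular_crossings_def is_crossing_def qf_nondegenerate_def)
    from chart_index_jump[OF ab l t C W this] primitiveD[OF M t W] show ?thesis
    proof eventually_elim
      case (elim s)
      then show ?case by (cases "t < s") (simp_all add: is_crossing_def)
    qed
  qed
  then have "M b - M a = ?r a + (\<Sum>t\<in>?X \<inter> {a<..<b}. ?r t - ?l t) - ?l b"
    by (rule increment_eq_sum_of_jumps[OF ab]) (use zero in auto)
  moreover have "?X \<inter> {a<..<b} = {t. a < t \<and> t < b \<and> is_crossing l C t}" by auto
  ultimately show ?thesis by (simp add: maslov_regular_def qf_signature_def)
qed

lemma lag_C1_primitive_exists:
  assumes "a < b" "lagrangian \<omega> C" "lag_C1 \<omega> l a b"
  obtains M where "primitive C {a..b} l M"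
  using primitive_interval[OF assms(2) less_imp_le[OF assms(1)] lag_C1_lagrangian[OF assms(3)]
      lag_C1_continuous[OF assms(3)]]
  by blast

theorem iota_CLM_eq_primitive:
  assumes ab: "a < b" and C: "lagrangian \<omega> C" and M: "primitive C {a..b} l M"
    and l': "lag_C1 \<omega> l' a b" "regular_crossings \<omega> l' C a b" "lag_homotopic \<omega> a b l l'"
  shows "iota_CLM \<omega> C l a b = M b - M a"
proof -
  have regular_eq: "maslov_regular \<omega> C k a b = M b - M a"
    if k: "lag_C1 \<omega> k a b" "regular_crossings \<omega> k C a b" "lag_homotopic \<omega> a b l k" for k
  proof -
    obtain N where N: "primitive C {a..b} k N" using lag_C1_primitive_exists[OF ab C k(1)] .
    show ?thesis
      using maslov_regular_eq_primitive[OF ab k(1) C k(2) N]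
        primitive_homotopy[OF C less_imp_le[OF ab] k(3) M N] by simp
  qed
  show ?thesis
    unfolding iota_CLM_def
  proof (rule the_equality)
    show "\<exists>k. lag_C1 \<omega> k a b \<and> regular_crossings \<omega> k C a b \<and> lag_homotopic \<omega> a b l k \<and>
        M b - M a = maslov_regular \<omega> C k a b"
      using l' regular_eq[OF l'] by (intro exI[of _ l']) simp
  qed (use regular_eq in auto)
qed

lemma lag_homotopic_refl:
  assumes "\<And>t. t \<in> {a..b} \<Longrightarrow> lagrangian \<omega> (l t)" "subspace_continuous_on {a..b} l"
  shows "lag_homotopic \<omega> a b l l"
  unfolding lag_homotopic_def
proof (intro exI[of _ "\<lambda>p. l (snd p)"] conjI)
  show "subspace_continuous_on ({0..1} \<times> {a..b}) (\<lambda>p. l (snd p))"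
    by (rule subspace_continuous_on_compose[OF assms(2)]) (auto intro: continuous_intros)
qed (use assms(1) in auto)

theorem iota_CLM_regular:
  assumes ab: "a < b" and C: "lagrangian \<omega> C" and l: "lag_C1 \<omega> l a b" "regular_crossings \<omega> l C a b"
  shows "iota_CLM \<omega> C l a b = maslov_regular \<omega> C l a b"
proof -
  obtain M where M: "primitive C {a..b} l M" using lag_C1_primitive_exists[OF ab C l(1)] .
  have "lag_homotopic \<omega> a b l l"
    by (rule lag_homotopic_refl[OF lag_C1_lagrangian[OF l(1)] lag_C1_continuous[OF l(1)]])
  then show ?thesis
    using iota_CLM_eq_primitive[OF ab C M l] maslov_regular_eq_primitive[OF ab l(1) C l(2) M] by simp
qed

theorem plus_curve_iota_CLM_ge:
  assumes ab: "a < b" and C: "lagrangian \<omega> C" and plus: "plus_curve \<omega> l C a b"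
  shows "iota_CLM \<omega> C l a b \<ge> int (dim (l a \<inter> C))"
proof -
  let ?q = "crossing_form \<omega> l C a b"
  have l: "lag_C1 \<omega> l a b" using plus by (simp add: plus_curve_def)
  have pos: "qf_pos_def (?q t) (l t \<inter> C)" if "t \<in> {a..b}" for t
    using plus that unfolding plus_curve_def is_crossing_def
    by (cases "l t \<inter> C = {0}") (auto simp: qf_pos_def_def)
  have K: "subspace (l t \<inter> C)" if "t \<in> {a..b}" for t
    by (intro subspace_inter lagrangian_subspace lag_C1_lagrangian[OF l that] C)
  note indices = pos_def_indices[OF K pos]
  have "regular_crossings \<omega> l C a b"
    unfolding regular_crossings_def
  proof (intro ballI impI crossing_form_definite_nondegenerate[OF ab l _ C])
    show "?q t v \<noteq> 0" if "t \<in> {a..b}" "v \<in> l t \<inter> C" "v \<noteq> 0" for t v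
      using pos[OF that(1)] that(2,3) by (force simp: qf_pos_def_def)
  qed
  then have "iota_CLM \<omega> C l a b = maslov_regular \<omega> C l a b" by (rule iota_CLM_regular[OF ab C l])
  moreover have "(\<Sum>t | a < t \<and> t < b \<and> is_crossing l C t. qf_signature (?q t) (l t \<inter> C)) \<ge> 0"
    by (rule sum_nonneg) (simp add: qf_signature_def indices)
  ultimately show ?thesis using ab by (simp add: maslov_regular_def indices)
qed

end

subsection \<open>Images under symplectic maps and rotations\<close>

context symplectic
begin

lemma symplectic_map_inj: "symplectic_map \<omega> A \<Longrightarrow> inj (blinfun_apply A)"
  by (auto simp: symplectic_map_def bij_def)

lemma symplectic_map_lagrangian:
  assumes A: "symplectic_map \<omega> A" and L: "lagrangian \<omega> L"
  shows "lagrangian \<omega> (A ` L)"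
proof -
  have "dim (A ` L) = dim L"
    by (intro dim_image_inj_on linear_blinfun lagrangian_subspace[OF L]
        inj_on_subset[OF symplectic_map_inj[OF A]]) simp
  then show ?thesis
    using A L linear_subspace_image[OF linear_blinfun, of L A]
    unfolding lagrangian_def symplectic_map_def by auto
qed

lemma dim_symplectic_map_Int:
  assumes A: "symplectic_map \<omega> A" and L: "lagrangian \<omega> L1" "lagrangian \<omega> L2"
  shows "dim (A ` L1 \<inter> A ` L2) = dim (L1 \<inter> L2)"
proof -
  have "A ` L1 \<inter> A ` L2 = A ` (L1 \<inter> L2)" using symplectic_map_inj[OF A] by (simp add: image_Int)
  moreover have "dim (A ` (L1 \<inter> L2)) = dim (L1 \<inter> L2)"
    by (intro dim_image_inj_on linear_blinfun subspace_inter lagrangian_subspace L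
        inj_on_subset[OF symplectic_map_inj[OF A]]) simp
  ultimately show ?thesis by simp
qed

lemma symplectic_map_compose:
  assumes "symplectic_map \<omega> A" "symplectic_map \<omega> B"
  shows "symplectic_map \<omega> (A o\<^sub>L B)"
  using assms bij_comp[of "blinfun_apply B" "blinfun_apply A"]
  by (simp add: symplectic_map_def blinfun_compose.rep_eq)

lemma subspace_continuous_on_symplectic_image:
  fixes A :: "'a::metric_space \<Rightarrow> ('v \<Rightarrow>\<^sub>L 'v)"
  assumes "continuous_on D A" "\<And>t. t \<in> D \<Longrightarrow> symplectic_map \<omega> (A t)" "lagrangian \<omega> L"
  shows "subspace_continuous_on D (\<lambda>t. A t ` L)"
  by (rule subspace_continuous_on_image)
    (use assms symplectic_map_inj lagrangian_subspace inj_on_subset in blast)+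

lemma lag_C1_symplectic_image:
  assumes A: "C1_on_interval a b A" "\<And>t. t \<in> {a..b} \<Longrightarrow> symplectic_map \<omega> (A t)" and L: "lagrangian \<omega> L"
  shows "lag_C1 \<omega> (\<lambda>t. A t ` L) a b"
proof -
  obtain B where B: "B \<subseteq> L" "independent B" "L \<subseteq> span B" "card B = dim L" using basis_exists by blast
  then have "finite B" "card B = DIM('v) div 2"
    using independent_imp_finite lagrangian_dim[OF L] by auto
  then obtain h where h: "bij_betw h {..<DIM('v) div 2} B"
    using ex_bij_betw_nat_finite[of B] by (auto simp: atLeast0LessThan)
  have "span B = L" using B(1,3) lagrangian_subspace[OF L] span_minimal by blast
  then have span_h: "span (h ` {..<DIM('v) div 2}) = L" using h by (simp add: bij_betw_def)
  show ?thesis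
    unfolding lag_C1_def
  proof (intro conjI ballI exI[of _ "\<lambda>t i. A t (h i)"] allI)
    show "lagrangian \<omega> (A t ` L)" if "t \<in> {a..b}" for t
      by (rule symplectic_map_lagrangian[OF A(2)[OF that] L])
    show "A t ` L = span ((\<lambda>i. A t (h i)) ` {..<DIM('v) div 2})" if "t \<in> {a..b}" for t
      using linear_span_image[OF linear_blinfun, of "A t" "h ` {..<DIM('v) div 2}"]
      by (simp add: span_h image_image)
    show "C1_on_interval a b (\<lambda>t. A t (h i))" for i
      by (rule C1_on_interval_bounded_linear[OF blinfun.bounded_linear_left A(1)])
  qed
qed

lemma crossing_form_symplectic_image:
  assumes ab: "a < b" and A: "C1_on_interval a b A" "\<And>t. t \<in> {a..b} \<Longrightarrow> symplectic_map \<omega> (A t)"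
    and L: "lagrangian \<omega> L" and t0: "t0 \<in> {a..b}" "(A has_vector_derivative A') (at t0 within {a..b})"
    and e: "e \<in> L"
  shows "crossing_form \<omega> (\<lambda>t. A t ` L) C a b t0 (A t0 e) = \<omega> (A t0 e) (A' e)"
  by (rule crossing_form_eq[OF ab lag_C1_symplectic_image[OF A L] t0(1)])
    (use e bounded_linear.has_vector_derivative[OF blinfun.bounded_linear_left t0(2)] in auto)

text \<open>The Euclidean structure of \<open>L\<close> identifies \<open>L\<close> with a transversal \<open>X\<close>, the dual of \<open>L\<close>.\<close>

lemma lagrangian_dual_map_exists:
  assumes X: "transversal X L"
  obtains j where "linear j" "\<And>x y. \<omega> y (j x) = proj X L y \<bullet> proj X L x"
    "\<And>x. proj X L x = 0 \<Longrightarrow> j x = 0" "inj_on j L" "j ` L = X"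
proof -
  have "bilinear (\<lambda>u y. - (proj X L u \<bullet> proj X L y))"
    by (intro bilinear_uminus bilinear_compose[OF _ linear_proj[OF X] linear_proj[OF X]]
        bilinear_conv_bounded_bilinear[THEN iffD2] bounded_bilinear_inner)
  then obtain j where j: "linear j" "\<And>u y. \<omega> (j u) y = - (proj X L u \<bullet> proj X L y)"
    using omega_represented by blast
  have omega_j: "\<omega> y (j x) = proj X L y \<bullet> proj X L x" for x y
    using omega_skew[of y "j x"] j(2)[of x y] by (simp add: inner_commute)
  have inj: "inj_on j L"
  proof (subst linear_inj_on_iff_eq_0[OF j(1) transversal_subspace(2)[OF X]], intro ballI impI)
    fix x assume "x \<in> L" "j x = 0"
    then show "x = 0" using omega_j[of x x] by (simp add: proj_id[OF X] omega_simps)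
  qed
  show ?thesis
  proof (rule that[OF j(1) omega_j _ inj])
    show "j x = 0" if "proj X L x = 0" for x
      by (rule omega_nondegenerate) (simp add: j(2) that)
    have "j x \<in> X" for x
      by (rule lagrangian_maximal[OF transversal_lagrangian(1)[OF X]]) (simp add: omega_j proj_zero[OF X])
    moreover have "dim (j ` L) = dim X"
      using dim_image_inj_on[OF j(1) transversal_subspace(2)[OF X] inj]
        transversal_lagrangian[OF X, THEN lagrangian_dim] by simp
    ultimately show "j ` L = X"
      by (intro subspace_dim_equal linear_subspace_image[OF j(1)] transversal_subspace[OF X]) auto
  qed
qed

lemma lagrangian_duality:
  assumes X: "transversal X L"
  obtains j k where "linear j" "linear k" "\<And>x. j x \<in> X" "\<And>x. k x \<in> L"
    "\<And>x y. \<omega> y (j x) = proj X L y \<bullet> proj X L x"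
    "\<And>x. j (k x) = proj L X x" "\<And>x. k (j x) = proj X L x" "\<And>x. j (j x) = 0" "\<And>x. k (k x) = 0"
proof -
  note X' = transversal_sym[OF X]
  obtain j where j: "linear j" "\<And>x y. \<omega> y (j x) = proj X L y \<bullet> proj X L x"
    and null: "\<And>x. proj X L x = 0 \<Longrightarrow> j x = 0" and inj: "inj_on j L" and image: "j ` L = X"
    by (rule lagrangian_dual_map_exists[OF X]) (rule that; assumption)
  have j_proj: "j (proj X L x) = j x" for x
  proof -
    have "proj X L (proj X L x - x) = 0" by (simp add: proj_diff[OF X] proj_id[OF X proj_in[OF X]])
    then show ?thesis using null[of "proj X L x - x"] by (simp add: linear_diff[OF j(1)])
  qed
  then have jX: "j x \<in> X" for x using proj_in[OF X, of x] image by (metis imageI)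
  obtain g where g: "range g \<subseteq> L" "linear g" "\<And>x. x \<in> L \<Longrightarrow> g (j x) = x"
    using linear_exists_left_inverse_on[OF j(1) transversal_subspace(2)[OF X] inj] by blast
  define k where "k x = g (proj L X x)" for x
  have kL: "k x \<in> L" for x using g(1) by (auto simp: k_def)
  show ?thesis
  proof (rule that[of j k])
    show "linear k"
      unfolding k_def using linear_compose[OF linear_proj[OF X'] g(2)] by (simp add: o_def)
    show "j (k x) = proj L X x" for x
    proof -
      have "proj L X x \<in> j ` L" unfolding image by (rule proj_in[OF X'])
      then show ?thesis using g(3) by (auto simp: k_def)
    qed
    show "k (j x) = proj X L x" for x
      using g(3)[OF proj_in[OF X]] by (simp add: k_def proj_id[OF X' jX] j_proj)
    show "j (j x) = 0" for x by (rule null) (rule proj_zero[OF X jX])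
    show "k (k x) = 0" for x using linear_0[OF g(2)] by (simp add: k_def[of "k x"] proj_zero[OF X' kL])
  qed (rule j jX kL)+
qed

lemma complex_structure_exists:
  assumes L: "lagrangian \<omega> L"
  obtains J :: "'v \<Rightarrow>\<^sub>L 'v" where "\<And>x. J (J x) = - x" "\<And>x y. \<omega> (J x) (J y) = \<omega> x y"
    "\<And>x. x \<noteq> 0 \<Longrightarrow> \<omega> x (J x) > 0"
proof -
  obtain X where X: "transversal X L" using transversal_exists[OF L] .
  let ?P = "proj X L" and ?Q = "proj L X"
  obtain j k where j: "linear j" "\<And>x. j x \<in> X" and k: "linear k" "\<And>x. k x \<in> L"
    and omega_j: "\<And>x y. \<omega> y (j x) = ?P y \<bullet> ?P x"
    and compositions: "\<And>x. j (k x) = ?Q x" "\<And>x. k (j x) = ?P x" "\<And>x. j (j x) = 0" "\<And>x. k (k x) = 0"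
    by (rule lagrangian_duality[OF X]) (rule that; assumption)
  define J where "J x = j x - k x" for x
  have linear_J: "linear J" unfolding J_def by (intro linear_compose_sub j(1) k(1))
  have kJ: "k (J x) = ?P x" for x by (simp add: J_def linear_diff[OF k(1)] compositions)
  have PJ: "?P (J x) = - k x" for x
    by (simp add: J_def proj_diff[OF X] proj_zero[OF X j(2)] proj_id[OF X k(2)])
  have decomp: "x = ?P x + j (k x)" for x by (simp add: compositions proj_swap[OF X])
  have omega_eq: "\<omega> x y = ?P x \<bullet> k y - ?P y \<bullet> k x" for x y
  proof -
    have "\<omega> x y = \<omega> (?P x + j (k x)) (?P y + j (k y))" using decomp by simp
    also have "\<dots> = \<omega> (?P x) (j (k y)) + \<omega> (j (k x)) (?P y)"
      using lagrangian_isotropic[OF L proj_in[OF X] proj_in[OF X], of x y]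
        lagrangian_isotropic[OF transversal_lagrangian(1)[OF X] j(2) j(2), of "k x" "k y"]
      by (simp add: omega_simps)
    also have "\<dots> = ?P x \<bullet> k y - ?P y \<bullet> k x"
      using omega_skew[of "j (k x)" "?P y"]
      by (simp add: omega_j proj_id[OF X k(2)] proj_id[OF X proj_in[OF X]])
    finally show ?thesis .
  qed
  have "bounded_linear J" using linear_J by (simp add: linear_conv_bounded_linear)
  then have apply_J: "blinfun_apply (Blinfun J) = J" by (rule bounded_linear_Blinfun_apply)
  show ?thesis
  proof (rule that[of "Blinfun J", unfolded apply_J])
    show "J (J x) = - x" for x
      by (simp add: J_def linear_diff[OF j(1)] linear_diff[OF k(1)] compositions proj_swap[OF X])
    show "\<omega> (J x) (J y) = \<omega> x y" for x y
      unfolding omega_eq PJ kJ by (simp add: inner_commute)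
    show "\<omega> x (J x) > 0" if "x \<noteq> 0" for x
    proof -
      have "?P x \<noteq> 0 \<or> k x \<noteq> 0" using decomp[of x] that linear_0[OF j(1)] by auto
      then have "?P x \<bullet> ?P x + k x \<bullet> k x > 0" by (auto intro: add_pos_nonneg add_nonneg_pos)
      then show ?thesis unfolding omega_eq PJ kJ by simp
    qed
  qed
qed

end

locale symplectic_rotation = symplectic \<omega> for \<omega> :: "'v::euclidean_space \<Rightarrow> 'v \<Rightarrow> real" +
  fixes J :: "'v \<Rightarrow>\<^sub>L 'v"
  assumes J_J: "J (J x) = - x" and omega_J: "\<omega> (J x) (J y) = \<omega> x y"
    and J_pos: "x \<noteq> 0 \<Longrightarrow> \<omega> x (J x) > 0"
begin

definition rotation :: "real \<Rightarrow> 'v \<Rightarrow>\<^sub>L 'v" where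
  "rotation \<theta> = cos \<theta> *\<^sub>R id_blinfun + sin \<theta> *\<^sub>R J"

lemma rotation_apply: "rotation \<theta> x = cos \<theta> *\<^sub>R x + sin \<theta> *\<^sub>R J x"
  by (simp add: rotation_def blinfun.bilinear_simps)

lemma rotation_0 [simp]: "rotation 0 x = x"
  by (simp add: rotation_apply)

lemma rotation_add: "rotation \<theta> (rotation \<phi> x) = rotation (\<theta> + \<phi>) x"
  by (simp add: rotation_apply blinfun.bilinear_simps J_J cos_add sin_add algebra_simps)

lemma J_rotation: "J (rotation \<theta> x) = rotation \<theta> (J x)"
  by (simp add: rotation_apply blinfun.bilinear_simps)

lemma omega_rotation: "\<omega> (rotation \<theta> x) (rotation \<theta> y) = \<omega> x y"
proof -
  have "\<omega> (J x) y = - \<omega> x (J y)" using omega_J[of "J x" y] by (simp add: J_J omega_simps)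
  then have "\<omega> (rotation \<theta> x) (rotation \<theta> y) = cos \<theta> * (cos \<theta> * \<omega> x y) + sin \<theta> * (sin \<theta> * \<omega> x y)"
    unfolding rotation_apply by (simp add: omega_simps omega_J algebra_simps)
  also have "\<dots> = ((cos \<theta>)\<^sup>2 + (sin \<theta>)\<^sup>2) * \<omega> x y"
    by (simp only: power2_eq_square distrib_right mult.assoc)
  finally show ?thesis by simp
qed

lemma symplectic_map_rotation: "symplectic_map \<omega> (rotation \<theta>)"
proof -
  have "bij (rotation \<theta>)"
    by (rule bij_betw_byWitness[of _ "rotation (- \<theta>)"]) (auto simp: rotation_add)
  then show ?thesis by (simp add: symplectic_map_def omega_rotation)
qed

lemma rotation_has_derivative: "(rotation has_vector_derivative J o\<^sub>L rotation \<theta>) (at \<theta> within S)"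
proof -
  have "J o\<^sub>L rotation \<theta> = - sin \<theta> *\<^sub>R id_blinfun + cos \<theta> *\<^sub>R J"
    by (rule blinfun_eqI) (simp add: rotation_apply blinfun.bilinear_simps J_J)
  then show ?thesis
    unfolding rotation_def[abs_def] by (auto intro!: derivative_eq_intros)
qed

lemma continuous_on_rotation [continuous_intros]:
  fixes f :: "'b::t2_space \<Rightarrow> real"
  shows "continuous_on S f \<Longrightarrow> continuous_on S (\<lambda>x. rotation (f x))"
  unfolding rotation_def by (auto intro!: continuous_intros)

lemma rotation_image_shift_pi:
  assumes "subspace L"
  shows "rotation (\<theta> + real N * pi) ` L = rotation \<theta> ` L"
proof (induction N)
  case (Suc N)
  have shift: "rotation (\<theta> + real (Suc N) * pi) x = rotation (\<theta> + real N * pi) (- x)" for x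
  proof -
    have "rotation (\<phi> + pi) x = rotation \<phi> (- x)" for \<phi> by (simp add: rotation_apply blinfun.bilinear_simps)
    from this[of "\<theta> + real N * pi"] show ?thesis by (simp add: algebra_simps)
  qed
  have "uminus ` L = L" using assms subspace_neg by (force simp: image_iff)
  then have "rotation (\<theta> + real N * pi) ` L = (\<lambda>x. rotation (\<theta> + real N * pi) (- x)) ` L"
    using image_image[of "rotation (\<theta> + real N * pi)" uminus L] by simp
  also have "\<dots> = rotation (\<theta> + real (Suc N) * pi) ` L" by (intro image_cong refl shift[symmetric])
  finally show ?case using Suc by simp
qed simp

lemma C1_on_interval_rotation: "C1_on_interval a b rotation"
  unfolding C1_on_interval_def
  by (intro exI[of _ "\<lambda>\<theta>. J o\<^sub>L rotation \<theta>"] conjI ballI rotation_has_derivative continuous_intros)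

lemma eventually_rotation_transversal:
  assumes L: "lagrangian \<omega> L" and C: "lagrangian \<omega> C"
  shows "\<forall>\<^sub>F \<theta> in at_right 0. transversal (rotation \<theta> ` L) C"
proof -
  let ?l = "\<lambda>\<theta>. rotation \<theta> ` L"
  have l: "lag_C1 \<omega> ?l 0 1"
    by (rule lag_C1_symplectic_image[OF C1_on_interval_rotation symplectic_map_rotation L])
  have "crossing_form \<omega> ?l C 0 1 0 v = \<omega> v (J v)" if "v \<in> L" for v
    using crossing_form_symplectic_image[OF zero_less_one C1_on_interval_rotation symplectic_map_rotation
        L _ rotation_has_derivative that, of 0 C] by simp
  then have nondegenerate: "qf_nondegenerate (crossing_form \<omega> ?l C 0 1 0) (?l 0 \<inter> C)"
    using J_pos by (intro crossing_form_definite_nondegenerate[OF _ l _ C]) force+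
  obtain W where "transversal W L" using transversal_exists[OF L] .
  then have "0 \<in> {0..1::real}" "transversal W (?l 0)" by simp_all
  from chart_index_jump[OF zero_less_one l this(1) C this(2) nondegenerate]
  have "\<forall>\<^sub>F \<theta> in at 0 within {0..1}. ?l \<theta> \<inter> C = {0}" by (rule eventually_mono) simp
  then show ?thesis
    unfolding at_within_Icc_at_right[OF zero_less_one]
    by eventually_elim (simp add: transversal_def C symplectic_map_lagrangian[OF symplectic_map_rotation L])
qed

end

context symplectic
begin

lemma symplectic_rotation_exists:
  assumes "lagrangian \<omega> L"
  obtains J where "symplectic_rotation \<omega> J"
  using complex_structure_exists[OF assms] symplectic_axioms
  by (metis symplectic_rotation.intro symplectic_rotation_axioms.intro)

lemma common_transversal_exists:
  assumes L: "lagrangian \<omega> L1" "lagrangian \<omega> L2"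
  obtains W where "transversal W L1" "transversal W L2"
proof -
  obtain J where "symplectic_rotation \<omega> J" using symplectic_rotation_exists[OF L(1)] .
  then interpret symplectic_rotation \<omega> J .
  have "\<forall>\<^sub>F \<theta> in at_right 0. transversal (rotation \<theta> ` L1) L1 \<and> transversal (rotation \<theta> ` L1) L2"
    by (intro eventually_conj eventually_rotation_transversal L)
  then show ?thesis using that eventually_happens trivial_limit_at_right_real by blast
qed

end

subsection \<open>Regular representatives\<close>

lemma square_bound_of_steep:
  fixes m r u \<kappa> :: real
  assumes m: "m > 0" "\<bar>\<kappa>\<bar> < m * r" "\<kappa>\<^sup>2 < m * r" and u: "2 * (m * \<bar>u\<bar>) \<le> \<kappa>"
  shows "\<bar>u\<bar> < r" "m * u\<^sup>2 < r"
proof -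
  have mu_le: "m * \<bar>u\<bar> \<le> \<bar>\<kappa>\<bar> / 2" using u by simp
  then have "m * \<bar>u\<bar> < m * r" using m(2) by simp
  then show "\<bar>u\<bar> < r" using m(1) by simp
  have "(m * \<bar>u\<bar>)\<^sup>2 \<le> (\<bar>\<kappa>\<bar> / 2)\<^sup>2" using mu_le m(1) by (intro power_mono) auto
  also have "\<dots> \<le> \<kappa>\<^sup>2" by (simp add: power_divide)
  also note m(3)
  finally have "m * (m * u\<^sup>2) < m * r" by (simp add: power_mult_distrib power2_eq_square mult_ac)
  then show "m * u\<^sup>2 < r" using m(1) by simp
qed

text \<open>With \<open>u = t - (a + b) / 2\<close> and \<open>w = (b - a) / 2\<close> take \<open>f = m (w\<^sup>2 - u\<^sup>2)\<close>, where
  \<open>m w\<^sup>2 = \<theta> + N \<pi>\<close> for large \<open>N\<close>. If \<open>\<bar>f'\<bar> = 2 m \<bar>u\<bar>\<close> is at most \<open>\<kappa>\<close>, then both \<open>\<bar>u\<bar>\<close> and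
  \<open>m u\<^sup>2\<close> are of order \<open>1 / m\<close>.\<close>

lemma steep_bump_exists:
  fixes a b \<theta> \<kappa> r :: real
  assumes ab: "a < b" and r: "r > 0"
  obtains f f' :: "real \<Rightarrow> real" and N :: nat
  where "f a = 0" "f b = 0" "\<And>t S. (f has_vector_derivative f' t) (at t within S)"
    "continuous_on UNIV f'"
    "\<And>t. \<bar>f' t\<bar> > \<kappa> \<or> \<bar>t - (a + b) / 2\<bar> < r \<and> \<bar>f t - (\<theta> + real N * pi)\<bar> < r"
proof -
  define w where "w = (b - a) / 2"
  have w: "w > 0" using ab by (simp add: w_def)
  define m0 where "m0 = max 1 (max (\<bar>\<kappa>\<bar> / r) (\<kappa>\<^sup>2 / r))"
  obtain N :: nat where N: "(w\<^sup>2 * m0 - \<theta>) / pi < real N" using reals_Archimedean2 by blast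
  define m where "m = (\<theta> + real N * pi) / w\<^sup>2"
  have peak: "m * w\<^sup>2 = \<theta> + real N * pi" using w by (simp add: m_def)
  have "w\<^sup>2 * m0 < \<theta> + real N * pi" using N by (simp add: pos_divide_less_eq)
  then have "m0 < m" using w by (simp add: m_def pos_less_divide_eq mult.commute)
  then have "m > 1" "\<bar>\<kappa>\<bar> / r < m" "\<kappa>\<^sup>2 / r < m" by (simp_all add: m0_def)
  then have m: "m > 1" "\<bar>\<kappa>\<bar> < m * r" "\<kappa>\<^sup>2 < m * r" using r by (simp_all add: pos_divide_less_eq)
  define f where "f t = m * (t - a) * (b - t)" for t
  define f' where "f' t = m * (a + b - 2 * t)" for t
  show ?thesis
  proof (rule that[of f f' N])
    show "(f has_vector_derivative f' t) (at t within S)" for t S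
      unfolding f_def f'_def has_real_derivative_iff_has_vector_derivative[symmetric]
      by (auto intro!: derivative_eq_intros simp: algebra_simps)
    show "continuous_on UNIV f'" unfolding f'_def by (intro continuous_intros)
    fix t
    define u where "u = t - (a + b) / 2"
    have f': "\<bar>f' t\<bar> = 2 * (m * \<bar>u\<bar>)"
    proof -
      have "f' t = - (2 * (m * u))" by (simp add: f'_def u_def algebra_simps)
      then show ?thesis using m(1) by (simp add: abs_mult)
    qed
    have f: "f t - (\<theta> + real N * pi) = - (m * u\<^sup>2)"
      unfolding peak[symmetric] by (simp add: f_def u_def w_def power2_eq_square field_simps)
    show "\<bar>f' t\<bar> > \<kappa> \<or> \<bar>t - (a + b) / 2\<bar> < r \<and> \<bar>f t - (\<theta> + real N * pi)\<bar> < r"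
    proof (cases "\<bar>f' t\<bar> > \<kappa>")
      case False
      then have u_le: "2 * (m * \<bar>u\<bar>) \<le> \<kappa>" using f' by simp
      have "m > 0" using m(1) by simp
      from square_bound_of_steep[OF this m(2,3) u_le] show ?thesis
        using m(1) unfolding f by (simp add: u_def)
    qed simp
  qed (simp_all add: f_def)
qed

lemma quadratic_ratio_bounded:
  fixes n d :: "real \<Rightarrow> 'v::euclidean_space \<Rightarrow> real"
  assumes cont: "continuous_on ({a..b} \<times> UNIV) (\<lambda>p. n (fst p) (snd p))"
      "continuous_on ({a..b} \<times> UNIV) (\<lambda>p. d (fst p) (snd p))"
    and pos: "\<And>t x. t \<in> {a..b} \<Longrightarrow> x \<noteq> 0 \<Longrightarrow> d t x > 0"
    and homogeneous: "\<And>t c x. n t (c *\<^sub>R x) = c\<^sup>2 * n t x" "\<And>t c x. d t (c *\<^sub>R x) = c\<^sup>2 * d t x"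
  shows "\<exists>\<kappa>. \<forall>t\<in>{a..b}. \<forall>x. \<bar>n t x\<bar> \<le> \<kappa> * d t x"
proof -
  let ?K = "{a..b} \<times> sphere (0 :: 'v) 1"
  have "d (fst p) (snd p) \<noteq> 0" if "p \<in> ?K" for p using pos[of "fst p" "snd p"] that by force
  then have "continuous_on ?K (\<lambda>p. n (fst p) (snd p) / d (fst p) (snd p))"
    by (intro continuous_on_divide continuous_on_subset[OF cont(1)] continuous_on_subset[OF cont(2)]) auto
  then have "bounded ((\<lambda>p. n (fst p) (snd p) / d (fst p) (snd p)) ` ?K)"
    by (intro compact_imp_bounded compact_continuous_image compact_Times compact_Icc compact_sphere)
  then obtain \<kappa> where \<kappa>: "\<And>t x. t \<in> {a..b} \<Longrightarrow> norm x = 1 \<Longrightarrow> \<bar>n t x / d t x\<bar> \<le> \<kappa>"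
    unfolding bounded_pos by force
  show ?thesis
  proof (intro exI[of _ \<kappa>] ballI allI)
    fix t x assume t: "t \<in> {a..b}"
    show "\<bar>n t x\<bar> \<le> \<kappa> * d t x"
    proof (cases "x = 0")
      case True
      then show ?thesis using homogeneous[of t 0 x] by simp
    next
      case False
      define u where "u = x /\<^sub>R norm x"
      have u: "norm u = 1" "x = norm x *\<^sub>R u" using False by (simp_all add: u_def)
      then have "d t u > 0" using pos[OF t, of u] by force
      then have "\<bar>n t u\<bar> \<le> \<kappa> * d t u" using \<kappa>[OF t u(1)] by (simp add: abs_divide pos_divide_le_eq)
      then have "(norm x)\<^sup>2 * \<bar>n t u\<bar> \<le> (norm x)\<^sup>2 * (\<kappa> * d t u)" by (rule mult_left_mono) simp
      then have "\<bar>(norm x)\<^sup>2 * n t u\<bar> \<le> \<kappa> * ((norm x)\<^sup>2 * d t u)" by (simp add: abs_mult mult_ac)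
      then show ?thesis using homogeneous[of t "norm x" u] u(2) by simp
    qed
  qed
qed

context symplectic_rotation
begin

abbreviation rotated :: "(real \<Rightarrow> real) \<Rightarrow> (real \<Rightarrow> 'v \<Rightarrow>\<^sub>L 'v) \<Rightarrow> real \<Rightarrow> 'v \<Rightarrow>\<^sub>L 'v" where
  "rotated f \<psi> t \<equiv> rotation (f t) o\<^sub>L \<psi> t"

lemma rotated_has_derivative:
  assumes f: "(f has_vector_derivative f') (at t within S)"
    and \<psi>: "(\<psi> has_vector_derivative \<psi>') (at t within S)"
  shows "(rotated f \<psi> has_vector_derivative
    (rotation (f t) o\<^sub>L \<psi>') + (f' *\<^sub>R (J o\<^sub>L rotation (f t)) o\<^sub>L \<psi> t)) (at t within S)"
proof -
  have "((rotation \<circ> f) has_vector_derivative f' *\<^sub>R (J o\<^sub>L rotation (f t))) (at t within S)"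
    by (rule vector_diff_chain_within[OF f rotation_has_derivative])
  from bounded_bilinear.has_vector_derivative[OF bounded_bilinear_blinfun_compose this \<psi>]
  show ?thesis by (simp add: o_def)
qed

lemma C1_on_interval_rotated:
  assumes f: "\<And>t. t \<in> {a..b} \<Longrightarrow> (f has_vector_derivative f' t) (at t within {a..b})"
      "continuous_on {a..b} f'"
    and \<psi>: "\<And>t. t \<in> {a..b} \<Longrightarrow> (\<psi> has_vector_derivative \<psi>' t) (at t within {a..b})" "continuous_on {a..b} \<psi>'"
  shows "C1_on_interval a b (rotated f \<psi>)"
  unfolding C1_on_interval_def
proof (intro exI[of _ "\<lambda>t. (rotation (f t) o\<^sub>L \<psi>' t) + (f' t *\<^sub>R (J o\<^sub>L rotation (f t)) o\<^sub>L \<psi> t)"]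
    conjI ballI rotated_has_derivative f(1) \<psi>(1))
  have "continuous_on {a..b} f" "continuous_on {a..b} \<psi>"
    using f(1) \<psi>(1) by (meson continuous_on_eq_continuous_within has_vector_derivative_continuous)+
  then show
      "continuous_on {a..b} (\<lambda>t. (rotation (f t) o\<^sub>L \<psi>' t) + (f' t *\<^sub>R (J o\<^sub>L rotation (f t)) o\<^sub>L \<psi> t))"
    by (intro continuous_intros bounded_bilinear.continuous_on[OF bounded_bilinear_blinfun_compose] f(2)
        \<psi>(2))
qed

lemma crossing_form_rotated:
  assumes ab: "a < b" and A: "C1_on_interval a b (rotated f \<psi>)" "\<And>t. t \<in> {a..b} \<Longrightarrow> symplectic_map \<omega> (\<psi> t)"
    and L: "lagrangian \<omega> L" and t: "t \<in> {a..b}" and e: "e \<in> L"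
    and deriv: "(f has_vector_derivative f') (at t within {a..b})"
        "(\<psi> has_vector_derivative \<psi>') (at t within {a..b})"
  shows "crossing_form \<omega> (\<lambda>t. rotated f \<psi> t ` L) C a b t (rotated f \<psi> t e) =
    f' * \<omega> (\<psi> t e) (J (\<psi> t e)) + \<omega> (\<psi> t e) (\<psi>' e)"
proof -
  have "crossing_form \<omega> (\<lambda>t. rotated f \<psi> t ` L) C a b t (rotated f \<psi> t e) =
      \<omega> (rotated f \<psi> t e) (((rotation (f t) o\<^sub>L \<psi>') + (f' *\<^sub>R (J o\<^sub>L rotation (f t)) o\<^sub>L \<psi> t)) e)"
    by (rule crossing_form_symplectic_image[OF ab A(1)
          symplectic_map_compose[OF symplectic_map_rotation A(2)]
          L t rotated_has_derivative[OF deriv] e])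
  then show ?thesis by (simp add: blinfun.bilinear_simps omega_simps J_rotation omega_rotation)
qed

lemma lag_homotopic_rotated:
  assumes f: "continuous_on {a..b} f" "f a = 0" "f b = 0"
    and \<psi>: "continuous_on {a..b} \<psi>" "\<And>t. t \<in> {a..b} \<Longrightarrow> symplectic_map \<omega> (\<psi> t)" and L: "lagrangian \<omega> L"
  shows "lag_homotopic \<omega> a b (\<lambda>t. \<psi> t ` L) (\<lambda>t. rotated f \<psi> t ` L)"
  unfolding lag_homotopic_def
proof (intro exI[of _ "\<lambda>p. rotated (\<lambda>t. fst p * f t) \<psi> (snd p) ` L"] conjI ballI)
  have symp: "symplectic_map \<omega> (rotated (\<lambda>t. fst p * f t) \<psi> (snd p))" if "p \<in> {0..1} \<times> {a..b}" for p
    using that by (intro symplectic_map_compose symplectic_map_rotation \<psi>(2)) auto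
  show "lagrangian \<omega> (rotated (\<lambda>t. fst p * f t) \<psi> (snd p) ` L)" if "p \<in> {0..1} \<times> {a..b}" for p
    by (rule symplectic_map_lagrangian[OF symp[OF that] L])
  show "subspace_continuous_on ({0..1} \<times> {a..b}) (\<lambda>p. rotated (\<lambda>t. fst p * f t) \<psi> (snd p) ` L)"
  proof (rule subspace_continuous_on_symplectic_image[OF _ symp L])
    show "continuous_on ({0..1} \<times> {a..b}) (\<lambda>p. rotated (\<lambda>t. fst p * f t) \<psi> (snd p))"
      by (intro bounded_bilinear.continuous_on[OF bounded_bilinear_blinfun_compose] continuous_intros
          continuous_on_compose2[OF \<psi>(1)] continuous_on_compose2[OF f(1)]) auto
  qed
qed (auto simp: f(2,3) image_image)

lemma rotation_velocity_dominates:
  fixes \<psi>' :: "real \<Rightarrow> 'v \<Rightarrow>\<^sub>L 'v"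
  assumes \<psi>: "C1_on_interval a b \<psi>" "\<And>t. t \<in> {a..b} \<Longrightarrow> symplectic_map \<omega> (\<psi> t)"
    and \<psi>': "continuous_on {a..b} \<psi>'"
  shows "\<exists>\<kappa>. \<forall>t\<in>{a..b}. \<forall>e. \<bar>\<omega> (\<psi> t e) (\<psi>' t e)\<bar> \<le> \<kappa> * \<omega> (\<psi> t e) (J (\<psi> t e))"
proof (rule quadratic_ratio_bounded)
  note cont = continuous_on_compose2[OF C1_on_interval_continuous[OF \<psi>(1)]] continuous_on_compose2[OF \<psi>']
  show "continuous_on ({a..b} \<times> UNIV) (\<lambda>p. \<omega> (\<psi> (fst p) (snd p)) (\<psi>' (fst p) (snd p)))"
    "continuous_on ({a..b} \<times> UNIV) (\<lambda>p. \<omega> (\<psi> (fst p) (snd p)) (J (\<psi> (fst p) (snd p))))"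
    by (intro bounded_bilinear.continuous_on[OF bounded_bilinear_omega] continuous_intros cont; auto)+
  show "\<omega> (\<psi> t e) (J (\<psi> t e)) > 0" if "t \<in> {a..b}" "e \<noteq> 0" for t e
  proof -
    have "\<psi> t e \<noteq> 0"
      using symplectic_map_inj[OF \<psi>(2)[OF that(1)]] that(2)
          linear_injective_0[OF linear_blinfun, of "\<psi> t"] by blast
    then show ?thesis by (rule J_pos)
  qed
qed (simp_all add: blinfun.scaleR_right omega_simps power2_eq_square)

lemma rotated_transversal_nearby:
  assumes \<psi>: "continuous_on {a..b} \<psi>" "\<And>t. t \<in> {a..b} \<Longrightarrow> symplectic_map \<omega> (\<psi> t)"
    and L: "lagrangian \<omega> L" and C: "lagrangian \<omega> C" and t0: "t0 \<in> {a..b}"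
  shows "\<exists>\<theta>. \<exists>r>0. \<forall>\<phi>. \<forall>t\<in>{a..b}. \<bar>\<phi> - \<theta>\<bar> < r \<longrightarrow> \<bar>t - t0\<bar> < r \<longrightarrow>
    transversal (rotation \<phi> ` \<psi> t ` L) C"
proof -
  let ?D = "UNIV \<times> {a..b}" and ?Q = "\<lambda>p. (rotation (fst p) o\<^sub>L \<psi> (snd p)) ` L"
  have symp: "symplectic_map \<omega> (rotation (fst p) o\<^sub>L \<psi> (snd p))" if "p \<in> ?D" for p
    using that by (intro symplectic_map_compose symplectic_map_rotation \<psi>(2)) auto
  have "continuous_on ?D (\<lambda>p. rotation (fst p) o\<^sub>L \<psi> (snd p))"
    by (intro bounded_bilinear.continuous_on[OF bounded_bilinear_blinfun_compose] continuous_intros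
        continuous_on_compose2[OF \<psi>(1)]) auto
  then have cont: "subspace_continuous_on ?D ?Q"
    by (rule subspace_continuous_on_symplectic_image[OF _ symp L])
  have "\<forall>\<^sub>F \<theta> in at_right 0. transversal (rotation \<theta> ` \<psi> t0 ` L) C"
    by (intro eventually_rotation_transversal symplectic_map_lagrangian[OF \<psi>(2)[OF t0] L] C)
  then obtain \<theta> where "transversal (rotation \<theta> ` \<psi> t0 ` L) C"
    using eventually_happens trivial_limit_at_right_real by blast
  then have \<theta>: "transversal C (?Q (\<theta>, t0))" by (simp add: image_image transversal_sym)
  have "lag_tendsto ?Q (?Q (\<theta>, t0)) (at (\<theta>, t0) within ?D)"
    by (rule subspace_continuous_on_lag_tendsto[OF cont symplectic_map_lagrangian[OF symp L]])
      (use t0 in auto)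
  then have "\<forall>\<^sub>F p in at (\<theta>, t0) within ?D. transversal C (?Q p)" by (rule lag_tendsto_transversal[OF \<theta>])
  then obtain d where d_pos: "d > 0"
    and near: "\<And>p. p \<in> ?D \<Longrightarrow> p \<noteq> (\<theta>, t0) \<Longrightarrow> dist p (\<theta>, t0) < d \<Longrightarrow> transversal C (?Q p)"
    unfolding eventually_at by blast
  show ?thesis
  proof (rule exI[of _ \<theta>], rule exI[of _ "d / 2"], intro conjI allI ballI impI)
    fix \<phi> t assume t: "t \<in> {a..b}" "\<bar>\<phi> - \<theta>\<bar> < d / 2" "\<bar>t - t0\<bar> < d / 2"
    have "dist (\<phi>, t) (\<theta>, t0) \<le> \<bar>\<phi> - \<theta>\<bar> + \<bar>t - t0\<bar>"
      unfolding dist_Pair_Pair dist_real_def by (rule sqrt_sum_squares_le_sum) auto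
    then have "dist (\<phi>, t) (\<theta>, t0) < d" using t(2,3) by simp
    then have "transversal C (?Q (\<phi>, t))" using near[of "(\<phi>, t)"] \<theta> t(1) by (cases "(\<phi>, t) = (\<theta>, t0)") auto
    then show "transversal (rotation \<phi> ` \<psi> t ` L) C" by (simp add: image_image transversal_sym)
  qed (use d_pos in simp)
qed

lemma regular_crossings_rotated:
  assumes ab: "a < b" and \<psi>: "\<And>t. t \<in> {a..b} \<Longrightarrow> (\<psi> has_vector_derivative \<psi>' t) (at t within {a..b})"
      "\<And>t. t \<in> {a..b} \<Longrightarrow> symplectic_map \<omega> (\<psi> t)"
    and f: "\<And>t. t \<in> {a..b} \<Longrightarrow> (f has_vector_derivative f' t) (at t within {a..b})"
    and A: "C1_on_interval a b (rotated f \<psi>)" and L: "lagrangian \<omega> L" and C: "lagrangian \<omega> C"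
    and velocity: "\<And>t e. t \<in> {a..b} \<Longrightarrow> \<bar>\<omega> (\<psi> t e) (\<psi>' t e)\<bar> \<le> \<kappa> * \<omega> (\<psi> t e) (J (\<psi> t e))"
    and fast: "\<And>t. t \<in> {a..b} \<Longrightarrow> is_crossing (\<lambda>t. rotated f \<psi> t ` L) C t \<Longrightarrow> \<bar>f' t\<bar> > \<kappa>"
  shows "regular_crossings \<omega> (\<lambda>t. rotated f \<psi> t ` L) C a b"
  unfolding regular_crossings_def
proof (intro ballI impI crossing_form_definite_nondegenerate[OF ab _ _ C])
  let ?l = "\<lambda>t. rotated f \<psi> t ` L"
  show "lag_C1 \<omega> ?l a b"
    by (rule lag_C1_symplectic_image[OF A symplectic_map_compose[OF symplectic_map_rotation \<psi>(2)] L])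
  fix t v assume t: "t \<in> {a..b}" "is_crossing ?l C t" and "v \<in> ?l t \<inter> C" "v \<noteq> 0"
  then obtain e where e: "e \<in> L" "v = rotated f \<psi> t e" by blast
  let ?x = "\<psi> t e"
  have "?x \<noteq> 0" using \<open>v \<noteq> 0\<close> e(2) by (auto simp: blinfun.zero_right)
  then have "\<kappa> * \<omega> ?x (J ?x) < \<bar>f' t\<bar> * \<omega> ?x (J ?x)" by (intro mult_strict_right_mono fast[OF t] J_pos)
  also have "\<dots> = \<bar>f' t * \<omega> ?x (J ?x)\<bar>" using J_pos[OF \<open>?x \<noteq> 0\<close>] by (simp add: abs_mult)
  finally have "\<kappa> * \<omega> ?x (J ?x) < \<bar>f' t * \<omega> ?x (J ?x)\<bar>" .
  moreover have "crossing_form \<omega> ?l C a b t v = f' t * \<omega> ?x (J ?x) + \<omega> ?x (\<psi>' t e)"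
    unfolding e(2) by (rule crossing_form_rotated[OF ab A \<psi>(2) L t(1) e(1) f[OF t(1)] \<psi>(1)[OF t(1)]])
  ultimately show "crossing_form \<omega> ?l C a b t v \<noteq> 0" using velocity[OF t(1), of e] by linarith
qed

text \<open>Where the rotation is fast it dominates the crossing form; where it is slow the path is
  transversal to \<open>C\<close>.\<close>

lemma regular_rotation_exists:
  assumes ab: "a < b" and \<psi>: "C1_on_interval a b \<psi>" "\<And>t. t \<in> {a..b} \<Longrightarrow> symplectic_map \<omega> (\<psi> t)"
    and L: "lagrangian \<omega> L" and C: "lagrangian \<omega> C"
  obtains l where "lag_C1 \<omega> l a b" "regular_crossings \<omega> l C a b" "lag_homotopic \<omega> a b (\<lambda>t. \<psi> t ` L) l"
proof -
  note cont = C1_on_interval_continuous[OF \<psi>(1)]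
  obtain \<psi>' where \<psi>': "\<And>t. t \<in> {a..b} \<Longrightarrow> (\<psi> has_vector_derivative \<psi>' t) (at t within {a..b})"
    "continuous_on {a..b} \<psi>'" using \<psi>(1) unfolding C1_on_interval_def by blast
  obtain \<kappa> where velocity: "\<And>t e. t \<in> {a..b} \<Longrightarrow> \<bar>\<omega> (\<psi> t e) (\<psi>' t e)\<bar> \<le> \<kappa> * \<omega> (\<psi> t e) (J (\<psi> t e))"
    using rotation_velocity_dominates[OF \<psi> \<psi>'(2)] by blast
  have middle: "(a + b) / 2 \<in> {a..b}" using ab by simp
  obtain \<theta> r where r_pos: "r > 0" and near: "\<And>\<phi> t. t \<in> {a..b} \<Longrightarrow> \<bar>\<phi> - \<theta>\<bar> < r \<Longrightarrow> \<bar>t - (a + b) / 2\<bar> < r \<Longrightarrow>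
      transversal (rotation \<phi> ` \<psi> t ` L) C"
    using rotated_transversal_nearby[OF cont \<psi>(2) L C middle] by metis
  obtain f f' :: "real \<Rightarrow> real" and N :: nat where f: "f a = 0" "f b = 0"
      "\<And>t S. (f has_vector_derivative f' t) (at t within S)" "continuous_on UNIV f'"
    and steep: "\<And>t. \<bar>f' t\<bar> > \<kappa> \<or> \<bar>t - (a + b) / 2\<bar> < r \<and> \<bar>f t - (\<theta> + real N * pi)\<bar> < r"
    by (rule steep_bump_exists[OF ab r_pos]) (rule that; assumption)
  let ?l = "\<lambda>t. rotated f \<psi> t ` L"
  have A: "C1_on_interval a b (rotated f \<psi>)"
    by (rule C1_on_interval_rotated[OF f(3) continuous_on_subset[OF f(4) subset_UNIV] \<psi>'])
  have "regular_crossings \<omega> ?l C a b"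
  proof (rule regular_crossings_rotated[OF ab \<psi>'(1) \<psi>(2) f(3) A L C velocity])
    fix t assume t: "t \<in> {a..b}" "is_crossing ?l C t"
    show "\<bar>f' t\<bar> > \<kappa>"
    proof (rule ccontr)
      assume "\<not> \<bar>f' t\<bar> > \<kappa>"
      then have "transversal (rotation (f t - real N * pi) ` \<psi> t ` L) C"
        using steep[of t] by (intro near[OF t(1)]) (auto simp: algebra_simps)
      moreover have "rotation (f t - real N * pi) ` \<psi> t ` L = ?l t"
        using rotation_image_shift_pi[OF linear_subspace_image[OF linear_blinfun lagrangian_subspace[OF L]],
            of "f t - real N * pi" N "\<psi> t"] by (simp add: image_image)
      ultimately show False using t(2) by (simp add: transversal_def is_crossing_def)
    qed
  qed
  moreover have "lag_C1 \<omega> ?l a b"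
    by (rule lag_C1_symplectic_image[OF A symplectic_map_compose[OF symplectic_map_rotation \<psi>(2)] L])
  moreover have "continuous_on {a..b} f"
    using f(3) by (meson continuous_on_eq_continuous_within has_vector_derivative_continuous)
  then have "lag_homotopic \<omega> a b (\<lambda>t. \<psi> t ` L) ?l"
    using f(1,2) by (rule lag_homotopic_rotated[OF _ _ _ cont \<psi>(2) L])
  ultimately show ?thesis using that by blast
qed

end

subsection \<open>Comparison of the two indices\<close>

context symplectic
begin

lemma iota_CLM_symplectic_image:
  assumes ab: "a < b" and \<psi>: "C1_on_interval a b \<psi>" "\<And>t. t \<in> {a..b} \<Longrightarrow> symplectic_map \<omega> (\<psi> t)"
    and L: "lagrangian \<omega> L" and C: "lagrangian \<omega> C" and M: "primitive C {a..b} (\<lambda>t. \<psi> t ` L) M"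
  shows "iota_CLM \<omega> C (\<lambda>t. \<psi> t ` L) a b = M b - M a"
proof -
  obtain J where "symplectic_rotation \<omega> J" using symplectic_rotation_exists[OF L] .
  then obtain l where "lag_C1 \<omega> l a b" "regular_crossings \<omega> l C a b" "lag_homotopic \<omega> a b (\<lambda>t. \<psi> t ` L) l"
    using symplectic_rotation.regular_rotation_exists[OF _ ab \<psi> L C] by blast
  then show ?thesis by (rule iota_CLM_eq_primitive[OF ab C M])
qed

lemma primitive_difference_triple_index:
  fixes l1 l2 :: "'a::metric_space \<Rightarrow> 'v set"
  assumes D: "connected D" and l: "\<And>t. t \<in> D \<Longrightarrow> lagrangian \<omega> (l1 t)" "\<And>t. t \<in> D \<Longrightarrow> lagrangian \<omega> (l2 t)"
    and cont: "subspace_continuous_on D l1" "subspace_continuous_on D l2"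
    and dims: "\<And>t. t \<in> D \<Longrightarrow> dim (l1 t \<inter> l2 t) = d" and C: "lagrangian \<omega> C"
    and M: "primitive C D l1 M1" "primitive C D l2 M2" and st: "s \<in> D" "t \<in> D"
  shows "M1 s - M2 s + triple_index \<omega> (l1 s) (l2 s) C = M1 t - M2 t + triple_index \<omega> (l1 t) (l2 t) C"
proof (rule connected_local_const[OF D st, of "\<lambda>t. M1 t - M2 t + triple_index \<omega> (l1 t) (l2 t) C"],
    intro ballI)
  fix p assume p: "p \<in> D"
  obtain X where X: "transversal X (l1 p)" "transversal X (l2 p)"
    using common_transversal_exists[OF l(1)[OF p] l(2)[OF p]] .
  have lim: "lag_tendsto l1 (l1 p) (at p within D)" "lag_tendsto l2 (l2 p) (at p within D)"
    using subspace_continuous_on_lag_tendsto[OF _ _ p] cont l by blast+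
  have "\<forall>\<^sub>F q in at p within D. q \<in> D" by (auto simp: eventually_at_filter)
  then have transversal_ev: "\<forall>\<^sub>F q in at p within D. transversal X (l1 q) \<and> transversal X (l2 q) \<and>
      dim (l1 q \<inter> l2 q) = dim (l1 p \<inter> l2 p)"
    using lag_tendsto_transversal[OF X(1) lim(1)] lag_tendsto_transversal[OF X(2) lim(2)]
    by eventually_elim (simp add: dims p)
  have "\<forall>\<^sub>F q in at p within D. form_index (diff_form X (l1 q) (l2 q)) UNIV =
      form_index (diff_form X (l1 p) (l2 p)) UNIV"
    by (rule form_index_diff_form_locally_constant[OF X transversal_ev tendsto_proj[OF X(1) lim(1)]
          tendsto_proj[OF X(2) lim(2)]])
  with transversal_ev primitiveD[OF M(1) p X(1)] primitiveD[OF M(2) p X(2)]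
  show "\<forall>\<^sub>F q in at p within D. M1 p - M2 p + triple_index \<omega> (l1 p) (l2 p) C =
      M1 q - M2 q + triple_index \<omega> (l1 q) (l2 q) C"
  proof eventually_elim
    case (elim q)
    then show ?case
      using triple_index_cocycle[OF _ _ C, of X "l1 q" "l2 q"] triple_index_cocycle[OF X C] by linarith
  qed
qed

theorem iota_CLM_difference:
  assumes ab: "a < b" and \<psi>: "C1_on_interval a b \<psi>" "\<And>t. t \<in> {a..b} \<Longrightarrow> symplectic_map \<omega> (\<psi> t)"
    and L: "lagrangian \<omega> L1" "lagrangian \<omega> L2" and C: "lagrangian \<omega> C"
  shows "iota_CLM \<omega> C (\<lambda>t. \<psi> t ` L1) a b - iota_CLM \<omega> C (\<lambda>t. \<psi> t ` L2) a b =
    triple_index \<omega> (\<psi> a ` L1) (\<psi> a ` L2) C - triple_index \<omega> (\<psi> b ` L1) (\<psi> b ` L2) C"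
proof -
  note l = lag_C1_symplectic_image[OF \<psi> L(1)] lag_C1_symplectic_image[OF \<psi> L(2)]
  obtain M1 where M1: "primitive C {a..b} (\<lambda>t. \<psi> t ` L1) M1" using lag_C1_primitive_exists[OF ab C l(1)] .
  obtain M2 where M2: "primitive C {a..b} (\<lambda>t. \<psi> t ` L2) M2" using lag_C1_primitive_exists[OF ab C l(2)] .
  have "M1 a - M2 a + triple_index \<omega> (\<psi> a ` L1) (\<psi> a ` L2) C =
      M1 b - M2 b + triple_index \<omega> (\<psi> b ` L1) (\<psi> b ` L2) C"
    by (rule primitive_difference_triple_index[OF connected_Icc lag_C1_lagrangian[OF l(1)]
          lag_C1_lagrangian[OF l(2)]
          lag_C1_continuous[OF l(1)] lag_C1_continuous[OF l(2)] dim_symplectic_map_Int[OF \<psi>(2) L] C M1 M2])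
      (use ab in auto)
  then show ?thesis
    using iota_CLM_symplectic_image[OF ab \<psi> L(1) C M1] iota_CLM_symplectic_image[OF ab \<psi> L(2) C M2] by simp
qed

end

theorem theorem4p5:
  fixes \<omega> :: "'v::euclidean_space \<Rightarrow> 'v \<Rightarrow> real"
    and n k :: nat and T :: real
    and L1 L2 L3 :: "'v set"
    and \<psi> :: "real \<Rightarrow> ('v \<Rightarrow>\<^sub>L 'v)"
  assumes symp: "symplectic_form \<omega>"
    and dimV: "DIM('v) = 2 * n"
    and T: "0 < T"
    and lag: "lagrangian \<omega> L1" "lagrangian \<omega> L2" "lagrangian \<omega> L3"
    and psi_sp: "\<forall>t\<in>{0..T}. symplectic_map \<omega> (\<psi> t)"
    and psi_C1: "C1_on_interval 0 T \<psi>"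
    and psi0: "\<psi> 0 = id_blinfun"
    and h1: "plus_curve \<omega> (\<lambda>t. blinfun_apply (\<psi> t) ` L2) L3 0 T"
    and h2: "triple_index \<omega> L1 L2 L3 = int n - int (dim (L1 \<inter> L2))"
    and h3: "dim (L3 \<inter> L2) = k"
    and h4: "iota_CLM \<omega> L3 (\<lambda>t. blinfun_apply (\<psi> t) ` L1) 0 T = int k"
  shows "iota_CLM \<omega> L3 (\<lambda>t. blinfun_apply (\<psi> t) ` L2) 0 T = int k"
proof (rule antisym)
  interpret symplectic \<omega> by unfold_locales (rule symp)
  have start: "\<psi> 0 ` L = L" for L by (simp add: psi0)
  have psi_T: "symplectic_map \<omega> (\<psi> T)" using psi_sp T by simp
  note lag_T = symplectic_map_lagrangian[OF psi_T]
  have "triple_index \<omega> (\<psi> T ` L1) (\<psi> T ` L2) L3 \<le> int (dim (\<psi> T ` L1)) - int (dim (\<psi> T ` L1 \<inter> \<psi> T ` L2))"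
    by (intro triple_index_le lag_T lag)
  also have "\<dots> = triple_index \<omega> L1 L2 L3"
    using lagrangian_dim[OF lag_T[OF lag(1)]] dim_symplectic_map_Int[OF psi_T lag(1,2)] dimV h2 by simp
  finally show "iota_CLM \<omega> L3 (\<lambda>t. \<psi> t ` L2) 0 T \<le> int k"
    using iota_CLM_difference[OF T psi_C1 bspec[OF psi_sp] lag] h4 start by simp
  show "int k \<le> iota_CLM \<omega> L3 (\<lambda>t. \<psi> t ` L2) 0 T"
    using plus_curve_iota_CLM_ge[OF T lag(3) h1] h3 start by (simp add: Int_commute)
qed

end
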